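(* Let $\mathcal P$ be a chiral or directly regular $n$-polytope of type $\{p_1, \ldots, p_{n-1}\}$ such that for all $i=1, \ldots, n-1$ we have $\gcd(p_i, p_{n-i}) = 1$. Then $\mathcal P \diamond \mathcal P^{\delta}$ is a properly self-dual chiral or directly regular $n$-polytope of type $\{p_1 p_{n-1}, p_2p_{n-2}, \ldots, p_{n-1} p_1\}$, and $\Gamma^+(\mathcal P \diamond \mathcal P^{\delta}) = \Gamma^+(\mathcal P) \times \Gamma^+(\mathcal P^{\delta})$.
   Context: An abstract polytope of rank $n$ (an $n$-polytope) is a ranked poset of faces with ranks from $-1$ to $n$, with a unique least face (rank $-1$) and a unique greatest face (rank $n$), in which every flag (maximal chain) has $n+2$ faces, which satisfies the diamond condition (whenever $F<G$ with ranks $j-1$ and $j+1$ there are exactly two $j$-faces strictly between them), and which is strongly flag-connected (any two flags $\Phi,\Psi$ are joined by a sequence of flags, consecutive ones adjacent, all containing $\Phi\cap\Psi$; two flags are adjacent if they differ in exactly one face). $\Phi^j$ denotes the unique flag differing from $\Phi$ only in its $j$-face, and $\Phi^{i,j}=(\Phi^i)^j$. Each polytope considered has a fixed base flag $\Phi$. $\mathcal P$ is regular if its automorphism group $\Gamma(\mathcal P)$ is transitive on flags; then $\Gamma(\mathcal P)$ is generated by $\rho_0,\dots,\rho_{n-1}$, where $\rho_i$ maps $\Phi$ to $\Phi^i$. Put $\sigma_i=\rho_{i-1}\rho_i$ and $\Gamma^+(\mathcal P)=\langle\sigma_1,\dots,\sigma_{n-1}\rangle$; $\mathcal P$ is directly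 regular if it is regular and $\Gamma^+(\mathcal P)$ has index $2$ in $\Gamma(\mathcal P)$. $\mathcal P$ is chiral if $\Gamma(\mathcal P)$ has exactly two orbits on flags and adjacent flags lie in distinct orbits; then $\Gamma^+(\mathcal P):=\Gamma(\mathcal P)$ is generated by $\sigma_1,\dots,\sigma_{n-1}$, where $\sigma_i$ maps $\Phi$ to $\Phi^{i,i-1}$. In both cases $(\sigma_i\cdots\sigma_j)^2=1$ for $i<j$, and the type of $\mathcal P$ is $\{p_1,\dots,p_{n-1}\}$ where $p_i$ is the order of $\sigma_i$. Dual: $\mathcal P^\delta$ is $\mathcal P$ with reversed order; $\Gamma^+(\mathcal P^\delta)$ is the same group with specified generators $\sigma_i'=\sigma_{n-i}^{-1}$, $i=1,\dots,n-1$. A chiral or directly regular polytope is properly self-dual if it has a duality (order-reversing bijection onto itself) fixing the base flag; equivalently $\sigma_i\mapsto\sigma_{n-i}^{-1}$ ($i=1,\dots,n-1$) extends to an automorphism of its rotation group. Intersection property: for a group $G$ with specified generators $\sigma_1,\dots,\sigma_{n-1}$, put $\tau_{i,j}=\sigma_i\cdots\sigma_j$ ($1\le i\le j\le n-1$) and, for $I\subseteq\{0,\dots,n-1\}$, $G_I=\langle\tau_{i,j}\mid i\le j,\ i-1,j\in I\rangle$. $G$ has the intersection property if $G_I\cap G_J=G_{I\cap J}$ for all $I,J$. Known facts: rotation groups of chiral or directly regular $n$-polytopes have the intersection property; conversely, a group generated by $\sigma_1,\dots,\sigma_{n-1}$ with $(\sigma_i\cdots\sigma_j)^2=1$ for $i<j$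 and with the intersection property is the rotation group of a chiral or directly regular $n$-polytope. Mix: $\Gamma^+(\mathcal P)\diamond\Gamma^+(\mathcal Q)$ is the subgroup of $\Gamma^+(\mathcal P)\times\Gamma^+(\mathcal Q)$ generated by $\beta_i=(\sigma_i,\sigma_i')$, where $\sigma_i,\sigma_i'$ are the specified generators of the two groups. $\mathcal P\diamond\mathcal Q$ is the flag-connected pre-polytope (polytope axioms with strong flag-connectedness weakened to flag-connectedness) built from this group, with $\Gamma^+(\mathcal P\diamond\mathcal Q)=\Gamma^+(\mathcal P)\diamond\Gamma^+(\mathcal Q)$; it is a polytope if and only if this group with generators $\beta_i$ has the intersection property, and is then the chiral or directly regular $n$-polytope with this rotation group. *)

theory Defs
  imports
    "HOL-Algebra.Bij"
    "HOL-Algebra.Generated_Groups"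
    "HOL-Algebra.Multiplicative_Group"
begin

record 'a ranked_poset =
  faces :: "'a set"
  face_le :: "'a rel"
  rk :: "'a \<Rightarrow> int"

definition flags :: "('a, 'b) ranked_poset_scheme \<Rightarrow> 'a set set" where
  "flags P = {C \<in> Chains (face_le P). \<forall>D \<in> Chains (face_le P). C \<subseteq> D \<longrightarrow> D = C}"

definition adjacent :: "'a set \<Rightarrow> 'a set \<Rightarrow> bool" where
  "adjacent \<Phi> \<Psi> \<longleftrightarrow> card (\<Phi> - \<Psi>) = 1 \<and> card (\<Psi> - \<Phi>) = 1"

definition strongly_flag_connected :: "('a, 'b) ranked_poset_scheme \<Rightarrow> bool" where
  "strongly_flag_connected P \<longleftrightarrow>
    (\<forall>\<Phi> \<in> flags P. \<forall>\<Psi> \<in> flags P.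
      (\<Phi>, \<Psi>) \<in> {(X, Y). X \<in> flags P \<and> Y \<in> flags P \<and> adjacent X Y
                  \<and> \<Phi> \<inter> \<Psi> \<subseteq> X \<and> \<Phi> \<inter> \<Psi> \<subseteq> Y}\<^sup>*)"

definition polytope :: "nat \<Rightarrow> ('a, 'b) ranked_poset_scheme \<Rightarrow> bool" where
  "polytope n P \<longleftrightarrow>
    partial_order_on (faces P) (face_le P) \<and>
    (\<forall>F \<in> faces P. - 1 \<le> rk P F \<and> rk P F \<le> int n) \<and>
    (\<forall>F G. (F, G) \<in> face_le P \<and> F \<noteq> G \<longrightarrow> rk P F < rk P G) \<and>
    (\<exists>F \<in> faces P. rk P F = - 1 \<and> (\<forall>G \<in> faces P. (F, G) \<in> face_le P)) \<and>
    (\<exists>F \<in> faces P. rk P F = int n \<and> (\<forall>G \<in> faces P. (G, F) \<in> face_le P)) \<and>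
    (\<forall>\<Phi> \<in> flags P. card \<Phi> = n + 2) \<and>
    (\<forall>F G. (F, G) \<in> face_le P \<and> rk P G = rk P F + 2 \<longrightarrow>
      card {H \<in> faces P. rk P H = rk P F + 1 \<and> (F, H) \<in> face_le P \<and> (H, G) \<in> face_le P} = 2) \<and>
    strongly_flag_connected P"

definition flag_adj :: "('a, 'b) ranked_poset_scheme \<Rightarrow> nat \<Rightarrow> 'a set \<Rightarrow> 'a set" where
  "flag_adj P j \<Phi> = (THE \<Psi>. \<Psi> \<in> flags P \<and> \<Psi> \<noteq> \<Phi> \<and>
     {F \<in> \<Psi>. rk P F \<noteq> int j} = {F \<in> \<Phi>. rk P F \<noteq> int j})"

text \<open>Automorphisms act on the right: \<open>f \<otimes> g\<close> is first \<open>f\<close>, then \<open>g\<close>.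
  (The composition in \<^const>\<open>BijGroup\<close> goes the other way round.) With this convention
  \<open>\<rho>\<^sub>i\<^sub>-\<^sub>1 \<otimes> \<rho>\<^sub>i\<close> maps \<open>\<Phi>\<close> to \<open>(\<Phi>\<^sup>i)\<^sup>i\<^sup>-\<^sup>1\<close>, and the products \<open>\<sigma>\<^sub>i \<otimes> \<dots> \<otimes> \<sigma>\<^sub>j\<close> with
  \<open>i < j\<close> are involutions.\<close>

definition aut_group :: "('a, 'b) ranked_poset_scheme \<Rightarrow> ('a \<Rightarrow> 'a) monoid" where
  "aut_group P =
    \<lparr>carrier = {f \<in> Bij (faces P). \<forall>F \<in> faces P. \<forall>G \<in> faces P.
        (f F, f G) \<in> face_le P \<longleftrightarrow> (F, G) \<in> face_le P},
     mult = \<lambda>f g. compose (faces P) g f,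
     one = \<lambda>F \<in> faces P. F\<rparr>"

definition flag_orbit :: "('a, 'b) ranked_poset_scheme \<Rightarrow> 'a set \<Rightarrow> 'a set set" where
  "flag_orbit P \<Phi> = (\<lambda>f. f ` \<Phi>) ` carrier (aut_group P)"

definition regular :: "nat \<Rightarrow> ('a, 'b) ranked_poset_scheme \<Rightarrow> bool" where
  "regular n P \<longleftrightarrow> polytope n P \<and>
    (\<forall>\<Phi> \<in> flags P. \<forall>\<Psi> \<in> flags P. \<exists>f \<in> carrier (aut_group P). f ` \<Phi> = \<Psi>)"

definition chiral :: "nat \<Rightarrow> ('a, 'b) ranked_poset_scheme \<Rightarrow> bool" where
  "chiral n P \<longleftrightarrow> polytope n P \<and> card (flag_orbit P ` flags P) = 2 \<and>
    (\<forall>\<Phi> \<in> flags P. \<forall>\<Psi> \<in> flags P. adjacent \<Phi> \<Psi> \<longrightarrow> flag_orbit P \<Phi> \<noteq> flag_orbit P \<Psi>)"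

text \<open>In what follows \<open>\<Phi>\<close> is the base flag.\<close>

definition aut_to :: "('a, 'b) ranked_poset_scheme \<Rightarrow> 'a set \<Rightarrow> 'a set \<Rightarrow> 'a \<Rightarrow> 'a" where
  "aut_to P \<Phi> \<Psi> = (THE f. f \<in> carrier (aut_group P) \<and> f ` \<Phi> = \<Psi>)"

definition refl_gen :: "('a, 'b) ranked_poset_scheme \<Rightarrow> 'a set \<Rightarrow> nat \<Rightarrow> 'a \<Rightarrow> 'a" where
  "refl_gen P \<Phi> i = aut_to P \<Phi> (flag_adj P i \<Phi>)"

definition rot_gen :: "nat \<Rightarrow> ('a, 'b) ranked_poset_scheme \<Rightarrow> 'a set \<Rightarrow> nat \<Rightarrow> 'a \<Rightarrow> 'a" where
  "rot_gen n P \<Phi> i =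
    (if regular n P then refl_gen P \<Phi> (i - 1) \<otimes>\<^bsub>aut_group P\<^esub> refl_gen P \<Phi> i
     else aut_to P \<Phi> (flag_adj P (i - 1) (flag_adj P i \<Phi>)))"

definition directly_regular :: "nat \<Rightarrow> ('a, 'b) ranked_poset_scheme \<Rightarrow> 'a set \<Rightarrow> bool" where
  "directly_regular n P \<Phi> \<longleftrightarrow> regular n P \<and>
    card (rcosets\<^bsub>aut_group P\<^esub> (generate (aut_group P) (rot_gen n P \<Phi> ` {1..n - 1}))) = 2"

definition rot_group ::
    "nat \<Rightarrow> ('a, 'b) ranked_poset_scheme \<Rightarrow> 'a set \<Rightarrow> ('a \<Rightarrow> 'a) monoid" where
  "rot_group n P \<Phi> = (aut_group P)\<lparr>carrier :=
    (if chiral n P then carrier (aut_group P)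
     else generate (aut_group P) (rot_gen n P \<Phi> ` {1..n - 1}))\<rparr>"

text \<open>\<^const>\<open>group.ord\<close> is \<open>0\<close> for elements of infinite order, so an entry \<open>0\<close> of the type stands for
  \<open>\<infinity>\<close>.\<close>

definition has_type ::
    "nat \<Rightarrow> ('a, 'b) ranked_poset_scheme \<Rightarrow> 'a set \<Rightarrow> (nat \<Rightarrow> nat) \<Rightarrow> bool" where
  "has_type n P \<Phi> p \<longleftrightarrow>
    (\<forall>i \<in> {1..n - 1}. group.ord (rot_group n P \<Phi>) (rot_gen n P \<Phi> i) = p i)"

definition dual :: "nat \<Rightarrow> 'a ranked_poset \<Rightarrow> 'a ranked_poset" where
  "dual n P = \<lparr>faces = faces P, face_le = (face_le P)\<inverse>, rk = \<lambda>F. int n - 1 - rk P F\<rparr>"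

definition properly_self_dual ::
    "nat \<Rightarrow> ('a, 'b) ranked_poset_scheme \<Rightarrow> 'a set \<Rightarrow> bool" where
  "properly_self_dual n P \<Phi> \<longleftrightarrow> (chiral n P \<or> directly_regular n P \<Phi>) \<and>
    (\<exists>d. bij_betw d (faces P) (faces P) \<and>
      (\<forall>F \<in> faces P. \<forall>G \<in> faces P. (d F, d G) \<in> face_le P \<longleftrightarrow> (G, F) \<in> face_le P) \<and>
      d ` \<Phi> = \<Phi>)"

text \<open>
  The ranked poset built from a group \<open>G\<close> with generators \<open>\<sigma>\<^sub>1, \<dots>, \<sigma>\<^sub>n\<^sub>-\<^sub>1\<close> such that
  \<open>(\<sigma>\<^sub>i \<cdots> \<sigma>\<^sub>j)\<^sup>2 = 1\<close> for \<open>i < j\<close>. It has two orbits of flags under \<open>G\<close>, represented by \<open>\<Phi>\<close> and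
  \<open>\<Phi>\<^sup>0\<close>; the pair \<open>(g, False)\<close> stands for \<open>\<Phi>g\<close> and \<open>(g, True)\<close> for \<open>\<Phi>\<^sup>0g\<close>. Since
  \<open>\<sigma>\<^sub>1 \<cdots> \<sigma>\<^sub>i\<close> is to map \<open>\<Phi>\<close> to \<open>(\<Phi>\<^sup>i)\<^sup>0\<close>, we have \<open>(\<Phi>g)\<^sup>i = \<Phi>\<^sup>0 \<sigma>\<^sub>1 \<cdots> \<sigma>\<^sub>i g\<close>, which gives
  \<open>gp_adj\<close>. A \<open>j\<close>-face is identified with the set of flags that contain it: those reachable from one
  another without changing the \<open>j\<close>-face. Two faces are incident iff they have a common flag.

  For \<open>n \<ge> 2\<close> and \<open>0 \<le> j < n\<close>, the pairs \<open>(g, False)\<close> in a \<open>j\<close>-face form a right coset of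
  \<open>\<langle>\<sigma>\<^sub>a \<cdots> \<sigma>\<^sub>b | a - 1 \<noteq> j, b \<noteq> j\<rangle>\<close>, so this is the usual coset poset. Keeping both
  flag orbits makes the construction correct for \<open>n = 1\<close> too, where \<open>G\<close> is trivial but there are two
  vertices.
\<close>

fun rot_prod :: "('g, 'c) monoid_scheme \<Rightarrow> (nat \<Rightarrow> 'g) \<Rightarrow> nat \<Rightarrow> 'g" where
  "rot_prod G s 0 = \<one>\<^bsub>G\<^esub>"
| "rot_prod G s (Suc i) = rot_prod G s i \<otimes>\<^bsub>G\<^esub> s (Suc i)"

definition gp_adj ::
    "('g, 'c) monoid_scheme \<Rightarrow> (nat \<Rightarrow> 'g) \<Rightarrow> nat \<Rightarrow> 'g \<times> bool \<Rightarrow> 'g \<times> bool" where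
  "gp_adj G s i = (\<lambda>(g, b). if b then (inv\<^bsub>G\<^esub> (rot_prod G s i) \<otimes>\<^bsub>G\<^esub> g, False)
                            else (rot_prod G s i \<otimes>\<^bsub>G\<^esub> g, True))"

definition gp_face ::
    "nat \<Rightarrow> ('g, 'c) monoid_scheme \<Rightarrow> (nat \<Rightarrow> 'g) \<Rightarrow> int \<Rightarrow> 'g \<times> bool \<Rightarrow> int \<times> ('g \<times> bool) set" where
  "gp_face n G s j x = (j, {y. (x, y) \<in> {(u, gp_adj G s i u) | u i.
      u \<in> carrier G \<times> UNIV \<and> i < n \<and> int i \<noteq> j}\<^sup>*})"

definition group_poset ::
    "nat \<Rightarrow> ('g, 'c) monoid_scheme \<Rightarrow> (nat \<Rightarrow> 'g) \<Rightarrow> (int \<times> ('g \<times> bool) set) ranked_poset" where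
  "group_poset n G s =
    (let Fs = {gp_face n G s j x | j x. j \<in> {- 1..int n} \<and> x \<in> carrier G \<times> UNIV} in
     \<lparr>faces = Fs,
      face_le = {(F, H). F \<in> Fs \<and> H \<in> Fs \<and> fst F \<le> fst H \<and> snd F \<inter> snd H \<noteq> {}},
      rk = fst\<rparr>)"

definition group_poset_flag ::
    "nat \<Rightarrow> ('g, 'c) monoid_scheme \<Rightarrow> (nat \<Rightarrow> 'g) \<Rightarrow> (int \<times> ('g \<times> bool) set) set" where
  "group_poset_flag n G s = (\<lambda>j. gp_face n G s j (\<one>\<^bsub>G\<^esub>, False)) ` {- 1..int n}"

definition mix_gen ::
    "nat \<Rightarrow> 'a ranked_poset \<Rightarrow> 'a set \<Rightarrow> 'b ranked_poset \<Rightarrow> 'b set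
      \<Rightarrow> nat \<Rightarrow> ('a \<Rightarrow> 'a) \<times> ('b \<Rightarrow> 'b)" where
  "mix_gen n P \<Phi> Q \<Psi> i = (rot_gen n P \<Phi> i, rot_gen n Q \<Psi> i)"

definition mix_group ::
    "nat \<Rightarrow> 'a ranked_poset \<Rightarrow> 'a set \<Rightarrow> 'b ranked_poset \<Rightarrow> 'b set
      \<Rightarrow> (('a \<Rightarrow> 'a) \<times> ('b \<Rightarrow> 'b)) monoid" where
  "mix_group n P \<Phi> Q \<Psi> = (rot_group n P \<Phi> \<times>\<times> rot_group n Q \<Psi>)
    \<lparr>carrier := generate (rot_group n P \<Phi> \<times>\<times> rot_group n Q \<Psi>) (mix_gen n P \<Phi> Q \<Psi> ` {1..n - 1})\<rparr>"

definition mix ::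
    "nat \<Rightarrow> 'a ranked_poset \<Rightarrow> 'a set \<Rightarrow> 'b ranked_poset \<Rightarrow> 'b set
      \<Rightarrow> (int \<times> ((('a \<Rightarrow> 'a) \<times> ('b \<Rightarrow> 'b)) \<times> bool) set) ranked_poset" where
  "mix n P \<Phi> Q \<Psi> = group_poset n (mix_group n P \<Phi> Q \<Psi>) (mix_gen n P \<Phi> Q \<Psi>)"

definition mix_flag ::
    "nat \<Rightarrow> 'a ranked_poset \<Rightarrow> 'a set \<Rightarrow> 'b ranked_poset \<Rightarrow> 'b set
      \<Rightarrow> (int \<times> ((('a \<Rightarrow> 'a) \<times> ('b \<Rightarrow> 'b)) \<times> bool) set) set" where
  "mix_flag n P \<Phi> Q \<Psi> = group_poset_flag n (mix_group n P \<Phi> Q \<Psi>) (mix_gen n P \<Phi> Q \<Psi>)"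

end

theory Submission
  imports Defs "HOL-Number_Theory.Cong"
begin

text \<open>A chiral or directly regular polytope is determined by its flags with the involutions
  \<open>\<Phi> \<mapsto> \<Phi>\<^sup>j\<close>. A set with such involutions comes from a polytope iff elements that agree in their
  \<open>j\<close>-faces for all \<open>j \<in> J\<close> are joined by a word without letters in \<open>J\<close>; this plays the role of the
  intersection property. A flag of the mix is a pair of flags \<open>(X, Y)\<close> of the same colour in the
  bipartite flag graphs, with the involutions acting on both coordinates. Suppose that two such pairs agree in
  their \<open>j\<close>-faces for \<open>j \<in> J\<close>. Then each coordinate can be corrected by its own word \<open>w\<close>, \<open>w'\<close>
  without letters in \<open>J\<close>, and the words have the same parity on each of the intervals into which \<open>J\<close>
  divides the letters. As the orders of \<open>r\<^sub>i r\<^sub>i\<^sub>+\<^sub>1\<close> on the two coordinates are coprime, a power of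
  \<open>r\<^sub>i r\<^sub>i\<^sub>+\<^sub>1\<close> acts as \<open>r\<^sub>i r\<^sub>i\<^sub>+\<^sub>1\<close> on the first and trivially on the second, so the
  difference of \<open>w\<close> and \<open>w'\<close> can be realised by a common word. For \<open>J = {}\<close> this gives connectedness,
  hence the group of the mix is the whole direct product. The duality of the mix exchanges the coordinates.\<close>

section \<open>Systems of adjacency involutions\<close>

text \<open>Stated with flags, the intersection property becomes one condition on words
  (\<open>joined_Int\<close>), which treats flags of both parities alike and still works in rank 1,
  where the rotation group is trivial but there are two flags. Chiral and directly regular polytopes
  are handled at once: what they share is that no rotation takes the base flag \<open>\<Phi>\<close>
  to \<open>\<Phi>\<^sup>0\<close>, so that the images of these two flags under rotations list all
  flags without repetition and the flag graph is bipartite. The price of the bipartition is that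
  every letter moves both coordinates of the mix and changes both colours, so no odd word can act on
  one coordinate alone. Coprimality frees only products of two letters, and once a set
  \<open>J\<close> of letters is forbidden, the two letters must come from the same gap of
  \<open>J\<close>. Hence the correcting words have to be compared gap by gap, and this comparison
  rests on the colours. An order 0 stands for infinity; coprimality then makes the other order 1,
  and no separate case arises.\<close>

definition joined :: "('i \<Rightarrow> 'v \<Rightarrow> 'v) \<Rightarrow> 'i set \<Rightarrow> 'v \<Rightarrow> 'v \<Rightarrow> bool" where
  "joined r K u v \<longleftrightarrow> (\<exists>w \<in> lists K. fold r w u = v)"

lemma joined_refl [simp]: "joined r K u u"
  unfolding joined_def by (rule bexI[of _ "[]"]) auto

lemma joined_foldI: "w \<in> lists K \<Longrightarrow> joined r K u (fold r w u)"
  unfolding joined_def by blast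

lemma joined_step: "i \<in> K \<Longrightarrow> joined r K u (r i u)"
  using joined_foldI[of "[i]" K r u] by auto

lemma joined_trans: "joined r K u v \<Longrightarrow> joined r K v x \<Longrightarrow> joined r K u x"
proof -
  assume "joined r K u v" "joined r K v x"
  then obtain w w' where "w \<in> lists K" "fold r w u = v" "w' \<in> lists K" "fold r w' v = x"
    unfolding joined_def by blast
  then show "joined r K u x"
    unfolding joined_def by (intro bexI[of _ "w @ w'"]) auto
qed

lemma joined_mono: "joined r K u v \<Longrightarrow> K \<subseteq> L \<Longrightarrow> joined r L u v"
  unfolding joined_def using lists_mono by blast

lemma joined_empty: "joined r {} u v \<longleftrightarrow> u = v"
  unfolding joined_def by auto

lemma joined_induct [consumes 1, case_names refl step]:
  assumes "joined r K u v"
    and "Q u"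
    and "\<And>x i. joined r K u x \<Longrightarrow> Q x \<Longrightarrow> i \<in> K \<Longrightarrow> Q (r i x)"
  shows "Q v"
proof -
  obtain w where w: "w \<in> lists K" "fold r w u = v"
    using assms(1) unfolding joined_def by blast
  from w(1) have "Q (fold r w u)"
  proof (induction w rule: rev_induct)
    case Nil
    then show ?case using assms(2) by simp
  next
    case (snoc i w)
    then show ?case
      using assms(3)[OF joined_foldI[of w K r u]] by auto
  qed
  then show ?thesis using w by simp
qed

text \<open>Bridge to \<open>gp_face\<close>, which is defined by a reflexive transitive closure
  restricted to a carrier. As \<open>V\<close> is closed under the letters, words starting in
  \<open>V\<close> never leave it.\<close>

lemma joined_iff_rtrancl:
  assumes "\<And>i x. i \<in> K \<Longrightarrow> x \<in> V \<Longrightarrow> r i x \<in> V" and "u \<in> V"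
  shows "joined r K u v \<longleftrightarrow> (u, v) \<in> {(x, r i x) | x i. x \<in> V \<and> i \<in> K}\<^sup>*"
proof
  assume "joined r K u v"
  then have "(u, v) \<in> {(x, r i x) | x i. x \<in> V \<and> i \<in> K}\<^sup>* \<and> v \<in> V"
  proof (induction rule: joined_induct)
    case refl
    then show ?case using assms(2) by simp
  next
    case (step x i)
    then have "(x, r i x) \<in> {(x, r i x) | x i. x \<in> V \<and> i \<in> K}"
      by blast
    then show ?case
      using step assms(1) by (meson rtrancl.rtrancl_into_rtrancl)
  qed
  then show "(u, v) \<in> {(x, r i x) | x i. x \<in> V \<and> i \<in> K}\<^sup>*"
    by simp
next
  assume "(u, v) \<in> {(x, r i x) | x i. x \<in> V \<and> i \<in> K}\<^sup>*"
  then show "joined r K u v"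
    by (induction rule: rtrancl_induct) (auto intro: joined_trans joined_step)
qed

text \<open>Connectedness is deliberately left out of the axioms, because for the mix it is a
  conclusion.\<close>

locale flag_system =
  fixes n :: nat and V :: "'v set" and r :: "nat \<Rightarrow> 'v \<Rightarrow> 'v"
  assumes adj_in: "i < n \<Longrightarrow> u \<in> V \<Longrightarrow> r i u \<in> V"
    and adj_adj: "i < n \<Longrightarrow> u \<in> V \<Longrightarrow> r i (r i u) = u"
    and adj_commute: "Suc i < j \<Longrightarrow> j < n \<Longrightarrow> u \<in> V \<Longrightarrow> r i (r j u) = r j (r i u)"
begin

lemma fold_in: "w \<in> lists {..<n} \<Longrightarrow> u \<in> V \<Longrightarrow> fold r w u \<in> V"
  by (induction w arbitrary: u) (auto simp: adj_in)

lemma joined_in: "joined r K u v \<Longrightarrow> K \<subseteq> {..<n} \<Longrightarrow> u \<in> V \<Longrightarrow> v \<in> V"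
  unfolding joined_def using fold_in lists_mono by blast

lemma fold_rev_fold: "w \<in> lists {..<n} \<Longrightarrow> u \<in> V \<Longrightarrow> fold r (rev w) (fold r w u) = u"
  by (induction w arbitrary: u) (auto simp: adj_in adj_adj fold_in)

lemma joined_sym:
  assumes "joined r K u v" "K \<subseteq> {..<n}" "u \<in> V"
  shows "joined r K v u"
proof -
  obtain w where w: "w \<in> lists K" "fold r w u = v"
    using assms(1) unfolding joined_def by blast
  moreover have "w \<in> lists {..<n}" using w(1) assms(2) lists_mono by blast
  ultimately have "fold r (rev w) v = u" using fold_rev_fold assms(3) by blast
  moreover have "rev w \<in> lists K" using w(1) by auto
  ultimately show ?thesis unfolding joined_def by blast
qed

lemma adj_commute': "Suc i < j \<or> Suc j < i \<Longrightarrow> i < n \<Longrightarrow> j < n \<Longrightarrow> u \<in> V \<Longrightarrow> r i (r j u) = r j (r i u)"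
  using adj_commute[of i j u] adj_commute[of j i u] by auto

lemma fold_commute_adj:
  "w \<in> lists {..<n} \<Longrightarrow> (\<And>i. i \<in> set w \<Longrightarrow> Suc i < j \<or> Suc j < i) \<Longrightarrow> j < n \<Longrightarrow> u \<in> V \<Longrightarrow>
    fold r w (r j u) = r j (fold r w u)"
proof (induction w arbitrary: u)
  case (Cons i w)
  have i: "i < n" "Suc i < j \<or> Suc j < i" and w: "w \<in> lists {..<n}"
    using Cons.prems(1) Cons.prems(2)[of i] by auto
  have "r i (r j u) = r j (r i u)"
    by (rule adj_commute'[OF i(2,1) Cons.prems(3,4)])
  moreover have "fold r w (r j (r i u)) = r j (fold r w (r i u))"
    by (rule Cons.IH[OF w _ Cons.prems(3) adj_in[OF i(1) Cons.prems(4)]]) (simp add: Cons.prems(2))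
  ultimately show ?case by simp
qed simp

text \<open>Once \<open>j\<close> is absent, every letter below \<open>j\<close> is at distance at
  least two from every letter above it, so the low letters can be moved to the front.\<close>

lemma fold_split:
  assumes "w \<in> lists ({..<n} - {j})" "u \<in> V"
  shows "fold r w u = fold r (filter (\<lambda>i. i > j) w) (fold r (filter (\<lambda>i. i < j) w) u)"
  using assms
proof (induction w arbitrary: u rule: list.induct)
  case Nil
  then show ?case by simp
next
  case (Cons i w)
  have w: "w \<in> lists ({..<n} - {j})" and i: "i < n" "i \<noteq> j"
    using Cons.prems(1) unfolding in_lists_conv_set by simp_all
  have IH: "fold r w (r i u) =
      fold r (filter (\<lambda>i. i > j) w) (fold r (filter (\<lambda>i. i < j) w) (r i u))"
    using Cons.IH[OF w, of "r i u"] adj_in[OF i(1) Cons.prems(2)] by simp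
  show ?case
  proof (cases "i < j")
    case True
    then show ?thesis using IH by simp
  next
    case False
    have "fold r (filter (\<lambda>i. i < j) w) (r i u) = r i (fold r (filter (\<lambda>i. i < j) w) u)"
      by (rule fold_commute_adj) (use w i False Cons.prems in auto)
    then show ?thesis using IH False i by simp
  qed
qed

lemma joined_split:
  assumes "joined r ({..<n} - {j}) u v" "u \<in> V"
  obtains x where "x \<in> V" "joined r {..<min j n} u x" "joined r {j<..<n} x v"
proof -
  obtain w where w: "w \<in> lists ({..<n} - {j})" "fold r w u = v"
    using assms(1) unfolding joined_def by blast
  let ?x = "fold r (filter (\<lambda>i. i < j) w) u"
  have "filter (\<lambda>i. i < j) w \<in> lists {..<min j n}" "filter (\<lambda>i. i > j) w \<in> lists {j<..<n}"
    using w(1) by auto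
  then have "joined r {..<min j n} u ?x" "joined r {j<..<n} ?x v"
    using fold_split[OF w(1) assms(2)] w(2) joined_foldI by metis+
  moreover have "?x \<in> V" by (rule fold_in) (use w assms in auto)
  ultimately show ?thesis using that by blast
qed

end

text \<open>\<open>joined_Int\<close> says that shared faces can be kept all at once if they can be
  kept one at a time. When \<open>J\<close> consists of all letters, it says that a flag is
  determined by its faces.\<close>

locale polytopal_flag_system = flag_system +
  assumes adj_neq: "i < n \<Longrightarrow> u \<in> V \<Longrightarrow> r i u \<noteq> u"
    and joined_Int: "J \<subseteq> {..<n} \<Longrightarrow> u \<in> V \<Longrightarrow> v \<in> V \<Longrightarrow>
      (\<And>j. j \<in> J \<Longrightarrow> joined r ({..<n} - {j}) u v) \<Longrightarrow> joined r ({..<n} - J) u v"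
begin

lemma connected: "u \<in> V \<Longrightarrow> v \<in> V \<Longrightarrow> joined r {..<n} u v"
  using joined_Int[of "{}" u v] by simp

lemma joined_all_eq:
  assumes "u \<in> V" "v \<in> V" "\<And>j. j < n \<Longrightarrow> joined r ({..<n} - {j}) u v"
  shows "u = v"
  using joined_Int[of "{..<n}" u v] assms by (simp add: joined_empty)

text \<open>If two words without the letter \<open>j\<close> lead to the same place, undoing the letters below \<open>j\<close> of
  one by those of the other gives two elements that are joined both by letters below \<open>j\<close> and by
  letters above \<open>j\<close>.\<close>

lemma lower_parts_agree:
  assumes w: "w \<in> lists ({..<n} - {j})" "w' \<in> lists ({..<n} - {j})"
    and u: "u \<in> V" and eq: "fold r w u = fold r w' u"
  shows "fold r (filter (\<lambda>i. i < j) w) u = fold r (filter (\<lambda>i. i < j) w') u"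
proof -
  define l h l' h' where defs: "l = filter (\<lambda>i. i < j) w" "h = filter (\<lambda>i. i > j) w"
    "l' = filter (\<lambda>i. i < j) w'" "h' = filter (\<lambda>i. i > j) w'"
  have lists: "l \<in> lists {..<n}" "l' \<in> lists {..<n}" "h \<in> lists {..<n}" "h' \<in> lists {..<n}"
    using w by (auto simp: defs)
  let ?x = "fold r l u" and ?x' = "fold r l' u"
  have V: "?x \<in> V" "?x' \<in> V" using lists u fold_in by auto
  have "fold r h ?x = fold r h' ?x'"
    using eq fold_split[OF w(1) u] fold_split[OF w(2) u] by (simp add: defs)
  then have "?x' = fold r (h @ rev h') ?x"
    using fold_rev_fold[OF lists(4) V(2)] by simp
  moreover have "h @ rev h' \<in> lists {j<..<n}" using w by (auto simp: defs)
  ultimately have high: "joined r {j<..<n} ?x ?x'"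
    using joined_foldI[of "h @ rev h'" "{j<..<n}" r ?x] by simp
  have "?x' = fold r (rev l @ l') ?x" using fold_rev_fold[OF lists(1) u] by simp
  moreover have "rev l @ l' \<in> lists {i. i < j \<and> i < n}" using w by (auto simp: defs)
  ultimately have low: "joined r {i. i < j \<and> i < n} ?x ?x'"
    using joined_foldI[of "rev l @ l'" "{i. i < j \<and> i < n}" r ?x] by simp
  \<comment> \<open>A word in letters above \<open>j\<close> avoids every \<open>i \<le> j\<close>,
    and one in letters below \<open>j\<close> avoids every \<open>i \<ge> j\<close>; so the two
    elements share every face.\<close>
  have "?x = ?x'"
  proof (rule joined_all_eq[OF V])
    fix i assume "i < n"
    show "joined r ({..<n} - {i}) ?x ?x'"
    proof (cases "i \<le> j")
      case True
      then show ?thesis by (intro joined_mono[OF high]) auto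
    next
      case False
      then show ?thesis by (intro joined_mono[OF low]) auto
    qed
  qed
  then show ?thesis by (simp add: defs)
qed

end

section \<open>Periods of two-letter words and products of flag systems\<close>

lemma fold_replicate_concat: "fold r (concat (replicate k w)) u = (fold r w ^^ k) u"
  by (induction k arbitrary: u) (auto simp: funpow_swap1)

lemma fold_equivariant:
  assumes "\<And>i u. i \<in> K \<Longrightarrow> u \<in> V \<Longrightarrow> r i u \<in> V"
    and "\<And>i u. i \<in> K \<Longrightarrow> u \<in> V \<Longrightarrow> f (r i u) = r' i (f u)"
    and "w \<in> lists K" "u \<in> V"
  shows "f (fold r w u) = fold r' w (f u)"
  using assms(3,4) by (induction w arbitrary: u) (auto simp: assms(1,2))

lemma concat_replicate_in_lists: "w \<in> lists K \<Longrightarrow> concat (replicate k w) \<in> lists K"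
  by (induction k) auto

text \<open>The \<open>a\<close>-th power of \<open>[i, j]\<close> read backwards is the
  \<open>a\<close>-th power of \<open>[j, i]\<close>, and the reversed word is the inverse.\<close>

lemma (in flag_system) period_reverse:
  assumes "i < n" "j < n" "\<And>x. x \<in> V \<Longrightarrow> (fold r [i, j] ^^ a) x = x" "x \<in> V"
  shows "(fold r [j, i] ^^ a) x = x"
proof -
  let ?w = "concat (replicate a [i, j])"
  have w: "?w \<in> lists {..<n}" using assms(1,2) by (intro concat_replicate_in_lists) simp
  have "rev ?w = concat (replicate a [j, i])"
    by (simp add: rev_concat)
  moreover have "fold r ?w x = x" using assms(3)[OF assms(4)] by (simp add: fold_replicate_concat)
  ultimately show ?thesis
    using fold_rev_fold[OF w assms(4)] by (simp only: fold_replicate_concat)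
qed

text \<open>\<open>V\<close> is to be the mix with its two projections; polytopality is assumed of
  the factors and proved for \<open>V\<close>. Letters start at 0, so \<open>p i\<close> and
  \<open>q i\<close> belong to the generator with index \<open>i + 1\<close>. They enter as periods,
  that is, as exponents.\<close>

locale flag_system_product =
  V: flag_system n V r + fst: polytopal_flag_system n V1 r1 + snd: polytopal_flag_system n V2 r2
  for n :: nat and V :: "'u set" and r and V1 :: "'v set" and r1 and V2 :: "'w set" and r2 +
  fixes c :: "'u \<Rightarrow> bool" and c1 :: "'v \<Rightarrow> bool" and c2 :: "'w \<Rightarrow> bool"
    and f1 :: "'u \<Rightarrow> 'v" and f2 :: "'u \<Rightarrow> 'w" and p q :: "nat \<Rightarrow> nat"
  assumes f1_in: "u \<in> V \<Longrightarrow> f1 u \<in> V1" and f2_in: "u \<in> V \<Longrightarrow> f2 u \<in> V2"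
    and f1_adj: "i < n \<Longrightarrow> u \<in> V \<Longrightarrow> f1 (r i u) = r1 i (f1 u)"
    and f2_adj: "i < n \<Longrightarrow> u \<in> V \<Longrightarrow> f2 (r i u) = r2 i (f2 u)"
    and joint_inj: "u \<in> V \<Longrightarrow> v \<in> V \<Longrightarrow> f1 u = f1 v \<Longrightarrow> f2 u = f2 v \<Longrightarrow> u = v"
    and colour1: "i < n \<Longrightarrow> x \<in> V1 \<Longrightarrow> c1 (r1 i x) \<longleftrightarrow> \<not> c1 x"
    and colour2: "i < n \<Longrightarrow> y \<in> V2 \<Longrightarrow> c2 (r2 i y) \<longleftrightarrow> \<not> c2 y"
    and c1_f1: "u \<in> V \<Longrightarrow> c1 (f1 u) = c u" and c2_f2: "u \<in> V \<Longrightarrow> c2 (f2 u) = c u"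
    and period1: "Suc i < n \<Longrightarrow> x \<in> V1 \<Longrightarrow> (fold r1 [i, Suc i] ^^ p i) x = x"
    and period2: "Suc i < n \<Longrightarrow> y \<in> V2 \<Longrightarrow> (fold r2 [i, Suc i] ^^ q i) y = y"
    and coprime: "Suc i < n \<Longrightarrow> coprime (p i) (q i)"
begin

lemma f1_fold: "w \<in> lists {..<n} \<Longrightarrow> u \<in> V \<Longrightarrow> f1 (fold r w u) = fold r1 w (f1 u)"
  by (rule fold_equivariant[of "{..<n}" V]) (auto simp: V.adj_in f1_adj)

lemma f2_fold: "w \<in> lists {..<n} \<Longrightarrow> u \<in> V \<Longrightarrow> f2 (fold r w u) = fold r2 w (f2 u)"
  by (rule fold_equivariant[of "{..<n}" V]) (auto simp: V.adj_in f2_adj)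

lemma c1_fold: "w \<in> lists {..<n} \<Longrightarrow> x \<in> V1 \<Longrightarrow> c1 (fold r1 w x) \<longleftrightarrow> (even (length w) = c1 x)"
  by (induction w arbitrary: x) (auto simp: colour1 fst.adj_in)

lemma c2_fold: "w \<in> lists {..<n} \<Longrightarrow> y \<in> V2 \<Longrightarrow> c2 (fold r2 w y) \<longleftrightarrow> (even (length w) = c2 y)"
  by (induction w arbitrary: y) (auto simp: colour2 snd.adj_in)

text \<open>The witness \<open>w\<close> may depend on \<open>u\<close>, since only the existence of
  a joining word matters in the end. Moving the first coordinate alone is enough, because the second
  will be dealt with by a word applied beforehand.\<close>

definition liftable :: "nat set \<Rightarrow> nat list \<Rightarrow> bool" where
  "liftable K e \<longleftrightarrow> (\<forall>u\<in>V. \<exists>w\<in>lists K. f1 (fold r w u) = fold r1 e (f1 u) \<and> f2 (fold r w u) = f2 u)"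

lemma liftable_Nil: "liftable K []"
  unfolding liftable_def by (auto intro: bexI[of _ "[]"])

lemma liftableE:
  assumes "liftable K e" "u \<in> V"
  obtains w where "w \<in> lists K" "f1 (fold r w u) = fold r1 e (f1 u)" "f2 (fold r w u) = f2 u"
  using assms unfolding liftable_def by auto

lemma liftable_append:
  assumes "liftable K d" "liftable K e" "K \<subseteq> {..<n}"
  shows "liftable K (d @ e)"
  unfolding liftable_def
proof
  fix u assume u: "u \<in> V"
  obtain w where w: "w \<in> lists K" "f1 (fold r w u) = fold r1 d (f1 u)" "f2 (fold r w u) = f2 u"
    by (rule liftableE[OF assms(1) u])
  have "fold r w u \<in> V"
    by (rule V.fold_in[OF _ u]) (use w(1) assms(3) in auto)
  then obtain w' where w': "w' \<in> lists K"
    "f1 (fold r w' (fold r w u)) = fold r1 e (f1 (fold r w u))"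
    "f2 (fold r w' (fold r w u)) = f2 (fold r w u)"
    by (rule liftableE[OF assms(2)])
  show "\<exists>w\<in>lists K. f1 (fold r w u) = fold r1 (d @ e) (f1 u) \<and> f2 (fold r w u) = f2 u"
    by (rule bexI[of _ "w @ w'"]) (use w w' in auto)
qed

text \<open>Only the action of a word on the first factor is visible here, which permits cancelling
  repeated letters and reordering commuting ones.\<close>

lemma liftable_cong:
  assumes "liftable K e" "\<And>x. x \<in> V1 \<Longrightarrow> fold r1 d x = fold r1 e x"
  shows "liftable K d"
  unfolding liftable_def
proof
  fix u assume u: "u \<in> V"
  obtain w where "w \<in> lists K" "f1 (fold r w u) = fold r1 e (f1 u)" "f2 (fold r w u) = f2 u"
    by (rule liftableE[OF assms(1) u])
  then show "\<exists>w\<in>lists K. f1 (fold r w u) = fold r1 d (f1 u) \<and> f2 (fold r w u) = f2 u"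
    unfolding assms(2)[OF f1_in[OF u]] by blast
qed

lemma liftable_pair:
  assumes "i < n" "j < n"
    and per: "\<And>x. x \<in> V1 \<Longrightarrow> (fold r1 [i, j] ^^ a) x = x" "\<And>y. y \<in> V2 \<Longrightarrow> (fold r2 [i, j] ^^ b) y = y"
    and "coprime a b" "i \<in> K" "j \<in> K"
  shows "liftable K [i, j]"
  unfolding liftable_def
proof
  fix u assume u: "u \<in> V"
  \<comment> \<open>The Chinese remainder theorem provides an exponent that is 1 modulo the first
    period and 0 modulo the second.\<close>
  obtain k where k: "[k = 1] (mod a)" "[k = 0] (mod b)"
    using binary_chinese_remainder_nat[OF assms(5)] by blast
  let ?w = "concat (replicate k [i, j])"
  have "(fold r1 [i, j] ^^ k) (f1 u) = (fold r1 [i, j] ^^ 1) (f1 u)"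
    using funpow_mod_eq[OF per(1)[OF f1_in[OF u]], of k] funpow_mod_eq[OF per(1)[OF f1_in[OF u]], of 1]
      k(1) unfolding cong_def by simp
  moreover have "(fold r2 [i, j] ^^ k) (f2 u) = (fold r2 [i, j] ^^ 0) (f2 u)"
    using funpow_mod_eq[OF per(2)[OF f2_in[OF u]], of k] funpow_mod_eq[OF per(2)[OF f2_in[OF u]], of 0]
      k(2) unfolding cong_def by simp
  moreover have w: "?w \<in> lists {..<n}" using assms(1,2) by (intro concat_replicate_in_lists) simp
  ultimately have "f1 (fold r ?w u) = fold r1 [i, j] (f1 u)" "f2 (fold r ?w u) = f2 u"
    unfolding f1_fold[OF w u] f2_fold[OF w u] by (simp_all add: fold_replicate_concat)
  moreover have "?w \<in> lists K" using assms(6,7) by (intro concat_replicate_in_lists) simp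
  ultimately show "\<exists>w\<in>lists K. f1 (fold r w u) = fold r1 [i, j] (f1 u) \<and> f2 (fold r w u) = f2 u"
    by blast
qed

lemma liftable_Suc:
  assumes "Suc i < n" "i \<in> K" "Suc i \<in> K"
  shows "liftable K [i, Suc i]" "liftable K [Suc i, i]"
proof -
  have i: "i < n" using assms by simp
  note P1 = period1[OF assms(1)] and P2 = period2[OF assms(1)]
  show "liftable K [i, Suc i]"
    by (rule liftable_pair[OF i assms(1) P1 P2 coprime[OF assms(1)] assms(2,3)])
  show "liftable K [Suc i, i]"
    by (rule liftable_pair[OF assms(1) i fst.period_reverse[OF i assms(1) P1]
        snd.period_reverse[OF i assms(1) P2] coprime[OF assms(1)] assms(3,2)])
qed

text \<open>Coprimality concerns neighbouring letters only. Distant ones are reached by telescoping: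
  \<open>[a, m] @ [m, Suc m]\<close> acts like \<open>[a, Suc m]\<close>. This is why the whole
  interval from \<open>a\<close> to \<open>b\<close> has to lie in \<open>K\<close>.\<close>

lemma liftable_letters:
  assumes K: "{a..b} \<subseteq> K" "b < n" "K \<subseteq> {..<n}" and "a \<le> b"
  shows "liftable K [a, b] \<and> liftable K [b, a]"
  using \<open>a \<le> b\<close> K(1,2)
proof (induction b rule: dec_induct)
  case base
  then show ?case
    using liftable_cong[OF liftable_Nil, of "[a, a]"] fst.adj_adj by auto
next
  case (step m)
  have "{a..m} \<subseteq> K" using step.prems(1) by (rule subset_trans[rotated]) simp
  then have IH: "liftable K [a, m]" "liftable K [m, a]"
    using step.IH step.prems(2) by simp_all
  have m: "liftable K [m, Suc m]" "liftable K [Suc m, m]"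
  proof -
    have "m \<in> {a..Suc m}" "Suc m \<in> {a..Suc m}" using step.hyps by auto
    then have "m \<in> K" "Suc m \<in> K" using step.prems(1) by blast+
    then show "liftable K [m, Suc m]" "liftable K [Suc m, m]"
      using liftable_Suc step.prems(2) by simp_all
  qed
  have mm: "r1 m (r1 m x) = x" if "x \<in> V1" for x
    by (rule fst.adj_adj[OF _ that]) (use step.prems(2) in simp)
  have a: "a < n" using step by simp
  have "liftable K ([a, m] @ [m, Suc m])" "liftable K ([Suc m, m] @ [m, a])"
    using liftable_append IH m K(3) by blast+
  then show ?case
  proof (intro conjI)
    show "liftable K [a, Suc m]" if "liftable K ([a, m] @ [m, Suc m])"
      by (rule liftable_cong[OF that]) (simp add: mm fst.adj_in[OF a])
    show "liftable K [Suc m, a]" if "liftable K ([Suc m, m] @ [m, a])"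
      by (rule liftable_cong[OF that]) (simp add: mm fst.adj_in[OF step.prems(2)])
  qed
qed

lemma liftable_mono:
  assumes "liftable K e" "K \<subseteq> L"
  shows "liftable L e"
  unfolding liftable_def
proof
  fix u assume u: "u \<in> V"
  obtain w where "w \<in> lists K" "f1 (fold r w u) = fold r1 e (f1 u)" "f2 (fold r w u) = f2 u"
    by (rule liftableE[OF assms(1) u])
  then show "\<exists>w\<in>lists L. f1 (fold r w u) = fold r1 e (f1 u) \<and> f2 (fold r w u) = f2 u"
    using lists_mono[OF assms(2)] by blast
qed

text \<open>An even word is a product of two-letter words, and inside an unbroken interval each of
  these lifts.\<close>

lemma liftable_interval:
  assumes K: "{a..<b} \<subseteq> K" "K \<subseteq> {..<n}" and "e \<in> lists {a..<b}" "b \<le> n" "even (length e)"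
  shows "liftable K e"
  using assms(3,5)
proof (induction e rule: induct_list012)
  case 1
  show ?case by (rule liftable_Nil)
next
  case (3 i j e)
  then have ij: "i \<in> {a..<b}" "j \<in> {a..<b}" by auto
  have "liftable K [i, j]"
  proof (cases "i \<le> j")
    case True
    have "{i..j} \<subseteq> K" using ij K(1) by fastforce
    then show ?thesis using liftable_letters[OF _ _ K(2) True] ij assms(4) by simp
  next
    case False
    have "{j..i} \<subseteq> K" using ij K(1) by fastforce
    then show ?thesis using liftable_letters[OF _ _ K(2), of j i] False ij assms(4) by simp
  qed
  then have "liftable K ([i, j] @ e)"
    using liftable_append[OF _ _ K(2)] 3 by fastforce
  then show ?case by simp
qed simp

text \<open>The parities are counted cumulatively below each \<open>j \<in> J\<close>, which is the
  form in which the colours deliver them; differences give the parity on each gap. The lower end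
  \<open>a\<close> makes the statement inductive: when the gap below the least element of
  \<open>J\<close> is split off, the remainder has the same shape.\<close>

lemma liftable_even:
  assumes "finite J" "K = {a..<n} - J" "set e \<subseteq> K" "even (length e)"
    and "\<And>j. j \<in> J \<Longrightarrow> even (length (filter (\<lambda>i. i < j) e))"
  shows "liftable K e"
  using assms
proof (induction "card J" arbitrary: J K a e)
  case 0
  then show ?case by (intro liftable_interval[of a n K e]) auto
next
  case (Suc m)
  define j where "j = Min J"
  have "J \<noteq> {}" using Suc.hyps(2) by auto
  then have j: "j \<in> J" "\<And>i. i \<in> J \<Longrightarrow> j \<le> i"
    using Suc.prems(1) unfolding j_def by simp_all
  let ?l = "filter (\<lambda>i. i < j) e" and ?h = "filter (\<lambda>i. i > j) e"
  \<comment> \<open>The maximum covers a least element of \<open>J\<close> that lies below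
    \<open>a\<close>; the part split off is then empty.\<close>
  let ?K = "{max a (Suc j)..<n} - (J - {j})"
  have K: "K \<subseteq> {..<n}" using Suc.prems(2) by auto
  have noj: "j \<notin> set e" using Suc.prems(2,3) j(1) by auto
  then have e: "e \<in> lists ({..<n} - {j})" using Suc.prems(3) K by auto
  \<comment> \<open>Passing to the high part lowers every later count by the same even number, so
    the parity conditions are inherited.\<close>
  have count: "length (filter (\<lambda>i. i < k) ?h) + length ?l = length (filter (\<lambda>i. i < k) e)"
    if "j \<le> k" for k
    using noj that by (induction e) auto
  have total: "length ?h + length ?l = length e"
    using noj by (induction e) auto
  have "liftable K ?l"
  proof (rule liftable_interval[OF _ K])
    show "{a..<min j n} \<subseteq> K" using j(2) Suc.prems(2) by fastforce
    show "?l \<in> lists {a..<min j n}" using Suc.prems(2,3) by auto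
    show "even (length ?l)" by (rule Suc.prems(5)[OF j(1)])
  qed simp
  moreover have "liftable ?K ?h"
  proof (rule Suc.hyps(1)[OF _ _ refl])
    show "m = card (J - {j})" using Suc.hyps(2) Suc.prems(1) j(1) by simp
    show "finite (J - {j})" using Suc.prems(1) by simp
    show "set ?h \<subseteq> ?K" using Suc.prems(2,3) by auto
    show "even (length ?h)"
      using total Suc.prems(4) Suc.prems(5)[OF j(1)] by (metis even_add)
    show "even (length (filter (\<lambda>i. i < k) ?h))" if "k \<in> J - {j}" for k
      using count[of k] j(2)[of k] that Suc.prems(5)[OF j(1)] Suc.prems(5)[of k]
      by (metis DiffD1 even_add)
  qed
  then have "liftable K ?h"
    by (rule liftable_mono) (use Suc.prems(2) in auto)
  ultimately have "liftable K (?l @ ?h)"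
    by (rule liftable_append[OF _ _ K])
  then show ?case
    by (rule liftable_cong) (simp add: fst.fold_split[OF e])
qed

text \<open>The low parts of both words lead to the same element, and each letter changes the
  colour.\<close>

lemma even_letters_below:
  assumes w: "w \<in> lists ({..<n} - {j})" "w' \<in> lists ({..<n} - {j})" and u: "u \<in> V1"
    and eq: "fold r1 w u = fold r1 w' u"
  shows "even (length (filter (\<lambda>i. i < j) w)) \<longleftrightarrow> even (length (filter (\<lambda>i. i < j) w'))"
proof -
  have lists: "filter (\<lambda>i. i < j) w \<in> lists {..<n}" "filter (\<lambda>i. i < j) w' \<in> lists {..<n}"
    using w by auto
  show ?thesis
    using c1_fold[OF lists(1) u] c1_fold[OF lists(2) u] fst.lower_parts_agree[OF w u eq] by argo
qed

lemma even_letters_below':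
  assumes w: "w \<in> lists ({..<n} - {j})" "w' \<in> lists ({..<n} - {j})" and u: "u \<in> V2"
    and eq: "fold r2 w u = fold r2 w' u"
  shows "even (length (filter (\<lambda>i. i < j) w)) \<longleftrightarrow> even (length (filter (\<lambda>i. i < j) w'))"
proof -
  have lists: "filter (\<lambda>i. i < j) w \<in> lists {..<n}" "filter (\<lambda>i. i < j) w' \<in> lists {..<n}"
    using w by auto
  show ?thesis
    using c2_fold[OF lists(1) u] c2_fold[OF lists(2) u] snd.lower_parts_agree[OF w u eq] by argo
qed

text \<open>A common word without the letter \<open>j\<close> fixes the parity of the number of letters below \<open>j\<close> for
  both factors, so two words without letters in \<open>J\<close>, one for each factor, differ by an even word on each
  of the intervals into which \<open>J\<close> divides the letters.\<close>

theorem polytopal: "polytopal_flag_system n V r"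
proof
  fix i u assume "i < n" "u \<in> V"
  then show "r i u \<noteq> u"
    using fst.adj_neq[OF _ f1_in] f1_adj by metis
next
  fix J u v
  assume J: "J \<subseteq> {..<n}" and u: "u \<in> V" and v: "v \<in> V"
    and joined: "\<And>j. j \<in> J \<Longrightarrow> joined r ({..<n} - {j}) u v"
  let ?K = "{..<n} - J"
  have lower: "\<exists>x\<in>lists ({..<n} - {j}). fold r1 x (f1 u) = f1 v \<and> fold r2 x (f2 u) = f2 v"
    if "j \<in> J" for j
  proof -
    obtain x where x: "x \<in> lists ({..<n} - {j})" "fold r x u = v"
      using joined[OF \<open>j \<in> J\<close>] unfolding joined_def by blast
    then have "x \<in> lists {..<n}" by auto
    then show ?thesis
      using f1_fold[OF _ u, of x] f2_fold[OF _ u, of x] x by (intro bexI[of _ x]) simp_all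
  qed
  have "joined r1 ({..<n} - {j}) (f1 u) (f1 v)" "joined r2 ({..<n} - {j}) (f2 u) (f2 v)"
    if "j \<in> J" for j
    unfolding joined_def using lower[OF that] by fast+
  then have "joined r1 ?K (f1 u) (f1 v)" "joined r2 ?K (f2 u) (f2 v)"
    using fst.joined_Int[OF J f1_in[OF u] f1_in[OF v]] snd.joined_Int[OF J f2_in[OF u] f2_in[OF v]]
    by simp_all
  then obtain w1 w2 where w1: "w1 \<in> lists ?K" "fold r1 w1 (f1 u) = f1 v"
      and w2: "w2 \<in> lists ?K" "fold r2 w2 (f2 u) = f2 v"
    unfolding joined_def by fast
  have lists: "w1 \<in> lists {..<n}" "w2 \<in> lists {..<n}" "rev w2 \<in> lists {..<n}"
    using w1(1) w2(1) by auto
  \<comment> \<open>The word \<open>w2\<close> is applied first: it brings the second coordinate to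
    its target and may spoil the first. The word \<open>?e\<close> undoes \<open>w2\<close> and then
    performs \<open>w1\<close>; it is lifted so that the second coordinate stays where it
    is.\<close>
  let ?e = "rev w2 @ w1"
  have "liftable ?K ?e"
  proof (rule liftable_even[of J _ 0])
    show "finite J" using J finite_subset by blast
    show "?K = {0..<n} - J" by auto
    show "set ?e \<subseteq> ?K" using w1(1) w2(1) by auto
    \<comment> \<open>The colours of the two coordinates agree at \<open>u\<close> and again at
      \<open>v\<close>, so both words change colour equally often modulo 2.\<close>
    have "even (length w1) \<longleftrightarrow> even (length w2)"
      using c1_fold[OF lists(1) f1_in[OF u]] c2_fold[OF lists(2) f2_in[OF u]] w1(2) w2(2) c1_f1[OF u] c2_f2[OF u] c1_f1[OF v] c2_f2[OF v]
      by (cases "c u") simp_all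
    then show "even (length ?e)" by simp
    show "even (length (filter (\<lambda>i. i < j) ?e))" if "j \<in> J" for j
    proof -
      obtain x where x: "x \<in> lists ({..<n} - {j})"
          "fold r1 x (f1 u) = f1 v" "fold r2 x (f2 u) = f2 v"
        using lower[OF \<open>j \<in> J\<close>] by blast
      have "w1 \<in> lists ({..<n} - {j})" "w2 \<in> lists ({..<n} - {j})"
        using w1(1) w2(1) that by auto
      then have "even (length (filter (\<lambda>i. i < j) w1)) = even (length (filter (\<lambda>i. i < j) w2))"
        using even_letters_below[OF _ x(1) f1_in[OF u]] even_letters_below'[OF _ x(1) f2_in[OF u]]
          x(2,3) w1(2) w2(2) by simp
      then show ?thesis by (simp add: rev_filter[symmetric])
    qed
  qed
  moreover have V: "fold r w2 u \<in> V" by (rule V.fold_in[OF lists(2) u])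
  ultimately obtain x where x: "x \<in> lists ?K"
      "f1 (fold r x (fold r w2 u)) = fold r1 ?e (f1 (fold r w2 u))"
      "f2 (fold r x (fold r w2 u)) = f2 (fold r w2 u)"
    by (rule liftableE)
  have "f1 (fold r x (fold r w2 u)) = f1 v"
    unfolding x(2) f1_fold[OF lists(2) u] fold_append comp_def fst.fold_rev_fold[OF lists(2) f1_in[OF u]]
    by (rule w1(2))
  moreover have "f2 (fold r x (fold r w2 u)) = f2 v"
    unfolding x(3) f2_fold[OF lists(2) u] by (rule w2(2))
  moreover have "fold r x (fold r w2 u) \<in> V"
    by (rule V.fold_in[OF _ V]) (use x(1) in auto)
  ultimately have "fold r (w2 @ x) u = v"
    unfolding fold_append comp_def using joint_inj[OF _ v] by blast
  moreover have "w2 @ x \<in> lists ?K" using w2(1) x(1) by auto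
  ultimately show "joined r ?K u v" unfolding joined_def by (rule bexI)
qed

end

section \<open>The poset of a polytopal flag system\<close>

text \<open>The rank tag separates the two improper faces: for ranks -1 and \<open>n\<close> the
  condition on letters removes none, so in a connected system both consist of all elements.\<close>

definition flag_face :: "nat \<Rightarrow> (nat \<Rightarrow> 'v \<Rightarrow> 'v) \<Rightarrow> int \<Rightarrow> 'v \<Rightarrow> int \<times> 'v set" where
  "flag_face n r j u = (j, {v. joined r {i. i < n \<and> int i \<noteq> j} u v})"

text \<open>The recipe of \<open>group_poset\<close> for an arbitrary system, so that the polytope
  axioms can be checked without a group.\<close>

definition flag_poset :: "nat \<Rightarrow> 'v set \<Rightarrow> (nat \<Rightarrow> 'v \<Rightarrow> 'v) \<Rightarrow> (int \<times> 'v set) ranked_poset" where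
  "flag_poset n V r =
    (let Fs = {flag_face n r j u | j u. j \<in> {- 1..int n} \<and> u \<in> V} in
     \<lparr>faces = Fs,
      face_le = {(F, H). F \<in> Fs \<and> H \<in> Fs \<and> fst F \<le> fst H \<and> snd F \<inter> snd H \<noteq> {}},
      rk = fst\<rparr>)"

definition flag_of :: "nat \<Rightarrow> (nat \<Rightarrow> 'v \<Rightarrow> 'v) \<Rightarrow> 'v \<Rightarrow> (int \<times> 'v set) set" where
  "flag_of n r u = (\<lambda>j. flag_face n r j u) ` {- 1..int n}"

lemma fst_flag_face [simp]: "fst (flag_face n r j u) = j"
  by (simp add: flag_face_def)

lemma flag_face_rank_eq: "flag_face n r i u = flag_face n r j v \<Longrightarrow> i = j"
  by (simp add: flag_face_def)

lemma faces_flag_poset: "faces (flag_poset n V r) = {flag_face n r j u | j u. j \<in> {- 1..int n} \<and> u \<in> V}"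
  and rk_flag_poset: "rk (flag_poset n V r) = fst"
  by (simp_all add: flag_poset_def Let_def)

lemma flag_face_in_poset: "u \<in> V \<Longrightarrow> - 1 \<le> j \<Longrightarrow> j \<le> int n \<Longrightarrow> flag_face n r j u \<in> faces (flag_poset n V r)"
  unfolding faces_flag_poset by (rule CollectI, rule exI[of _ j], rule exI[of _ u]) simp

lemma flag_poset_rank:
  assumes "F \<in> faces (flag_poset n V r)"
  shows "fst F \<in> {- 1..int n}"
  using assms unfolding faces_flag_poset by auto

context flag_system
begin

lemma flag_face_eqI:
  assumes "joined r K u v" "K \<subseteq> {..<n}" "\<And>k. k \<in> K \<Longrightarrow> int k \<noteq> j" "u \<in> V"
  shows "flag_face n r j u = flag_face n r j v"
proof -
  have sub: "K \<subseteq> {i. i < n \<and> int i \<noteq> j}" using assms(2,3) by auto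
  have uv: "joined r {i. i < n \<and> int i \<noteq> j} u v" by (rule joined_mono[OF assms(1) sub])
  have vu: "joined r {i. i < n \<and> int i \<noteq> j} v u" by (rule joined_sym[OF uv _ assms(4)]) auto
  show ?thesis unfolding flag_face_def using joined_trans[OF uv] joined_trans[OF vu] by auto
qed

lemma flag_face_eq_iff:
  assumes "u \<in> V"
  shows "flag_face n r j u = flag_face n r j v \<longleftrightarrow> joined r {i. i < n \<and> int i \<noteq> j} u v"
proof
  assume "flag_face n r j u = flag_face n r j v"
  then have "v \<in> {x. joined r {i. i < n \<and> int i \<noteq> j} u x}"
    unfolding flag_face_def by simp
  then show "joined r {i. i < n \<and> int i \<noteq> j} u v" by simp
next
  assume "joined r {i. i < n \<and> int i \<noteq> j} u v"
  then show "flag_face n r j u = flag_face n r j v"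
    by (rule flag_face_eqI) (use assms in auto)
qed

lemma flag_face_adj:
  assumes "u \<in> V" "k < n" "int k \<noteq> j"
  shows "flag_face n r j (r k u) = flag_face n r j u"
  by (rule flag_face_eqI[of "{k}", symmetric]) (use assms joined_step[of k "{k}" r u] in auto)

text \<open>Faces are equivalence classes of flags, so an element common to two of them represents
  both.\<close>

lemma face_le_flag_poset:
  "(F, H) \<in> face_le (flag_poset n V r) \<longleftrightarrow>
    (\<exists>x\<in>V. \<exists>i j. - 1 \<le> i \<and> i \<le> j \<and> j \<le> int n \<and> F = flag_face n r i x \<and> H = flag_face n r j x)"
proof
  assume "(F, H) \<in> face_le (flag_poset n V r)"
  then have F: "F \<in> faces (flag_poset n V r)" "H \<in> faces (flag_poset n V r)" "fst F \<le> fst H"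
      "snd F \<inter> snd H \<noteq> {}"
    by (simp_all add: flag_poset_def Let_def)
  obtain i u j v where u: "u \<in> V" "F = flag_face n r i u" "- 1 \<le> i" "i \<le> int n"
      and v: "v \<in> V" "H = flag_face n r j v" "- 1 \<le> j" "j \<le> int n"
    using F(1,2) unfolding faces_flag_poset by auto
  obtain x where x: "joined r {k. k < n \<and> int k \<noteq> i} u x" "joined r {k. k < n \<and> int k \<noteq> j} v x"
    using F(4) u(2) v(2) unfolding flag_face_def by auto
  have "x \<in> V" by (rule joined_in[OF x(1) _ u(1)]) auto
  moreover have "F = flag_face n r i x" "H = flag_face n r j x"
    using x u v flag_face_eq_iff by simp_all
  moreover have "i \<le> j" using F(3) u(2) v(2) by simp
  ultimately show "\<exists>x\<in>V. \<exists>i j. - 1 \<le> i \<and> i \<le> j \<and> j \<le> int n \<and>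
      F = flag_face n r i x \<and> H = flag_face n r j x"
    using u(3) v(4) by auto
next
  assume "\<exists>x\<in>V. \<exists>i j. - 1 \<le> i \<and> i \<le> j \<and> j \<le> int n \<and>
      F = flag_face n r i x \<and> H = flag_face n r j x"
  then obtain x i j where x: "x \<in> V" "- 1 \<le> i" "i \<le> j" "j \<le> int n"
      "F = flag_face n r i x" "H = flag_face n r j x"
    by blast
  have "x \<in> snd F" "x \<in> snd H" unfolding x(5,6) flag_face_def by simp_all
  moreover have "F \<in> faces (flag_poset n V r)" "H \<in> faces (flag_poset n V r)"
    unfolding x(5,6) by (rule flag_face_in_poset[OF x(1)]; use x(2-4) in linarith)+
  moreover have "fst F \<le> fst H" using x by simp
  ultimately show "(F, H) \<in> face_le (flag_poset n V r)"
    unfolding flag_poset_def Let_def by auto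
qed

end

context polytopal_flag_system
begin

abbreviation "face \<equiv> flag_face n r"
abbreviation "poset \<equiv> flag_poset n V r"

lemma improper_face_eq:
  assumes "u \<in> V" "v \<in> V" "j < 0 \<or> int n \<le> j"
  shows "face j u = face j v"
  by (rule flag_face_eqI[of "{..<n}"]) (use assms connected in auto)

lemma faces_determine:
  assumes "u \<in> V" "v \<in> V" "\<And>j. j < n \<Longrightarrow> face (int j) u = face (int j) v"
  shows "u = v"
proof (rule joined_all_eq[OF assms(1,2)])
  fix j assume "j < n"
  have "{i. i < n \<and> int i \<noteq> int j} = {..<n} - {j}" by auto
  then show "joined r ({..<n} - {j}) u v"
    using assms(3)[OF \<open>j < n\<close>] flag_face_eq_iff[OF assms(1), of "int j" v] by simp
qed

text \<open>The main tool for chains: two flags through a common \<open>j\<close>-face can exchange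
  their parts above it. Split a word from \<open>v\<close> to \<open>u\<close> without the letter
  \<open>j\<close>: its low letters lead from \<open>v\<close> to \<open>x\<close> and keep the
  faces of rank at least \<open>j\<close>, its high letters lead from \<open>x\<close> to
  \<open>u\<close> and keep those of rank at most \<open>j\<close>.\<close>

lemma splice:
  assumes "u \<in> V" "v \<in> V" "face j u = face j v"
  obtains x where "x \<in> V" "\<And>i. i \<le> j \<Longrightarrow> face i x = face i u" "\<And>i. j \<le> i \<Longrightarrow> face i x = face i v"
proof -
  consider "j < 0" | "int n \<le> j" | k where "j = int k" "k < n"
    by (metis linorder_not_less nonneg_int_cases of_nat_less_iff)
  then show ?thesis
  proof cases
    case 1
    then show ?thesis using that[of v] improper_face_eq[OF assms(2,1)] assms by auto
  next
    case 2
    then show ?thesis using that[of u] improper_face_eq[OF assms(1,2)] assms by auto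
  next
    case 3
    have "{i. i < n \<and> int i \<noteq> j} = {..<n} - {k}" using 3 by auto
    then have "joined r ({..<n} - {k}) v u"
      using flag_face_eq_iff[OF assms(2), of j u] assms(3) by simp
    then obtain x where x: "x \<in> V" "joined r {..<min k n} v x" "joined r {k<..<n} x u"
      using joined_split assms(2) by metis
    show ?thesis
    proof (rule that[OF x(1)])
      show "face i x = face i u" if "i \<le> j" for i
        by (rule flag_face_eqI[OF x(3) _ _ x(1)]) (use that 3 in auto)
      show "face i x = face i v" if "j \<le> i" for i
        by (rule flag_face_eqI[OF x(2) _ _ assms(2), symmetric]) (use that 3 in auto)
    qed
  qed
qed

text \<open>Transitivity is the point: the flags that witness the two incidences share the middle
  face and are spliced there. Antisymmetry comes from the rank tags.\<close>

lemma partial_order_on_poset: "partial_order_on (faces poset) (face_le poset)"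
proof -
  have "face_le poset \<subseteq> faces poset \<times> faces poset"
    by (auto simp: flag_poset_def Let_def)
  moreover have "refl_on (faces poset) (face_le poset)"
    unfolding refl_on_def faces_flag_poset face_le_flag_poset by auto
  moreover have "antisym (face_le poset)"
  proof (rule antisymI)
    fix F G assume "(F, G) \<in> face_le poset" "(G, F) \<in> face_le poset"
    then obtain x i j y k l where "x \<in> V" "i \<le> j" "F = face i x" "G = face j x"
        "k \<le> l" "G = face k y" "F = face l y"
      unfolding face_le_flag_poset by blast
    then show "F = G" using flag_face_rank_eq by (metis order_antisym)
  qed
  moreover have "trans (face_le poset)"
  proof (rule transI)
    fix F G H assume "(F, G) \<in> face_le poset" "(G, H) \<in> face_le poset"
    then obtain x i j y k l where x: "x \<in> V" "- 1 \<le> i" "i \<le> j" "F = face i x" "G = face j x"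
        and y: "y \<in> V" "k \<le> l" "l \<le> int n" "G = face k y" "H = face l y"
      unfolding face_le_flag_poset by blast
    have jk: "j = k" using x(5) y(4) flag_face_rank_eq by metis
    then obtain z where z: "z \<in> V" "\<And>i. i \<le> j \<Longrightarrow> face i z = face i x"
        "\<And>i. j \<le> i \<Longrightarrow> face i z = face i y"
      using splice[OF x(1) y(1), of j] x(5) y(4) by metis
    have "F = face i z" "H = face l z" using z x y jk by auto
    then show "(F, H) \<in> face_le poset"
      unfolding face_le_flag_poset using z(1) x y jk by (intro bexI[of _ z] exI[of _ i] exI[of _ l]) auto
  qed
  ultimately show ?thesis unfolding partial_order_on_def preorder_on_def by blast
qed

lemma face_le_same_rank: "(F, G) \<in> face_le poset \<Longrightarrow> fst F = fst G \<Longrightarrow> F = G"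
  unfolding face_le_flag_poset by auto

lemma chain_rank_inj:
  assumes "C \<in> Chains (face_le poset)"
  shows "inj_on fst C"
proof (rule inj_onI)
  fix F G assume "F \<in> C" "G \<in> C" "fst F = fst G"
  moreover from this have "(F, G) \<in> face_le poset \<or> (G, F) \<in> face_le poset"
    using assms unfolding Chains_def by blast
  ultimately show "F = G" using face_le_same_rank by metis
qed

lemma chain_in_faces: "C \<in> Chains (face_le poset) \<Longrightarrow> F \<in> C \<Longrightarrow> F \<in> faces poset"
  unfolding Chains_def flag_poset_def Let_def by auto

lemma finite_chain:
  assumes "C \<in> Chains (face_le poset)"
  shows "finite C"
proof (rule inj_on_finite[OF chain_rank_inj[OF assms]])
  show "fst ` C \<subseteq> {- 1..int n}"
    using flag_poset_rank[OF chain_in_faces[OF assms]] by (rule image_subsetI)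
qed simp

lemma chain_subset: "C \<in> Chains R \<Longrightarrow> D \<subseteq> C \<Longrightarrow> D \<in> Chains R"
  unfolding Chains_def by blast

text \<open>Faces are added in the order of their ranks. A flag through the earlier faces and a flag
  through the highest of them and the new face are spliced at that highest face.\<close>

lemma chain_common_flag:
  assumes "C \<in> Chains (face_le poset)" "V \<noteq> {}"
  obtains u where "u \<in> V" "C \<subseteq> flag_of n r u"
proof -
  have "\<exists>u\<in>V. \<forall>F\<in>C. F = face (fst F) u"
    using finite_chain[OF assms(1)] assms(1)
  proof (induction rule: finite_ranking_induct[where f = fst])
    case empty
    then show ?case using assms(2) by auto
  next
    case (insert F S)
    then obtain u where u: "u \<in> V" "\<And>G. G \<in> S \<Longrightarrow> G = face (fst G) u"
      using chain_subset[OF insert.prems] by (metis subset_insertI)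
    have F: "F \<in> faces poset" using chain_in_faces[OF insert.prems] by simp
    show ?case
    proof (cases "S = {}")
      case True
      then show ?thesis using F unfolding faces_flag_poset by auto
    next
      case False
      then obtain G where G: "G \<in> S" "\<And>H. H \<in> S \<Longrightarrow> fst H \<le> fst G"
        using insert.hyps(1) Max_in[of "fst ` S"] Max_ge[of "fst ` S"] by fastforce
      have "(G, F) \<in> face_le poset \<or> (F, G) \<in> face_le poset"
        using insert.prems G(1) unfolding Chains_def by blast
      moreover have "fst G \<le> fst F" using insert.hyps G(1) by blast
      moreover have "fst F \<le> fst G" if "(F, G) \<in> face_le poset"
        using that unfolding face_le_flag_poset by auto
      ultimately have "(G, F) \<in> face_le poset"
        using face_le_same_rank by (metis order_antisym)
      then obtain y i j where y: "y \<in> V" "i \<le> j" "G = face i y" "F = face j y"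
        unfolding face_le_flag_poset by blast
      have "face i u = face i y" using u(2)[OF G(1)] y(3) by (metis fst_flag_face)
      then obtain z where z: "z \<in> V" "\<And>k. k \<le> i \<Longrightarrow> face k z = face k u"
          "\<And>k. i \<le> k \<Longrightarrow> face k z = face k y"
        using splice[OF u(1) y(1)] by metis
      have "H = face (fst H) z" if "H \<in> S" for H
        using G(2)[OF that] u(2)[OF that] y(3) z(2) by auto
      moreover have "F = face (fst F) z" using y z(3) by auto
      ultimately show ?thesis using z(1) by auto
    qed
  qed
  then obtain u where u: "u \<in> V" "\<And>F. F \<in> C \<Longrightarrow> F = face (fst F) u" by blast
  have "C \<subseteq> flag_of n r u"
  proof
    fix F assume F: "F \<in> C"
    then have "fst F \<in> {- 1..int n}"
      by (rule flag_poset_rank[OF chain_in_faces[OF assms(1)]])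
    then show "F \<in> flag_of n r u" using u(2)[OF F] unfolding flag_of_def by (rule rev_image_eqI)
  qed
  then show ?thesis using that u(1) by blast
qed

lemma flag_of_chain:
  assumes "u \<in> V"
  shows "flag_of n r u \<in> Chains (face_le poset)"
  unfolding Chains_def
proof (intro CollectI ballI)
  fix F G assume "F \<in> flag_of n r u" "G \<in> flag_of n r u"
  then obtain i j where "i \<in> {- 1..int n}" "F = face i u" "j \<in> {- 1..int n}" "G = face j u"
    unfolding flag_of_def by auto
  then show "(F, G) \<in> face_le poset \<or> (G, F) \<in> face_le poset"
    unfolding face_le_flag_poset using assms
    by (metis atLeastAtMost_iff linorder_linear)
qed

lemma flag_of_subset_eq:
  assumes "flag_of n r u \<subseteq> flag_of n r v" "u \<in> V" "v \<in> V"
  shows "u = v"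
proof (rule faces_determine[OF assms(2,3)])
  fix j assume "j < n"
  then have "face (int j) u \<in> flag_of n r u" unfolding flag_of_def by auto
  then obtain k where "face (int j) u = face k v"
    using assms(1) unfolding flag_of_def by blast
  then show "face (int j) u = face (int j) v" using flag_face_rank_eq by metis
qed

lemma flag_of_inj: "inj_on (flag_of n r) V"
  by (rule inj_onI) (rule flag_of_subset_eq; simp)

text \<open>Every chain lies in some \<open>flag_of\<close>, and none of these contains another.
  \<open>V\<close> has to be inhabited, since the only flag of the empty poset is the empty
  chain.\<close>

lemma flags_poset:
  assumes "V \<noteq> {}"
  shows "flags poset = flag_of n r ` V"
proof
  show "flags poset \<subseteq> flag_of n r ` V"
  proof
    fix C assume "C \<in> flags poset"
    then have C: "C \<in> Chains (face_le poset)" "\<And>D. D \<in> Chains (face_le poset) \<Longrightarrow> C \<subseteq> D \<Longrightarrow> D = C"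
      unfolding flags_def by auto
    obtain u where "u \<in> V" "C \<subseteq> flag_of n r u"
      by (rule chain_common_flag[OF C(1) assms])
    then show "C \<in> flag_of n r ` V" using C(2)[OF flag_of_chain] by blast
  qed
  show "flag_of n r ` V \<subseteq> flags poset"
  proof
    fix C assume "C \<in> flag_of n r ` V"
    then obtain u where u: "u \<in> V" "C = flag_of n r u" by blast
    have "D = C" if D: "D \<in> Chains (face_le poset)" "C \<subseteq> D" for D
    proof -
      obtain v where v: "v \<in> V" "D \<subseteq> flag_of n r v"
        by (rule chain_common_flag[OF D(1) assms])
      then have "u = v" using flag_of_subset_eq[of u v] D(2) u by simp
      then show ?thesis using v u D(2) by blast
    qed
    then show "C \<in> flags poset" unfolding flags_def using flag_of_chain[OF u(1)] u(2) by blast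
  qed
qed

lemma card_flag_of: "card (flag_of n r u) = n + 2"
proof -
  have "inj_on (\<lambda>j. face j u) {- 1..int n}"
    by (rule inj_onI) (rule flag_face_rank_eq)
  then show ?thesis unfolding flag_of_def by (simp add: card_image)
qed

lemma face_adj_neq:
  assumes "u \<in> V" "j < n"
  shows "face (int j) (r j u) \<noteq> face (int j) u"
proof
  assume "face (int j) (r j u) = face (int j) u"
  then have "face (int i) (r j u) = face (int i) u" if "i < n" for i
    using flag_face_adj[OF assms, of "int i"] by (cases "i = j") auto
  then have "r j u = u" by (intro faces_determine) (use assms adj_in in auto)
  then show False using adj_neq assms by blast
qed

lemma flag_of_minus_adj:
  assumes "u \<in> V" "j < n"
  shows "flag_of n r u - flag_of n r (r j u) = {face (int j) u}"
proof (intro equalityI subsetI)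
  fix F assume F: "F \<in> flag_of n r u - flag_of n r (r j u)"
  then obtain i where i: "i \<in> {- 1..int n}" "F = face i u" unfolding flag_of_def by blast
  moreover have "face i (r j u) \<in> flag_of n r (r j u)" using i unfolding flag_of_def by blast
  ultimately show "F \<in> {face (int j) u}"
    using F flag_face_adj[OF assms, of i] by (cases "i = int j") auto
next
  fix F assume F: "F \<in> {face (int j) u}"
  have "F \<notin> flag_of n r (r j u)"
  proof
    assume "F \<in> flag_of n r (r j u)"
    then obtain i where "F = face i (r j u)" unfolding flag_of_def by blast
    then show False using F face_adj_neq[OF assms] flag_face_rank_eq by (metis singletonD)
  qed
  moreover have "F \<in> flag_of n r u" using F assms(2) unfolding flag_of_def by auto
  ultimately show "F \<in> flag_of n r u - flag_of n r (r j u)" by blast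
qed

lemma adjacent_flag_of:
  assumes "u \<in> V" "j < n"
  shows "adjacent (flag_of n r u) (flag_of n r (r j u))"
  unfolding adjacent_def
  using flag_of_minus_adj[OF assms] flag_of_minus_adj[OF adj_in[OF assms(2,1)] assms(2)]
  by (simp add: adj_adj assms)

text \<open>With \<open>J\<close> the set of ranks at which the two flags agree,
  \<open>joined_Int\<close> supplies a path that avoids \<open>J\<close>, and every flag on it keeps
  the common faces. The improper faces survive too, since no letter has rank -1 or
  \<open>n\<close>.\<close>

lemma strongly_flag_connected_poset:
  assumes "V \<noteq> {}"
  shows "strongly_flag_connected poset"
  unfolding strongly_flag_connected_def flags_poset[OF assms]
proof (intro ballI)
  fix X Y assume "X \<in> flag_of n r ` V" "Y \<in> flag_of n r ` V"
  then obtain u v where u: "u \<in> V" "X = flag_of n r u" and v: "v \<in> V" "Y = flag_of n r v" by blast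
  define J where "J = {j. j < n \<and> face (int j) u = face (int j) v}"
  have "joined r ({..<n} - J) u v"
  proof (rule joined_Int[OF _ u(1) v(1)])
    fix j assume j: "j \<in> J"
    have "{i. i < n \<and> int i \<noteq> int j} = {..<n} - {j}" by auto
    then show "joined r ({..<n} - {j}) u v"
      using j flag_face_eq_iff[OF u(1), of "int j" v] unfolding J_def by simp
  qed (auto simp: J_def)
  define S where "S = {(Z, W). Z \<in> flag_of n r ` V \<and> W \<in> flag_of n r ` V \<and> adjacent Z W \<and>
      X \<inter> Y \<subseteq> Z \<and> X \<inter> Y \<subseteq> W}"
  have sub: "X \<inter> Y \<subseteq> flag_of n r x" if x: "joined r ({..<n} - J) u x" for x
  proof
    fix F assume F: "F \<in> X \<inter> Y"
    then obtain j where j: "j \<in> {- 1..int n}" "F = face j u" "F = face j v"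
      unfolding u v flag_of_def using flag_face_rank_eq by (smt (verit) IntE imageE)
    have "face j u = face j x"
      by (rule flag_face_eqI[OF x _ _ u(1)]) (use j J_def in auto)
    then show "F \<in> flag_of n r x" using j(1,2) unfolding flag_of_def by simp
  qed
  from \<open>joined r ({..<n} - J) u v\<close> have "(X, flag_of n r v) \<in> S\<^sup>*"
  proof (induction rule: joined_induct)
    case refl
    then show ?case using u by simp
  next
    case (step x i)
    have "x \<in> V" by (rule joined_in[OF step.hyps(1) _ u(1)]) auto
    moreover have "joined r ({..<n} - J) u (r i x)"
      using step.hyps joined_step joined_trans by metis
    ultimately have "(flag_of n r x, flag_of n r (r i x)) \<in> S"
      using step.hyps sub adjacent_flag_of adj_in unfolding S_def by simp
    then show ?case using step.IH by (rule rtrancl_into_rtrancl[rotated])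
  qed
  then show "(X, Y) \<in> {(Z, W). Z \<in> flag_of n r ` V \<and> W \<in> flag_of n r ` V \<and> adjacent Z W \<and>
      X \<inter> Y \<subseteq> Z \<and> X \<inter> Y \<subseteq> W}\<^sup>*"
    using v(2) unfolding S_def by simp
qed

text \<open>For \<open>H\<close> between \<open>F\<close> and \<open>G\<close>, a flag through
  \<open>F\<close>, \<open>H\<close> and one through \<open>H\<close>, \<open>G\<close> are spliced
  into one flag \<open>w\<close>. It shares \<open>F\<close> and \<open>G\<close> with
  \<open>x\<close>, so it is joined to \<open>x\<close> by letters other than the neighbours of
  \<open>j\<close>; among these only \<open>j\<close> affects the \<open>j\<close>-face, and the
  others commute with it.\<close>

lemma diamond:
  assumes "(F, G) \<in> face_le poset" "fst G = fst F + 2"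
  shows "card {H \<in> faces poset. fst H = fst F + 1 \<and> (F, H) \<in> face_le poset \<and> (H, G) \<in> face_le poset} = 2"
proof -
  obtain x i where x: "x \<in> V" "- 1 \<le> i" "i + 2 \<le> int n" "F = face i x" "G = face (i + 2) x"
    using assms unfolding face_le_flag_poset by auto
  define j where "j = nat (i + 1)"
  have j: "int j = i + 1" "j < n" using x by (auto simp: j_def)
  have rx: "r j x \<in> V" using adj_in j x by blast
  have "{H \<in> faces poset. fst H = fst F + 1 \<and> (F, H) \<in> face_le poset \<and> (H, G) \<in> face_le poset} =
      {face (int j) x, face (int j) (r j x)}" (is "?L = ?R")
  proof
    have FG: "F = face i (r j x)" "G = face (i + 2) (r j x)"
      using x flag_face_adj[OF x(1) j(2)] j(1) by simp_all
    have ij: "- 1 \<le> int j" "int j \<le> int n" "i \<le> int j" "int j \<le> i + 2" using j x by auto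
    have "H \<in> ?L" if y: "H = face (int j) y" "y \<in> V" "F = face i y" "G = face (i + 2) y" for H y
    proof -
      have "H \<in> faces poset"
        unfolding y(1) by (rule flag_face_in_poset[OF y(2) ij(1,2)])
      moreover have "fst H = fst F + 1" using y j by simp
      moreover have "(F, H) \<in> face_le poset" "(H, G) \<in> face_le poset"
        unfolding face_le_flag_poset using y ij x(2,3) by blast+
      ultimately show ?thesis by simp
    qed
    note in_L = this
    have "face (int j) x \<in> ?L" by (rule in_L[OF refl x(1,4,5)])
    moreover have "face (int j) (r j x) \<in> ?L" by (rule in_L[OF refl rx FG])
    ultimately show "?R \<subseteq> ?L" by blast
    show "?L \<subseteq> ?R"
    proof
      fix H assume "H \<in> ?L"
      then have H: "fst H = int j" "(F, H) \<in> face_le poset" "(H, G) \<in> face_le poset"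
        using x(4) j(1) by simp_all
      from H(2) obtain y k l where y': "y \<in> V" "F = face k y" "H = face l y"
        unfolding face_le_flag_poset by blast
      have y: "y \<in> V" "F = face i y" "H = face (int j) y"
        using y' H(1) x(4) flag_face_rank_eq[of n r i x k y] by auto
      from H(3) obtain z k l where z': "z \<in> V" "H = face k z" "G = face l z"
        unfolding face_le_flag_poset by blast
      have z: "z \<in> V" "H = face (int j) z" "G = face (i + 2) z"
        using z' H(1) x(5) flag_face_rank_eq[of n r "i + 2" x l z] by auto
      from y z obtain w where w: "w \<in> V" "\<And>k. k \<le> int j \<Longrightarrow> face k w = face k y"
          "\<And>k. int j \<le> k \<Longrightarrow> face k w = face k z"
        using splice[OF y(1) z(1), of "int j"] by metis
      have w': "face i w = face i x"
        using w(2)[OF ij(3)] y(2) x(4) by simp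
      have wH: "face (int j) w = H"
        using w(2)[of "int j"] y(3) by simp
      have w'': "face (i + 2) w = face (i + 2) x"
        using w(3)[OF ij(4)] z(3) x(5) by simp
      \<comment> \<open>If \<open>F\<close> or \<open>G\<close> is improper, its rank is not a
        letter and nothing is removed for it.\<close>
      define J where "J = {k. k < n \<and> (int k = i \<or> int k = i + 2)}"
      have "joined r ({..<n} - J) x w"
      proof (rule joined_Int[OF _ x(1) w(1)])
        fix k assume k: "k \<in> J"
        have "{l. l < n \<and> int l \<noteq> int k} = {..<n} - {k}" by auto
        moreover have "int k = i \<or> int k = i + 2" using k unfolding J_def by simp
        then have "face (int k) x = face (int k) w" using w' w'' by metis
        ultimately show "joined r ({..<n} - {k}) x w"
          using flag_face_eq_iff[OF x(1), of "int k" w] by simp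
      qed (auto simp: J_def)
      \<comment> \<open>The \<open>j\<close>-faces of \<open>w\<close> and of \<open>r j w\<close>
        are tracked together, so that the induction survives a letter \<open>j\<close>, which
        interchanges them.\<close>
      then have "face (int j) w = face (int j) x \<and> face (int j) (r j w) = face (int j) (r j x) \<or>
          face (int j) w = face (int j) (r j x) \<and> face (int j) (r j w) = face (int j) x"
      proof (induction rule: joined_induct)
        case refl
        then show ?case by simp
      next
        case (step y k)
        have y: "y \<in> V" by (rule joined_in[OF step.hyps(1) _ x(1)]) auto
        show ?case
        proof (cases "k = j")
          case True
          then show ?thesis using step.IH adj_adj[OF j(2) y] by auto
        next
          case False
          have k: "k < n" "Suc k < j \<or> Suc j < k"
            using step.hyps(2) False j unfolding J_def by auto
          then have "face (int j) (r k y) = face (int j) y"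
            using flag_face_adj[OF y k(1)] False by simp
          moreover have "r j (r k y) = r k (r j y)"
            using adj_commute'[of j k y] k j y by blast
          then have "face (int j) (r j (r k y)) = face (int j) (r j y)"
            using flag_face_adj[OF adj_in[OF j(2) y] k(1)] False by simp
          ultimately show ?thesis using step.IH by simp
        qed
      qed
      then show "H \<in> ?R" using wH by auto
    qed
  qed
  moreover have "face (int j) x \<noteq> face (int j) (r j x)"
    using face_adj_neq[OF x(1) j(2)] by simp
  ultimately show ?thesis by simp
qed

theorem polytope_poset:
  assumes "V \<noteq> {}"
  shows "polytope n poset"
proof -
  obtain u where u: "u \<in> V" using assms by blast
  have least: "face (- 1) u \<in> faces poset" "face (int n) u \<in> faces poset"
    by (rule flag_face_in_poset[OF u]; simp)+
  have bounds: "(face (- 1) u, F) \<in> face_le poset" "(F, face (int n) u) \<in> face_le poset" if "F \<in> faces poset" for F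
  proof -
    obtain j v where v: "F = face j v" "j \<in> {- 1..int n}" "v \<in> V"
      using \<open>F \<in> faces poset\<close> unfolding faces_flag_poset by blast
    have "face (- 1) u = face (- 1) v" "face (int n) u = face (int n) v"
      using improper_face_eq[OF u v(3)] by auto
    then show "(face (- 1) u, F) \<in> face_le poset" "(F, face (int n) u) \<in> face_le poset"
      unfolding face_le_flag_poset using v by auto
  qed
  have less: "fst F < fst G" if FG: "(F, G) \<in> face_le poset" "F \<noteq> G" for F G
  proof -
    have "fst F \<le> fst G" using FG(1) unfolding face_le_flag_poset by auto
    then show ?thesis using face_le_same_rank[OF FG(1)] FG(2) by linarith
  qed
  show ?thesis
    unfolding polytope_def rk_flag_poset
  proof (intro conjI)
    show "partial_order_on (faces poset) (face_le poset)" by (rule partial_order_on_poset)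
    show "\<forall>F\<in>faces poset. - 1 \<le> fst F \<and> fst F \<le> int n"
      using flag_poset_rank[of _ n V r] by simp
    show "\<forall>F G. (F, G) \<in> face_le poset \<and> F \<noteq> G \<longrightarrow> fst F < fst G" using less by blast
    show "\<exists>F\<in>faces poset. fst F = - 1 \<and> (\<forall>G\<in>faces poset. (F, G) \<in> face_le poset)"
      using bounds(1) by (intro bexI[OF _ least(1)]) simp
    show "\<exists>F\<in>faces poset. fst F = int n \<and> (\<forall>G\<in>faces poset. (G, F) \<in> face_le poset)"
      using bounds(2) by (intro bexI[OF _ least(2)]) simp
    show "\<forall>C\<in>flags poset. card C = n + 2"
      unfolding flags_poset[OF assms] using card_flag_of by blast
    show "\<forall>F G. (F, G) \<in> face_le poset \<and> fst G = fst F + 2 \<longrightarrow>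
        card {H \<in> faces poset. fst H = fst F + 1 \<and> (F, H) \<in> face_le poset \<and> (H, G) \<in> face_le poset} = 2"
      using diamond by blast
    show "strongly_flag_connected poset" by (rule strongly_flag_connected_poset[OF assms])
  qed
qed

lemma flag_adj_flag_of:
  assumes "u \<in> V" "j < n"
  shows "flag_adj poset j (flag_of n r u) = flag_of n r (r j u)"
  unfolding flag_adj_def rk_flag_poset
proof (rule the_equality)
  have V: "V \<noteq> {}" using assms by blast
  have ru: "r j u \<in> V" using adj_in assms by blast
  have face_at: "{F \<in> flag_of n r v. fst F \<noteq> int j} = (\<lambda>i. face i v) ` ({- 1..int n} - {int j})" for v
    unfolding flag_of_def by auto
  have "flag_of n r (r j u) \<noteq> flag_of n r u"
    using flag_of_minus_adj[OF assms] by auto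
  moreover have "{F \<in> flag_of n r (r j u). fst F \<noteq> int j} = {F \<in> flag_of n r u. fst F \<noteq> int j}"
    unfolding face_at using flag_face_adj[OF assms] by (intro image_cong) auto
  ultimately show "flag_of n r (r j u) \<in> flags poset \<and> flag_of n r (r j u) \<noteq> flag_of n r u \<and>
      {F \<in> flag_of n r (r j u). fst F \<noteq> int j} = {F \<in> flag_of n r u. fst F \<noteq> int j}"
    using ru unfolding flags_poset[OF V] by blast
  fix Y assume Y: "Y \<in> flags poset \<and> Y \<noteq> flag_of n r u \<and>
      {F \<in> Y. fst F \<noteq> int j} = {F \<in> flag_of n r u. fst F \<noteq> int j}"
  then obtain v where v: "v \<in> V" "Y = flag_of n r v" unfolding flags_poset[OF V] by blast
  have eq: "face (int i) u = face (int i) v" if "i < n" "i \<noteq> j" for i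
  proof -
    have "face (int i) u \<in> (\<lambda>k. face k u) ` ({- 1..int n} - {int j})" using that by auto
    also have "\<dots> = (\<lambda>k. face k v) ` ({- 1..int n} - {int j})"
      using Y unfolding v face_at by simp
    finally obtain k where "face (int i) u = face k v" by blast
    then show ?thesis using flag_face_rank_eq by metis
  qed
  \<comment> \<open>With all letters except \<open>j\<close> forbidden, only words in
    \<open>j\<close> remain, which leaves the two candidates \<open>u\<close> and
    \<open>r j u\<close>.\<close>
  have "joined r ({..<n} - ({..<n} - {j})) u v"
  proof (rule joined_Int[OF _ assms(1) v(1)])
    fix i assume i: "i \<in> {..<n} - {j}"
    have "{k. k < n \<and> int k \<noteq> int i} = {..<n} - {i}" by auto
    then show "joined r ({..<n} - {i}) u v"
      using eq[of i] i flag_face_eq_iff[OF assms(1), of "int i" v] by simp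
  qed simp
  then have "joined r {j} u v" using assms(2) by (simp add: Diff_Diff_Int)
  then have "v = u \<or> v = r j u"
    by (induction rule: joined_induct) (use adj_adj assms in auto)
  then show "Y = flag_of n r (r j u)" using Y v by auto
qed

end

section \<open>Flags of a polytope\<close>

locale abstract_polytope =
  fixes n :: nat and P :: "('a, 'b) ranked_poset_scheme"
  assumes polytope: "polytope n P"
begin

lemma partial_order: "partial_order_on (faces P) (face_le P)"
  using polytope unfolding polytope_def by (rule conjunct1)

lemma le_faces: "(F, G) \<in> face_le P \<Longrightarrow> F \<in> faces P \<and> G \<in> faces P"
  using partial_order_onD(4)[OF partial_order] by blast

lemma le_refl: "F \<in> faces P \<Longrightarrow> (F, F) \<in> face_le P"
  using partial_order_onD(1)[OF partial_order] unfolding refl_on_def by blast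

lemma le_trans: "(F, G) \<in> face_le P \<Longrightarrow> (G, H) \<in> face_le P \<Longrightarrow> (F, H) \<in> face_le P"
  using partial_order_onD(2)[OF partial_order] by (rule transD)

lemma rk_bounds: "F \<in> faces P \<Longrightarrow> rk P F \<in> {- 1..int n}"
  using polytope unfolding polytope_def by simp

lemma rk_less: "(F, G) \<in> face_le P \<Longrightarrow> F \<noteq> G \<Longrightarrow> rk P F < rk P G"
  using polytope unfolding polytope_def by blast

lemma card_flag: "X \<in> flags P \<Longrightarrow> card X = n + 2"
  using polytope unfolding polytope_def by blast

lemma card_between: "(F, G) \<in> face_le P \<Longrightarrow> rk P G = rk P F + 2 \<Longrightarrow>
    card {H \<in> faces P. rk P H = rk P F + 1 \<and> (F, H) \<in> face_le P \<and> (H, G) \<in> face_le P} = 2"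
  using polytope unfolding polytope_def by blast

lemma strongly_connected: "strongly_flag_connected P"
  using polytope unfolding polytope_def by blast

lemma chain_faces: "C \<in> Chains (face_le P) \<Longrightarrow> F \<in> C \<Longrightarrow> F \<in> faces P"
  unfolding Chains_def using le_faces by blast

lemma chain_rk_inj:
  assumes "C \<in> Chains (face_le P)"
  shows "inj_on (rk P) C"
proof (rule inj_onI, rule ccontr)
  fix F G assume "F \<in> C" "G \<in> C" "rk P F = rk P G" "F \<noteq> G"
  moreover from this have "(F, G) \<in> face_le P \<or> (G, F) \<in> face_le P"
    using assms unfolding Chains_def by blast
  ultimately show False using rk_less[of F G] rk_less[of G F] by auto
qed

lemma chain_rk: "C \<in> Chains (face_le P) \<Longrightarrow> rk P ` C \<subseteq> {- 1..int n}"
  using chain_faces rk_bounds by blast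

lemma chain_finite: "C \<in> Chains (face_le P) \<Longrightarrow> finite C"
  using inj_on_finite[OF chain_rk_inj chain_rk] by simp

lemma chain_card_le:
  assumes "C \<in> Chains (face_le P)"
  shows "card C \<le> n + 2"
  using card_inj_on_le[OF chain_rk_inj[OF assms] chain_rk[OF assms]] by simp

lemma flagI:
  assumes "C \<in> Chains (face_le P)" "card C = n + 2"
  shows "C \<in> flags P"
  unfolding flags_def
proof (intro CollectI conjI ballI impI)
  fix D assume "D \<in> Chains (face_le P)" "C \<subseteq> D"
  then show "D = C"
    using card_seteq[OF chain_finite[of D], of C] chain_card_le[of D] assms(2) by simp
qed (rule assms(1))

lemma flag_chain: "X \<in> flags P \<Longrightarrow> X \<in> Chains (face_le P)"
  unfolding flags_def by blast

lemma flag_faces: "X \<in> flags P \<Longrightarrow> X \<subseteq> faces P"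
  using chain_faces flag_chain by blast

text \<open>Chains have bounded size, so there is a largest one containing \<open>F\<close>, and it
  is maximal among all chains.\<close>

lemma face_in_flag:
  assumes "F \<in> faces P"
  obtains X where "X \<in> flags P" "F \<in> X"
proof -
  let ?Q = "\<lambda>C. C \<in> Chains (face_le P) \<and> F \<in> C"
  have "?Q {F}" unfolding Chains_def using le_refl[OF assms] by blast
  then obtain C where C: "?Q C" "\<And>D. ?Q D \<Longrightarrow> card D \<le> card C"
    using ex_has_greatest_nat[of ?Q "{F}" card "n + 3"] chain_card_le by fastforce
  have "C \<in> flags P"
    unfolding flags_def
  proof (intro CollectI conjI ballI impI)
    fix D assume "D \<in> Chains (face_le P)" "C \<subseteq> D"
    then show "D = C" using C card_seteq[OF chain_finite[of D], of C] by blast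
  qed (use C(1) in blast)
  then show ?thesis using that C(1) by blast
qed

lemma flag_rk_bij:
  assumes "X \<in> flags P"
  shows "bij_betw (rk P) X {- 1..int n}"
proof -
  have "card (rk P ` X) = n + 2"
    using card_image[OF chain_rk_inj[OF flag_chain[OF assms]]] card_flag[OF assms] by simp
  then have "rk P ` X = {- 1..int n}"
    using card_subset_eq[of "{- 1..int n}" "rk P ` X"] chain_rk[OF flag_chain[OF assms]] by simp
  then show ?thesis
    using chain_rk_inj[OF flag_chain[OF assms]] unfolding bij_betw_def by blast
qed

definition face_at :: "'a set \<Rightarrow> int \<Rightarrow> 'a" where
  "face_at X j = inv_into X (rk P) j"

lemma face_at:
  assumes "X \<in> flags P" "j \<in> {- 1..int n}"
  shows "face_at X j \<in> X" "rk P (face_at X j) = j"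
proof -
  have "j \<in> rk P ` X" using flag_rk_bij[OF assms(1)] assms(2) unfolding bij_betw_def by blast
  then show "face_at X j \<in> X" "rk P (face_at X j) = j"
    unfolding face_at_def by (rule inv_into_into, rule f_inv_into_f)
qed

lemma face_at_rk: "X \<in> flags P \<Longrightarrow> F \<in> X \<Longrightarrow> face_at X (rk P F) = F"
  unfolding face_at_def using chain_rk_inj[OF flag_chain] by (rule inv_into_f_f)

lemma face_at_eqI: "X \<in> flags P \<Longrightarrow> F \<in> X \<Longrightarrow> rk P F = j \<Longrightarrow> face_at X j = F"
  using face_at_rk by blast

lemma face_at_range: "X \<in> flags P \<Longrightarrow> F \<in> X \<Longrightarrow> rk P F \<in> {- 1..int n}"
  using rk_bounds flag_faces by blast

lemma flag_eqI:
  assumes "X \<in> flags P" "Y \<in> flags P" "\<And>j. j \<in> {- 1..int n} \<Longrightarrow> face_at X j = face_at Y j"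
  shows "X = Y"
proof -
  have "Z \<subseteq> W" if "Z \<in> flags P" "W \<in> flags P" "\<And>j. j \<in> {- 1..int n} \<Longrightarrow> face_at Z j = face_at W j" for Z W
  proof
    fix F assume F: "F \<in> Z"
    have j: "rk P F \<in> {- 1..int n}" by (rule face_at_range[OF that(1) F])
    have "F = face_at W (rk P F)" using face_at_rk[OF that(1) F] that(3)[OF j] by simp
    then show "F \<in> W" using face_at(1)[OF that(2) j] by simp
  qed
  from this[OF assms] this[OF assms(2,1) assms(3)[symmetric]] show ?thesis by blast
qed

lemma flag_le:
  assumes "X \<in> flags P" "F \<in> X" "G \<in> X" "rk P F \<le> rk P G"
  shows "(F, G) \<in> face_le P"
proof -
  have "(F, G) \<in> face_le P \<or> (G, F) \<in> face_le P"
    using flag_chain[OF assms(1)] assms(2,3) unfolding Chains_def by blast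
  moreover have "(F, G) \<in> face_le P" if "(G, F) \<in> face_le P"
    using rk_less[OF that] assms(4) le_faces[OF that] le_refl by (cases "F = G") auto
  ultimately show ?thesis by blast
qed

lemma face_at_le:
  assumes "X \<in> flags P" "- 1 \<le> i" "i \<le> j" "j \<le> int n"
  shows "(face_at X i, face_at X j) \<in> face_le P"
  by (rule flag_le[OF assms(1)]) (use face_at[OF assms(1)] assms in auto)

lemma improper_face_at:
  assumes "X \<in> flags P" "Y \<in> flags P" "j = - 1 \<or> j = int n"
  shows "face_at X j = face_at Y j"
proof -
  have "\<exists>F \<in> faces P. rk P F = - 1 \<and> (\<forall>G \<in> faces P. (F, G) \<in> face_le P)"
    using polytope unfolding polytope_def by (elim conjE) assumption
  then obtain L where L: "rk P L = - 1" "\<And>G. G \<in> faces P \<Longrightarrow> (L, G) \<in> face_le P"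
    by blast
  have "\<exists>F \<in> faces P. rk P F = int n \<and> (\<forall>G \<in> faces P. (G, F) \<in> face_le P)"
    using polytope unfolding polytope_def by (elim conjE) assumption
  then obtain U where U: "rk P U = int n" "\<And>G. G \<in> faces P \<Longrightarrow> (G, U) \<in> face_le P"
    by blast
  have low: "face_at Z (- 1) = L" if "Z \<in> flags P" for Z
    using face_at[OF that, of "- 1"] flag_faces[OF that] rk_less[OF L(2), of "face_at Z (- 1)"] L(1)
    by fastforce
  have high: "face_at Z (int n) = U" if "Z \<in> flags P" for Z
    using face_at[OF that, of "int n"] flag_faces[OF that] rk_less[OF U(2), of "face_at Z (int n)"] U(1)
    by fastforce
  show ?thesis using low high assms by metis
qed

text \<open>Only two faces of rank \<open>j\<close> fit between the given neighbours, and both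
  \<open>Y\<close> and \<open>Z\<close> avoid the one used by \<open>X\<close>.\<close>

lemma diamond_unique:
  assumes "X \<in> flags P" "Y \<in> flags P" "Z \<in> flags P" "j < n"
    and "face_at Y (int j - 1) = face_at X (int j - 1)" "face_at Y (int j + 1) = face_at X (int j + 1)"
    and "face_at Z (int j - 1) = face_at X (int j - 1)" "face_at Z (int j + 1) = face_at X (int j + 1)"
    and "face_at Y (int j) \<noteq> face_at X (int j)" "face_at Z (int j) \<noteq> face_at X (int j)"
  shows "face_at Y (int j) = face_at Z (int j)"
proof -
  let ?F = "face_at X (int j - 1)" and ?G = "face_at X (int j + 1)"
  let ?B = "{H \<in> faces P. rk P H = rk P ?F + 1 \<and> (?F, H) \<in> face_le P \<and> (H, ?G) \<in> face_le P}"
  have rkF: "rk P ?F = int j - 1" and rkG: "rk P ?G = int j + 1"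
    using face_at(2)[OF assms(1)] assms(4) by simp_all
  have "card ?B = 2"
    by (rule card_between[OF face_at_le[OF assms(1)]]) (use assms(4) rkF rkG in auto)
  then obtain a b where ab: "?B = {a, b}"
    unfolding card_2_iff by blast
  have "face_at W (int j) \<in> ?B"
    if W: "W \<in> flags P" "face_at W (int j - 1) = ?F" "face_at W (int j + 1) = ?G" for W
  proof -
    have "(face_at W (int j - 1), face_at W (int j)) \<in> face_le P"
      "(face_at W (int j), face_at W (int j + 1)) \<in> face_le P"
      using face_at_le[OF W(1)] assms(4) by simp_all
    moreover have "rk P (face_at W (int j)) = int j" using face_at(2)[OF W(1)] assms(4) by simp
    ultimately show ?thesis using W(2,3) rkF le_faces by simp
  qed
  then have "face_at X (int j) \<in> ?B" "face_at Y (int j) \<in> ?B" "face_at Z (int j) \<in> ?B"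
    using assms by blast+
  then show ?thesis using assms(9,10) unfolding ab by auto
qed

lemma adj_exists:
  assumes X: "X \<in> flags P" and j: "j < n"
  obtains Y where "Y \<in> flags P" "face_at Y (int j) \<noteq> face_at X (int j)"
    "\<And>i. i \<in> {- 1..int n} \<Longrightarrow> i \<noteq> int j \<Longrightarrow> face_at Y i = face_at X i"
proof -
  let ?F = "face_at X (int j - 1)" and ?G = "face_at X (int j + 1)"
  let ?B = "{H \<in> faces P. rk P H = rk P ?F + 1 \<and> (?F, H) \<in> face_le P \<and> (H, ?G) \<in> face_le P}"
  have rkF: "rk P ?F = int j - 1" and rkG: "rk P ?G = int j + 1"
    using face_at(2)[OF X] j by simp_all
  have "card ?B = 2"
    by (rule card_between[OF face_at_le[OF X]]) (use j rkF rkG in auto)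
  then have "\<exists>H \<in> ?B. H \<noteq> face_at X (int j)" by (auto simp: card_2_iff)
  then obtain H where H: "H \<in> faces P" "rk P H = int j" "(?F, H) \<in> face_le P" "(H, ?G) \<in> face_le P"
      "H \<noteq> face_at X (int j)"
    using rkF by auto
  \<comment> \<open>The \<open>j\<close>-face of \<open>X\<close> is exchanged for the second one
    granted by the diamond condition; comparisons across rank \<open>j\<close> pass through its
    neighbours.\<close>
  define g where "g = (face_at X)(int j := H)"
  have g_le: "(g a, g b) \<in> face_le P" if ab: "- 1 \<le> a" "a \<le> b" "b \<le> int n" for a b
  proof -
    consider "a = int j" "b = int j" | "a \<noteq> int j" "b \<noteq> int j"
      | "a = int j" "int j + 1 \<le> b" | "a \<le> int j - 1" "b = int j"
      using ab by linarith
    then show ?thesis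
    proof cases
      case 1
      then show ?thesis using le_refl[OF H(1)] unfolding g_def by simp
    next
      case 2
      then show ?thesis using face_at_le[OF X ab] unfolding g_def by simp
    next
      case 3
      then show ?thesis using le_trans[OF H(4) face_at_le[OF X, of "int j + 1" b]] ab unfolding g_def by simp
    next
      case 4
      then show ?thesis using le_trans[OF face_at_le[OF X, of a "int j - 1"] H(3)] ab unfolding g_def by simp
    qed
  qed
  have g_rk: "rk P (g i) = i" if "i \<in> {- 1..int n}" for i
    using face_at(2)[OF X that] H(2) unfolding g_def by simp
  let ?Y = "g ` {- 1..int n}"
  have "inj_on g {- 1..int n}" using g_rk by (metis inj_onI)
  then have "card ?Y = n + 2" by (simp add: card_image)
  moreover have "?Y \<in> Chains (face_le P)"
    unfolding Chains_def
  proof (intro CollectI ballI)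
    fix A B assume "A \<in> ?Y" "B \<in> ?Y"
    then obtain a b where "a \<in> {- 1..int n}" "A = g a" "b \<in> {- 1..int n}" "B = g b" by blast
    then show "(A, B) \<in> face_le P \<or> (B, A) \<in> face_le P"
      using g_le[of a b] g_le[of b a] by (cases "a \<le> b") auto
  qed
  ultimately have Y: "?Y \<in> flags P" by (intro flagI)
  have at: "face_at ?Y i = g i" if "i \<in> {- 1..int n}" for i
    by (rule face_at_eqI[OF Y]) (use that g_rk in auto)
  show ?thesis
  proof (rule that[OF Y])
    show "face_at ?Y (int j) \<noteq> face_at X (int j)" using at[of "int j"] j H(5) unfolding g_def by simp
    show "face_at ?Y i = face_at X i" if "i \<in> {- 1..int n}" "i \<noteq> int j" for i
      using at[OF that(1)] that(2) unfolding g_def by simp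
  qed
qed

text \<open>Translates the set comparison in the definition of \<open>flag_adj\<close> into equality
  of faces rank by rank.\<close>

lemma agree_iff:
  assumes "X \<in> flags P" "Y \<in> flags P"
  shows "{F \<in> Y. rk P F \<noteq> j} = {F \<in> X. rk P F \<noteq> j} \<longleftrightarrow>
    (\<forall>i\<in>{- 1..int n}. i \<noteq> j \<longrightarrow> face_at Y i = face_at X i)"
proof
  assume eq: "{F \<in> Y. rk P F \<noteq> j} = {F \<in> X. rk P F \<noteq> j}"
  show "\<forall>i\<in>{- 1..int n}. i \<noteq> j \<longrightarrow> face_at Y i = face_at X i"
  proof (intro ballI impI)
    fix i assume i: "i \<in> {- 1..int n}" "i \<noteq> j"
    then have "face_at X i \<in> {F \<in> Y. rk P F \<noteq> j}"
      unfolding eq using face_at[OF assms(1) i(1)] by simp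
    then show "face_at Y i = face_at X i"
      using face_at_eqI[OF assms(2)] face_at(2)[OF assms(1) i(1)] by simp
  qed
next
  assume eq: "\<forall>i\<in>{- 1..int n}. i \<noteq> j \<longrightarrow> face_at Y i = face_at X i"
  have "F \<in> W" if "Z \<in> flags P" "W \<in> flags P" "F \<in> Z" "rk P F \<noteq> j"
    "\<forall>i\<in>{- 1..int n}. i \<noteq> j \<longrightarrow> face_at Z i = face_at W i" for F Z W
    using face_at_rk[OF that(1,3)] face_at(1)[OF that(2) face_at_range[OF that(1,3)]]
      face_at_range[OF that(1,3)] that(4,5) by metis
  from this[OF assms(2,1)] this[OF assms] eq
  show "{F \<in> Y. rk P F \<noteq> j} = {F \<in> X. rk P F \<noteq> j}" by auto
qed

lemma
  assumes X: "X \<in> flags P" and j: "j < n"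
  shows flag_adj_in: "flag_adj P j X \<in> flags P"
    and face_at_adj_neq: "face_at (flag_adj P j X) (int j) \<noteq> face_at X (int j)"
    and face_at_adj: "i \<in> {- 1..int n} \<Longrightarrow> i \<noteq> int j \<Longrightarrow> face_at (flag_adj P j X) i = face_at X i"
    and flag_adj_eqI: "Z \<in> flags P \<Longrightarrow> Z \<noteq> X \<Longrightarrow>
      (\<And>i. i \<in> {- 1..int n} \<Longrightarrow> i \<noteq> int j \<Longrightarrow> face_at Z i = face_at X i) \<Longrightarrow> Z = flag_adj P j X"
proof -
  obtain Y where Y: "Y \<in> flags P" "face_at Y (int j) \<noteq> face_at X (int j)"
    "\<And>i. i \<in> {- 1..int n} \<Longrightarrow> i \<noteq> int j \<Longrightarrow> face_at Y i = face_at X i"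
    using adj_exists[OF X j] by blast
  have uniq: "Z = Y" if Z: "Z \<in> flags P" "Z \<noteq> X"
    "\<And>i. i \<in> {- 1..int n} \<Longrightarrow> i \<noteq> int j \<Longrightarrow> face_at Z i = face_at X i" for Z
  proof (rule flag_eqI[OF Z(1) Y(1)])
    have neq: "face_at Z (int j) \<noteq> face_at X (int j)"
    proof
      assume "face_at Z (int j) = face_at X (int j)"
      then have "Z = X" by (intro flag_eqI[OF Z(1) X]) (metis Z(3))
      then show False using Z(2) by simp
    qed
    have "face_at Z (int j) = face_at Y (int j)"
      by (rule diamond_unique[OF X Z(1) Y(1) j]) (use j Z(3) Y(3) neq Y(2) in auto)
    then show "face_at Z i = face_at Y i" if "i \<in> {- 1..int n}" for i
      using Z(3)[OF that] Y(3)[OF that] by (cases "i = int j") auto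
  qed
  have "flag_adj P j X = Y"
    unfolding flag_adj_def
  proof (rule the_equality)
    show "Y \<in> flags P \<and> Y \<noteq> X \<and> {F \<in> Y. rk P F \<noteq> int j} = {F \<in> X. rk P F \<noteq> int j}"
      using Y agree_iff[OF X Y(1)] by auto
    fix Z assume Z: "Z \<in> flags P \<and> Z \<noteq> X \<and> {F \<in> Z. rk P F \<noteq> int j} = {F \<in> X. rk P F \<noteq> int j}"
    then show "Z = Y" using agree_iff[OF X, of Z "int j"] by (intro uniq) auto
  qed
  then show "flag_adj P j X \<in> flags P" "face_at (flag_adj P j X) (int j) \<noteq> face_at X (int j)"
    "i \<in> {- 1..int n} \<Longrightarrow> i \<noteq> int j \<Longrightarrow> face_at (flag_adj P j X) i = face_at X i"
    "Z \<in> flags P \<Longrightarrow> Z \<noteq> X \<Longrightarrow>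
      (\<And>i. i \<in> {- 1..int n} \<Longrightarrow> i \<noteq> int j \<Longrightarrow> face_at Z i = face_at X i) \<Longrightarrow> Z = flag_adj P j X"
    using Y uniq by simp_all
qed

lemma flag_adj_neq: "X \<in> flags P \<Longrightarrow> j < n \<Longrightarrow> flag_adj P j X \<noteq> X"
  using face_at_adj_neq by metis

lemma flag_adj_adj:
  assumes "X \<in> flags P" "j < n"
  shows "flag_adj P j (flag_adj P j X) = X"
proof -
  note in1 = flag_adj_in[OF assms]
  show ?thesis
    by (rule flag_adj_eqI[OF in1 assms(2) assms(1), symmetric])
      (use flag_adj_neq[OF assms] face_at_adj[OF assms] in auto)
qed

text \<open>The change at \<open>j\<close> leaves both neighbours of rank \<open>i\<close> in place,
  so the diamond condition at rank \<open>i\<close> has the same two solutions before and after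
  it.\<close>

lemma flag_adj_commute:
  assumes X: "X \<in> flags P" and ij: "Suc i < j" "j < n"
  shows "flag_adj P i (flag_adj P j X) = flag_adj P j (flag_adj P i X)"
proof -
  have i: "i < n" using ij by simp
  let ?Y = "flag_adj P j X" and ?Z = "flag_adj P i X"
  let ?W = "flag_adj P i ?Y"
  note Y = flag_adj_in[OF X ij(2)] and Z = flag_adj_in[OF X i]
  note W = flag_adj_in[OF Y i]
  show ?thesis
  proof (rule flag_adj_eqI[OF Z ij(2) W])
    have Wj: "face_at ?W (int j) = face_at ?Y (int j)"
      by (rule face_at_adj[OF Y i]) (use ij in auto)
    have Zj: "face_at ?Z (int j) = face_at X (int j)"
      by (rule face_at_adj[OF X i]) (use ij in auto)
    show "?W \<noteq> ?Z"
      using Wj Zj face_at_adj_neq[OF X ij(2)] by metis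
    fix k assume k: "k \<in> {- 1..int n}" "k \<noteq> int j"
    show "face_at ?W k = face_at ?Z k"
    proof (cases "k = int i")
      case False
      then show ?thesis
        using face_at_adj[OF Y i k(1)] face_at_adj[OF X ij(2) k] face_at_adj[OF X i k(1)] by simp
    next
      case True
      have "face_at ?W (int i) = face_at ?Z (int i)"
      proof (rule diamond_unique[OF X W Z i])
        show "face_at ?W (int i - 1) = face_at X (int i - 1)" "face_at ?W (int i + 1) = face_at X (int i + 1)"
          using face_at_adj[OF Y i] face_at_adj[OF X ij(2)] ij by simp_all
        show "face_at ?Z (int i - 1) = face_at X (int i - 1)" "face_at ?Z (int i + 1) = face_at X (int i + 1)"
          using face_at_adj[OF X i] i by simp_all
        show "face_at ?W (int i) \<noteq> face_at X (int i)"
          using face_at_adj_neq[OF Y i] face_at_adj[OF X ij(2), of "int i"] ij by simp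
        show "face_at ?Z (int i) \<noteq> face_at X (int i)"
          by (rule face_at_adj_neq[OF X i])
      qed
      then show ?thesis using True by simp
    qed
  qed
qed

lemma adjacent_flag_adj:
  assumes X: "X \<in> flags P" and j: "j < n"
  shows "adjacent X (flag_adj P j X)"
proof -
  have "Z - W = {face_at Z (int j)}"
    if Z: "Z \<in> flags P" and W: "W \<in> flags P" and neq: "face_at W (int j) \<noteq> face_at Z (int j)"
      and eq: "\<And>i. i \<in> {- 1..int n} \<Longrightarrow> i \<noteq> int j \<Longrightarrow> face_at W i = face_at Z i" for Z W
  proof
    show "Z - W \<subseteq> {face_at Z (int j)}"
    proof
      fix F assume F: "F \<in> Z - W"
      then have "rk P F = int j"
        using eq[of "rk P F"] face_at_range[OF Z] face_at_rk[OF Z] face_at(1)[OF W] by (metis DiffE)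
      then show "F \<in> {face_at Z (int j)}" using F face_at_eqI[OF Z] by blast
    qed
    have jr: "int j \<in> {- 1..int n}" using j by simp
    have "face_at Z (int j) \<notin> W"
      using face_at_eqI[OF W _ face_at(2)[OF Z jr]] neq by blast
    then show "{face_at Z (int j)} \<subseteq> Z - W" using face_at(1)[OF Z jr] by blast
  qed
  note diff = this
  have "X - flag_adj P j X = {face_at X (int j)}"
    by (rule diff[OF X flag_adj_in[OF X j] face_at_adj_neq[OF X j] face_at_adj[OF X j]])
  moreover have "flag_adj P j X - X = {face_at (flag_adj P j X) (int j)}"
    by (rule diff[OF flag_adj_in[OF X j] X face_at_adj_neq[OF X j, symmetric] face_at_adj[OF X j, symmetric]])
  ultimately show ?thesis unfolding adjacent_def by simp
qed

text \<open>All flags share the least and the greatest face, so the single difference occurs at a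
  rank that is a letter.\<close>

lemma adjacent_flags:
  assumes X: "X \<in> flags P" and Y: "Y \<in> flags P" and "adjacent X Y"
  obtains j where "j < n" "Y = flag_adj P j X" "face_at X (int j) \<notin> Y"
proof -
  obtain F where F: "X - Y = {F}"
    using assms(3) unfolding adjacent_def by (auto simp: card_1_singleton_iff)
  have FX: "F \<in> X" "F \<notin> Y" using F by auto
  have eq: "face_at Y i = face_at X i" if "i \<in> {- 1..int n}" "i \<noteq> rk P F" for i
  proof (rule face_at_eqI[OF Y _ face_at(2)[OF X that(1)]])
    have "face_at X i \<noteq> F" using face_at(2)[OF X that(1)] that(2) by auto
    then show "face_at X i \<in> Y" using F face_at(1)[OF X that(1)] by blast
  qed
  have range: "rk P F \<in> {- 1..int n}" by (rule face_at_range[OF X FX(1)])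
  have "rk P F \<noteq> - 1 \<and> rk P F \<noteq> int n"
  proof (rule ccontr)
    assume "\<not> ?thesis"
    then have "face_at X (rk P F) = face_at Y (rk P F)"
      by (intro improper_face_at[OF X Y]) auto
    then show False using face_at_rk[OF X FX(1)] face_at(1)[OF Y range] FX(2) by simp
  qed
  then have j: "nat (rk P F) < n" "rk P F = int (nat (rk P F))"
    using range by auto
  have "Y \<noteq> X" using FX by blast
  then have "Y = flag_adj P (nat (rk P F)) X"
    using flag_adj_eqI[OF X j(1) Y] eq j(2) by simp
  moreover have "face_at X (int (nat (rk P F))) \<notin> Y"
    using face_at_eqI[OF X FX(1) j(2)] FX(2) by simp
  ultimately show ?thesis using that j(1) by blast
qed

text \<open>Strong flag-connectedness gives a path that keeps \<open>X \<inter> Y\<close>. The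
  \<open>j\<close>-faces with \<open>j \<in> J\<close> belong to this intersection, so no step of
  the path can use a letter of \<open>J\<close>.\<close>

sublocale polytopal_flag_system n "flags P" "flag_adj P"
proof
  fix J X Y
  assume J: "J \<subseteq> {..<n}" and X: "X \<in> flags P" and Y: "Y \<in> flags P"
    and joined: "\<And>j. j \<in> J \<Longrightarrow> joined (flag_adj P) ({..<n} - {j}) X Y"
  have eq: "face_at X (int j) \<in> X \<inter> Y" if j: "j \<in> J" for j
  proof -
    have jr: "int j \<in> {- 1..int n}" using j J by auto
    from joined[OF j] have "Y \<in> flags P \<and> face_at Y (int j) = face_at X (int j)"
    proof (induction rule: joined_induct)
      case refl
      then show ?case using X by simp
    next
      case (step Z i)
      then show ?case using flag_adj_in[of Z i] face_at_adj[of Z i, OF _ _ jr] by auto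
    qed
    then show ?thesis using face_at(1)[OF X jr] face_at(1)[OF Y jr] by simp
  qed
  define S where "S = {(Z, W). Z \<in> flags P \<and> W \<in> flags P \<and> adjacent Z W \<and> X \<inter> Y \<subseteq> Z \<and> X \<inter> Y \<subseteq> W}"
  have "(X, Y) \<in> S\<^sup>*"
    using strongly_connected X Y unfolding strongly_flag_connected_def S_def by blast
  then show "joined (flag_adj P) ({..<n} - J) X Y"
  proof (induction rule: rtrancl_induct)
    case base
    then show ?case by simp
  next
    case (step Z W)
    have ZW: "Z \<in> flags P" "W \<in> flags P" "adjacent Z W" "X \<inter> Y \<subseteq> Z" "X \<inter> Y \<subseteq> W"
      using step.hyps(2) unfolding S_def by auto
    obtain j where j: "j < n" "W = flag_adj P j Z" "face_at Z (int j) \<notin> W"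
      by (rule adjacent_flags[OF ZW(1-3)])
    have "j \<notin> J"
    proof
      assume "j \<in> J"
      then have "face_at X (int j) \<in> Z" "face_at X (int j) \<in> W" using eq ZW(4,5) by blast+
      moreover have "rk P (face_at X (int j)) = int j" using face_at(2)[OF X] j(1) by simp
      ultimately show False using face_at_eqI[OF ZW(1)] j(3) by metis
    qed
    then have "joined (flag_adj P) ({..<n} - J) Z W"
      using joined_step[of j "{..<n} - J" "flag_adj P" Z] j by simp
    then show ?case by (rule joined_trans[OF step.IH])
  qed
qed (simp_all add: flag_adj_in flag_adj_adj flag_adj_neq, rule flag_adj_commute)

end

section \<open>Automorphisms\<close>

lemma aut_group_simps:
  "carrier (aut_group P) = {f \<in> Bij (faces P). \<forall>F \<in> faces P. \<forall>G \<in> faces P.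
      (f F, f G) \<in> face_le P \<longleftrightarrow> (F, G) \<in> face_le P}"
  "f \<otimes>\<^bsub>aut_group P\<^esub> g = compose (faces P) g f"
  "\<one>\<^bsub>aut_group P\<^esub> = (\<lambda>F \<in> faces P. F)"
  by (simp_all add: aut_group_def)

lemma autD:
  assumes "f \<in> carrier (aut_group P)"
  shows "f \<in> extensional (faces P)" "bij_betw f (faces P) (faces P)"
    "F \<in> faces P \<Longrightarrow> f F \<in> faces P"
    "F \<in> faces P \<Longrightarrow> G \<in> faces P \<Longrightarrow> (f F, f G) \<in> face_le P \<longleftrightarrow> (F, G) \<in> face_le P"
  using assms unfolding aut_group_simps Bij_def bij_betw_def by auto

lemma autI:
  assumes "f \<in> extensional (faces P)" "bij_betw f (faces P) (faces P)"
    "\<And>F G. F \<in> faces P \<Longrightarrow> G \<in> faces P \<Longrightarrow> (f F, f G) \<in> face_le P \<longleftrightarrow> (F, G) \<in> face_le P"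
  shows "f \<in> carrier (aut_group P)"
  using assms unfolding aut_group_simps Bij_def by simp

lemma group_aut_group: "group (aut_group P)"
proof (rule groupI)
  fix f g assume f: "f \<in> carrier (aut_group P)" and g: "g \<in> carrier (aut_group P)"
  have "compose (faces P) g f \<in> Bij (faces P)"
    using f g by (auto simp: aut_group_simps compose_Bij)
  then show "f \<otimes>\<^bsub>aut_group P\<^esub> g \<in> carrier (aut_group P)"
    unfolding aut_group_simps using autD(3,4)[OF f] autD(4)[OF g] by (simp add: compose_eq)
next
  show "\<one>\<^bsub>aut_group P\<^esub> \<in> carrier (aut_group P)"
    unfolding aut_group_simps using id_Bij by auto
next
  fix f g h assume "f \<in> carrier (aut_group P)" "g \<in> carrier (aut_group P)" "h \<in> carrier (aut_group P)"
  then show "f \<otimes>\<^bsub>aut_group P\<^esub> g \<otimes>\<^bsub>aut_group P\<^esub> h = f \<otimes>\<^bsub>aut_group P\<^esub> (g \<otimes>\<^bsub>aut_group P\<^esub> h)"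
    unfolding aut_group_simps(2) by (intro compose_assoc) (auto dest: autD(3))
next
  fix f assume f: "f \<in> carrier (aut_group P)"
  show "\<one>\<^bsub>aut_group P\<^esub> \<otimes>\<^bsub>aut_group P\<^esub> f = f"
    unfolding aut_group_simps(2,3) using autD(1,3)[OF f] by (intro compose_Id) auto
  let ?g = "restrict (inv_into (faces P) f) (faces P)"
  have inj: "inj_on f (faces P)" and im: "f ` faces P = faces P"
    using autD(2)[OF f] unfolding bij_betw_def by auto
  have "?g \<in> carrier (aut_group P)"
  proof (rule autI)
    show "bij_betw ?g (faces P) (faces P)"
      using bij_betw_inv_into[OF autD(2)[OF f]] by (simp add: bij_betw_restrict_eq)
    fix F G assume "F \<in> faces P" "G \<in> faces P"
    then show "(?g F, ?g G) \<in> face_le P \<longleftrightarrow> (F, G) \<in> face_le P"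
      using autD(4)[OF f, of "?g F" "?g G"] im by (simp add: inv_into_into f_inv_into_f)
  qed simp
  moreover have "?g \<otimes>\<^bsub>aut_group P\<^esub> f = \<one>\<^bsub>aut_group P\<^esub>"
    unfolding aut_group_simps(2,3) using im
    by (auto simp: compose_def fun_eq_iff f_inv_into_f restrict_def)
  ultimately show "\<exists>g\<in>carrier (aut_group P). g \<otimes>\<^bsub>aut_group P\<^esub> f = \<one>\<^bsub>aut_group P\<^esub>" by blast
qed

lemma aut_mult_image: "X \<subseteq> faces P \<Longrightarrow> (f \<otimes>\<^bsub>aut_group P\<^esub> g) ` X = g ` f ` X"
  unfolding aut_group_simps(2) image_image by (intro image_cong) (auto simp: compose_eq)

lemma aut_one_image: "X \<subseteq> faces P \<Longrightarrow> \<one>\<^bsub>aut_group P\<^esub> ` X = X"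
  unfolding aut_group_simps(3) by auto

context abstract_polytope
begin

interpretation Aut: group "aut_group P" by (rule group_aut_group)

lemma aut_image_inj: "f \<in> carrier (aut_group P) \<Longrightarrow> X \<subseteq> faces P \<Longrightarrow> inj_on f X"
  using autD(2) unfolding bij_betw_def by (blast intro: inj_on_subset)

lemma aut_flag:
  assumes f: "f \<in> carrier (aut_group P)" and X: "X \<in> flags P"
  shows "f ` X \<in> flags P"
proof (rule flagI)
  show "f ` X \<in> Chains (face_le P)"
    unfolding Chains_def
  proof (intro CollectI ballI)
    fix F' G' assume "F' \<in> f ` X" "G' \<in> f ` X"
    then obtain F G where FG: "F \<in> X" "F' = f F" "G \<in> X" "G' = f G" by blast
    then have "F \<in> faces P" "G \<in> faces P" using flag_faces[OF X] by auto
    moreover have "(F, G) \<in> face_le P \<or> (G, F) \<in> face_le P"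
      using flag_chain[OF X] FG unfolding Chains_def by blast
    ultimately show "(F', G') \<in> face_le P \<or> (G', F') \<in> face_le P"
      unfolding FG using autD(4)[OF f] by blast
  qed
  show "card (f ` X) = n + 2"
    using card_image[OF aut_image_inj[OF f flag_faces[OF X]]] card_flag[OF X] by simp
qed

text \<open>Automorphisms are only required to respect the order, and this formula recovers the rank
  from the order. The offset 2 arises because ranks start at -1 and \<open>F\<close> itself is
  counted.\<close>

lemma rk_eq_card:
  assumes X: "X \<in> flags P" and F: "F \<in> X"
  shows "rk P F = int (card {G \<in> X. (G, F) \<in> face_le P}) - 2"
proof -
  have "(G, F) \<in> face_le P \<longleftrightarrow> rk P G \<le> rk P F" if "G \<in> X" for G
    using flag_le[OF X that F] rk_less[of G F] by (cases "G = F") auto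
  then have eq: "{G \<in> X. (G, F) \<in> face_le P} = {G \<in> X. rk P G \<le> rk P F}"
    by (intro Collect_cong conj_cong refl) simp
  have bij: "bij_betw (rk P) {G \<in> X. rk P G \<le> rk P F} {- 1..rk P F}"
  proof (rule bij_betw_imageI)
    show "inj_on (rk P) {G \<in> X. rk P G \<le> rk P F}"
      using flag_rk_bij[OF X] unfolding bij_betw_def by (auto intro: inj_on_subset)
    have "rk P F \<le> int n" using face_at_range[OF X F] by simp
    then show "rk P ` {G \<in> X. rk P G \<le> rk P F} = {- 1..rk P F}"
      using flag_rk_bij[OF X] unfolding bij_betw_def by force
  qed
  have "card {G \<in> X. (G, F) \<in> face_le P} = card {- 1..rk P F}"
    unfolding eq by (rule bij_betw_same_card[OF bij])
  then show ?thesis using face_at_range[OF X F] by simp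
qed

lemma aut_rk:
  assumes f: "f \<in> carrier (aut_group P)" and F: "F \<in> faces P"
  shows "rk P (f F) = rk P F"
proof -
  obtain X where X: "X \<in> flags P" "F \<in> X" by (rule face_in_flag[OF F])
  have faces: "G \<in> faces P" if "G \<in> X" for G using that flag_faces[OF X(1)] by blast
  have "{G \<in> f ` X. (G, f F) \<in> face_le P} = f ` {G \<in> X. (G, F) \<in> face_le P}"
    using autD(4)[OF f faces F] by blast
  moreover have "inj_on f {G \<in> X. (G, F) \<in> face_le P}"
    by (rule aut_image_inj[OF f]) (use faces in auto)
  ultimately have "card {G \<in> f ` X. (G, f F) \<in> face_le P} = card {G \<in> X. (G, F) \<in> face_le P}"
    by (simp add: card_image)
  then show ?thesis
    using rk_eq_card[OF X] rk_eq_card[OF aut_flag[OF f X(1)], of "f F"] X(2) by simp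
qed

lemma aut_face_at:
  assumes f: "f \<in> carrier (aut_group P)" and X: "X \<in> flags P" and j: "j \<in> {- 1..int n}"
  shows "face_at (f ` X) j = f (face_at X j)"
proof (rule face_at_eqI[OF aut_flag[OF f X]])
  show "f (face_at X j) \<in> f ` X" using face_at(1)[OF X j] by blast
  show "rk P (f (face_at X j)) = j"
    using aut_rk[OF f] face_at[OF X j] flag_faces[OF X] by (metis subsetD)
qed

lemma aut_flag_adj:
  assumes f: "f \<in> carrier (aut_group P)" and X: "X \<in> flags P" and j: "j < n"
  shows "f ` flag_adj P j X = flag_adj P j (f ` X)"
proof (rule flag_adj_eqI[OF aut_flag[OF f X] j aut_flag[OF f flag_adj_in[OF X j]]])
  have faces: "X \<subseteq> faces P" "flag_adj P j X \<subseteq> faces P"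
    using flag_faces X flag_adj_in[OF X j] by auto
  have "inj_on f (faces P)" using autD(2)[OF f] unfolding bij_betw_def by simp
  then show "f ` flag_adj P j X \<noteq> f ` X"
    using flag_adj_neq[OF X j] inj_on_image_eq_iff faces by metis
  fix i assume i: "i \<in> {- 1..int n}" "i \<noteq> int j"
  then show "face_at (f ` flag_adj P j X) i = face_at (f ` X) i"
    using aut_face_at[OF f X i(1)] aut_face_at[OF f flag_adj_in[OF X j] i(1)] face_at_adj[OF X j i]
    by simp
qed

text \<open>Automorphisms commute with the adjacency maps, so agreement on one flag spreads to all
  flags by connectedness, and every face lies in a flag. This freeness provides the uniqueness in
  the definite description \<open>aut_to\<close>.\<close>

lemma aut_eqI:
  assumes f: "f \<in> carrier (aut_group P)" and g: "g \<in> carrier (aut_group P)"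
    and X: "X \<in> flags P" and eq: "f ` X = g ` X"
  shows "f = g"
proof (rule extensionalityI[OF autD(1)[OF f] autD(1)[OF g]])
  fix F assume F: "F \<in> faces P"
  obtain Y where Y: "Y \<in> flags P" "F \<in> Y" by (rule face_in_flag[OF F])
  from connected[OF X Y(1)] have "Y \<in> flags P \<and> f ` Y = g ` Y"
  proof (induction rule: joined_induct)
    case refl
    then show ?case using X eq by simp
  next
    case (step Z i)
    then show ?case using aut_flag_adj[OF f] aut_flag_adj[OF g] flag_adj_in by auto
  qed
  then have "face_at (f ` Y) (rk P F) = face_at (g ` Y) (rk P F)" by simp
  then show "f F = g F"
    using aut_face_at[OF f Y(1) face_at_range[OF Y]] aut_face_at[OF g Y(1) face_at_range[OF Y]]
      face_at_rk[OF Y] by simp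
qed

lemma aut_to_eqI:
  assumes "f \<in> carrier (aut_group P)" "X \<in> flags P" "f ` X = Y"
  shows "aut_to P X Y = f"
  unfolding aut_to_def using assms aut_eqI by (intro the_equality) auto

lemma aut_inv_image:
  assumes f: "f \<in> carrier (aut_group P)" and X: "X \<subseteq> faces P"
  shows "(inv\<^bsub>aut_group P\<^esub> f) ` f ` X = X" "f ` (inv\<^bsub>aut_group P\<^esub> f) ` X = X"
  using aut_mult_image[OF X, of f "inv\<^bsub>aut_group P\<^esub> f"] aut_mult_image[OF X, of "inv\<^bsub>aut_group P\<^esub> f" f]
    Aut.r_inv[OF f] Aut.l_inv[OF f] aut_one_image[OF X] by simp_all

text \<open>The first factor \<open>s\<close> of a power replaces \<open>X\<close> by its image
  under the word, and the remaining power commutes with adjacency, so the word can be pulled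
  out.\<close>

lemma aut_pow_image:
  assumes X: "X \<in> flags P" and s: "s \<in> carrier (aut_group P)" and i: "Suc i < n"
    and sX: "s ` X = flag_adj P i (flag_adj P (Suc i) X)"
  shows "(s [^]\<^bsub>aut_group P\<^esub> (k :: nat)) ` X = (fold (flag_adj P) [Suc i, i] ^^ k) X"
proof (induction k)
  case 0
  then show ?case using aut_one_image[OF flag_faces[OF X]] by simp
next
  case (Suc k)
  let ?T = "fold (flag_adj P) [Suc i, i]"
  have pow: "s [^]\<^bsub>aut_group P\<^esub> k \<in> carrier (aut_group P)" using s by simp
  have "s [^]\<^bsub>aut_group P\<^esub> Suc k = s \<otimes>\<^bsub>aut_group P\<^esub> s [^]\<^bsub>aut_group P\<^esub> k"
    by (rule Aut.nat_pow_Suc2[OF s])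
  then have "(s [^]\<^bsub>aut_group P\<^esub> Suc k) ` X = (s [^]\<^bsub>aut_group P\<^esub> k) ` ?T X"
    using aut_mult_image[OF flag_faces[OF X]] sX by simp
  also have "\<dots> = ?T ((s [^]\<^bsub>aut_group P\<^esub> k) ` X)"
    using aut_flag_adj[OF pow] flag_adj_in X i by simp
  finally show ?case using Suc.IH by simp
qed

end

section \<open>Rotation groups\<close>

text \<open>Common ground of the chiral and the directly regular case: only the effect of the
  generators on the base flag is prescribed, and nothing is said about reflections.\<close>

locale rotary_generators = abstract_polytope n P
  for n and P :: "('a, 'b) ranked_poset_scheme" +
  fixes \<Phi> :: "'a set" and s :: "nat \<Rightarrow> 'a \<Rightarrow> 'a"
  assumes base_flag: "\<Phi> \<in> flags P"
    and rank_pos: "0 < n"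
    and s_aut: "i \<in> {1..n - 1} \<Longrightarrow> s i \<in> carrier (aut_group P)"
    and s_base: "i \<in> {1..n - 1} \<Longrightarrow> s i ` \<Phi> = flag_adj P (i - 1) (flag_adj P i \<Phi>)"
begin

sublocale Aut: group "aut_group P" by (rule group_aut_group)

definition "rotations = generate (aut_group P) (s ` {1..n - 1})"

abbreviation "rotation_group \<equiv> (aut_group P)\<lparr>carrier := rotations\<rparr>"

lemma rotations_subgroup: "subgroup rotations (aut_group P)"
  unfolding rotations_def by (rule Aut.generate_is_subgroup) (use s_aut in blast)

sublocale Rot: group rotation_group
  by (rule Aut.subgroup_imp_group[OF rotations_subgroup])

lemma rotations_aut: "g \<in> rotations \<Longrightarrow> g \<in> carrier (aut_group P)"
  using subgroup.mem_carrier[OF rotations_subgroup] .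

lemma s_rotation: "i \<in> {1..n - 1} \<Longrightarrow> s i \<in> rotations"
  unfolding rotations_def by (intro generate.incl) blast

lemma rot_prod_rotation: "i < n \<Longrightarrow> rot_prod rotation_group s i \<in> rotations"
proof (induction i)
  case 0
  then show ?case using subgroup.one_closed[OF rotations_subgroup] by simp
next
  case (Suc i)
  then show ?case
    using subgroup.m_closed[OF rotations_subgroup] s_rotation[of "Suc i"] by simp
qed

lemma adj_base: "i < n \<Longrightarrow> flag_adj P i \<Phi> \<in> flags P"
  by (rule flag_adj_in[OF base_flag])

text \<open>The images telescope: \<open>s (Suc i)\<close> applied to
  \<open>flag_adj P i \<Phi>\<close> creates a second change at rank \<open>i\<close>, which cancels
  the first and leaves a change at \<open>Suc i\<close>.\<close>

lemma rot_prod_image: "i < n \<Longrightarrow> rot_prod rotation_group s i ` flag_adj P 0 \<Phi> = flag_adj P i \<Phi>"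
proof (induction i)
  case 0
  then show ?case using aut_one_image[OF flag_faces[OF adj_base]] by simp
next
  case (Suc i)
  have s: "s (Suc i) \<in> carrier (aut_group P)" using s_aut Suc.prems by simp
  have "rot_prod rotation_group s (Suc i) ` flag_adj P 0 \<Phi> = s (Suc i) ` flag_adj P i \<Phi>"
    using aut_mult_image[OF flag_faces[OF adj_base[OF rank_pos]]] Suc by simp
  also have "\<dots> = flag_adj P i (flag_adj P i (flag_adj P (Suc i) \<Phi>))"
    using aut_flag_adj[OF s base_flag] s_base[of "Suc i"] Suc.prems by simp
  also have "\<dots> = flag_adj P (Suc i) \<Phi>"
    using flag_adj_adj[OF adj_base[OF Suc.prems]] Suc.prems by simp
  finally show ?case .
qed

text \<open>Turns the pairs that encode flags in \<open>group_poset\<close> into actual flags of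
  \<open>P\<close>.\<close>

definition orbit_flag :: "('a \<Rightarrow> 'a) \<times> bool \<Rightarrow> 'a set" where
  "orbit_flag x = fst x ` (if snd x then flag_adj P 0 \<Phi> else \<Phi>)"

lemma orbit_flag_in: "g \<in> rotations \<Longrightarrow> orbit_flag (g, b) \<in> flags P"
  unfolding orbit_flag_def using aut_flag[OF rotations_aut] base_flag adj_base[OF rank_pos] by simp

lemma gp_adj_in:
  assumes "x \<in> rotations \<times> UNIV" "i < n"
  shows "gp_adj rotation_group s i x \<in> rotations \<times> UNIV"
  using Rot.m_closed Rot.inv_closed rot_prod_rotation[OF assms(2)] assms(1)
  unfolding gp_adj_def by auto

text \<open>In a product the left factor acts first, so the left multiplication in
  \<open>gp_adj\<close> alters the representative flag, and \<open>g\<close> afterwards carries the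
  altered flag along.\<close>

lemma orbit_flag_gp_adj:
  assumes "x \<in> rotations \<times> UNIV" "i < n"
  shows "orbit_flag (gp_adj rotation_group s i x) = flag_adj P i (orbit_flag x)"
proof -
  obtain g b where x: "x = (g, b)" and g: "g \<in> rotations" using assms(1) by blast
  let ?t = "rot_prod rotation_group s i"
  note t = rot_prod_rotation[OF assms(2)]
  note tA = rotations_aut[OF t] and gA = rotations_aut[OF g]
  note faces = flag_faces[OF base_flag] flag_faces[OF adj_base[OF rank_pos]]
  show ?thesis
  proof (cases b)
    case False
    have "orbit_flag (gp_adj rotation_group s i x) = g ` flag_adj P i \<Phi>"
      unfolding x orbit_flag_def gp_adj_def using False aut_mult_image[OF faces(2)]
        rot_prod_image[OF assms(2)] by simp
    then show ?thesis
      unfolding x orbit_flag_def using False aut_flag_adj[OF gA base_flag assms(2)] by simp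
  next
    case True
    let ?X = "flag_adj P i (flag_adj P 0 \<Phi>)"
    have X: "?X \<in> flags P" by (rule flag_adj_in[OF adj_base[OF rank_pos] assms(2)])
    have "?t ` ?X = \<Phi>"
      using aut_flag_adj[OF tA adj_base[OF rank_pos] assms(2)] rot_prod_image[OF assms(2)]
        flag_adj_adj[OF base_flag assms(2)] by simp
    then have "(inv\<^bsub>aut_group P\<^esub> ?t) ` \<Phi> = ?X"
      using aut_inv_image(1)[OF tA flag_faces[OF X]] by simp
    moreover have "inv\<^bsub>rotation_group\<^esub> ?t = inv\<^bsub>aut_group P\<^esub> ?t"
      by (rule Aut.m_inv_consistent[OF rotations_subgroup t])
    ultimately have "orbit_flag (gp_adj rotation_group s i x) = g ` ?X"
      unfolding x orbit_flag_def gp_adj_def using True aut_mult_image[OF faces(1)] by simp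
    then show ?thesis
      unfolding x orbit_flag_def using True aut_flag_adj[OF gA adj_base[OF rank_pos] assms(2)] by simp
  qed
qed

lemma orbit_flag_surj:
  assumes "X \<in> flags P"
  obtains g b where "g \<in> rotations" "X = orbit_flag (g, b)"
proof -
  from connected[OF base_flag assms] have "\<exists>x\<in>rotations \<times> UNIV. X = orbit_flag x"
  proof (induction rule: joined_induct)
    case refl
    have "\<Phi> = orbit_flag (\<one>\<^bsub>aut_group P\<^esub>, False)"
      unfolding orbit_flag_def using aut_one_image[OF flag_faces[OF base_flag]] by simp
    then show ?case using subgroup.one_closed[OF rotations_subgroup] by blast
  next
    case (step Y i)
    then obtain x where x: "x \<in> rotations \<times> UNIV" "Y = orbit_flag x" by blast
    have "i < n" using step.hyps by simp
    then show ?case using orbit_flag_gp_adj[OF x(1)] gp_adj_in[OF x(1)] x(2) by metis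
  qed
  then show ?thesis using that by (metis mem_Sigma_iff surj_pair)
qed

end

section \<open>Parity of flags\<close>

locale rotary_polytope = rotary_generators +
  assumes no_reflection: "f \<in> rotations \<Longrightarrow> f ` \<Phi> \<noteq> flag_adj P 0 \<Phi>"
begin

text \<open>A coincidence between images of \<open>\<Phi>\<close> and of
  \<open>\<Phi>\<^sup>0\<close> would yield a rotation from the one to the other; images of the same
  flag determine the rotation by freeness.\<close>

lemma orbit_flag_inj: "inj_on orbit_flag (rotations \<times> UNIV)"
proof (rule inj_onI)
  fix x y assume xy: "x \<in> rotations \<times> UNIV" "y \<in> rotations \<times> UNIV" "orbit_flag x = orbit_flag y"
  have no: "g ` \<Phi> \<noteq> h ` flag_adj P 0 \<Phi>" if "g \<in> rotations" "h \<in> rotations" for g h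
  proof
    assume "g ` \<Phi> = h ` flag_adj P 0 \<Phi>"
    then have "(g \<otimes>\<^bsub>aut_group P\<^esub> inv\<^bsub>aut_group P\<^esub> h) ` \<Phi> = flag_adj P 0 \<Phi>"
      using aut_mult_image[OF flag_faces[OF base_flag]]
        aut_inv_image(1)[OF rotations_aut[OF that(2)] flag_faces[OF adj_base[OF rank_pos]]] by simp
    moreover have "g \<otimes>\<^bsub>aut_group P\<^esub> inv\<^bsub>aut_group P\<^esub> h \<in> rotations"
      using that subgroup.m_closed[OF rotations_subgroup] subgroup.m_inv_closed[OF rotations_subgroup]
      by blast
    ultimately show False using no_reflection by blast
  qed
  obtain g b h c where eq: "x = (g, b)" "y = (h, c)" and g: "g \<in> rotations" "h \<in> rotations"
    using xy by blast
  have "b = c"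
    using xy(3) no[OF g] no[OF g(2,1)] unfolding eq orbit_flag_def by (cases b; cases c) auto
  moreover have "g = h"
    using xy(3) aut_eqI[OF rotations_aut[OF g(1)] rotations_aut[OF g(2)]] base_flag adj_base[OF rank_pos]
    unfolding eq orbit_flag_def \<open>b = c\<close> by (cases c) auto
  ultimately show "x = y" unfolding eq by simp
qed

text \<open>The orbit is taken under rotations only: in the regular case all flags lie in one orbit
  of the full group, and reflections interchange the two parities.\<close>

definition odd_flag :: "'a set \<Rightarrow> bool" where
  "odd_flag X \<longleftrightarrow> X \<notin> (\<lambda>g. g ` \<Phi>) ` rotations"

lemma odd_orbit_flag:
  assumes "g \<in> rotations"
  shows "odd_flag (orbit_flag (g, b)) = b"
proof (cases b)
  case False
  then show ?thesis unfolding odd_flag_def orbit_flag_def using assms by simp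
next
  case True
  have "orbit_flag (g, b) \<noteq> h ` \<Phi>" if "h \<in> rotations" for h
    using inj_onD[OF orbit_flag_inj, of "(g, b)" "(h, False)"] assms that True
    by (auto simp: orbit_flag_def)
  then show ?thesis unfolding odd_flag_def using True by blast
qed

lemma odd_flag_adj:
  assumes X: "X \<in> flags P" and i: "i < n"
  shows "odd_flag (flag_adj P i X) \<longleftrightarrow> \<not> odd_flag X"
proof -
  obtain g b where g: "g \<in> rotations" "X = orbit_flag (g, b)" by (rule orbit_flag_surj[OF X])
  then have x: "(g, b) \<in> rotations \<times> UNIV" by simp
  obtain h where "gp_adj rotation_group s i (g, b) = (h, \<not> b)" "h \<in> rotations"
    using gp_adj_in[OF x i] unfolding gp_adj_def by (cases b) auto
  then show ?thesis
    using orbit_flag_gp_adj[OF x i] odd_orbit_flag g by metis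
qed

lemma odd_flag_cases:
  assumes "X \<in> flags P"
  obtains g where "g \<in> rotations" "\<not> odd_flag X" "X = g ` \<Phi>"
  | g where "g \<in> rotations" "odd_flag X" "X = g ` flag_adj P 0 \<Phi>"
proof -
  obtain g b where g: "g \<in> rotations" "X = orbit_flag (g, b)" by (rule orbit_flag_surj[OF assms])
  then show ?thesis using that odd_orbit_flag[OF g(1), of b] unfolding orbit_flag_def by (cases b) auto
qed

lemma odd_base: "\<not> odd_flag \<Phi>"
  unfolding odd_flag_def
  using aut_one_image[OF flag_faces[OF base_flag]] subgroup.one_closed[OF rotations_subgroup] by blast

text \<open>Parity alternates along adjacency and automorphisms commute with adjacency, so what
  happens at the base flag decides for all flags.\<close>

lemma odd_aut_image:
  assumes f: "f \<in> carrier (aut_group P)" and X: "X \<in> flags P"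
  shows "odd_flag (f ` X) \<longleftrightarrow> odd_flag X \<noteq> odd_flag (f ` \<Phi>)"
  using connected[OF base_flag X]
proof (induction rule: joined_induct)
  case refl
  then show ?case using odd_base by simp
next
  case (step Y i)
  have "Y \<in> flags P" by (rule joined_in[OF step.hyps(1) _ base_flag]) simp
  then show ?case
    using step odd_flag_adj aut_flag_adj[OF f] aut_flag[OF f] by simp
qed

lemma rotation_iff_even:
  assumes f: "f \<in> carrier (aut_group P)"
  shows "f \<in> rotations \<longleftrightarrow> \<not> odd_flag (f ` \<Phi>)"
proof
  assume "\<not> odd_flag (f ` \<Phi>)"
  then obtain g where "g \<in> rotations" "f ` \<Phi> = g ` \<Phi>"
    unfolding odd_flag_def by blast
  then show "f \<in> rotations" using aut_eqI[OF f rotations_aut base_flag] by blast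
qed (auto simp: odd_flag_def)

text \<open>On the base flag the word \<open>[Suc i, i]\<close> acts like \<open>s (Suc i)\<close>,
  and rotations carry the period to all even flags. Odd flags lie one \<open>i\<close>-step away
  from even ones, and this step conjugates the word into its inverse
  \<open>[i, Suc i]\<close>.\<close>

lemma rotation_period:
  assumes i: "Suc i < n" and X: "X \<in> flags P"
  shows "(fold (flag_adj P) [i, Suc i] ^^ group.ord rotation_group (s (Suc i))) X = X"
proof -
  let ?k = "group.ord rotation_group (s (Suc i))"
  let ?T = "fold (flag_adj P) [Suc i, i]" and ?T' = "fold (flag_adj P) [i, Suc i]"
  have s: "s (Suc i) \<in> rotations" using s_rotation i by simp
  have i': "i < n" using i by simp
  have "s (Suc i) [^]\<^bsub>aut_group P\<^esub> ?k = \<one>\<^bsub>aut_group P\<^esub>"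
    using Rot.pow_ord_eq_1[of "s (Suc i)"] s Aut.nat_pow_consistent[of "s (Suc i)" ?k rotations] by simp
  then have base: "(?T ^^ ?k) \<Phi> = \<Phi>"
    using aut_pow_image[OF base_flag rotations_aut[OF s] i, of ?k] s_base[of "Suc i"] i
      aut_one_image[OF flag_faces[OF base_flag]] by simp
  have T_in: "(?T ^^ m) Y \<in> flags P" if "Y \<in> flags P" for m Y
    by (induction m) (use that flag_adj_in i i' in auto)
  have T'_in: "(?T' ^^ m) Y \<in> flags P" if "Y \<in> flags P" for m Y
    by (induction m) (use that flag_adj_in i i' in auto)
  have equivariant: "(?T ^^ m) (g ` \<Phi>) = g ` (?T ^^ m) \<Phi>" if "g \<in> rotations" for g m
  proof (induction m)
    case (Suc m)
    have "?T (g ` Y) = g ` ?T Y" if "Y \<in> flags P" for Y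
      using aut_flag_adj[OF rotations_aut[OF \<open>g \<in> rotations\<close>]] that flag_adj_in i i' by simp
    from this[OF T_in[OF base_flag, of m]] Suc.IH show ?case
      by (simp only: funpow.simps comp_apply)
  qed simp
  have even: "(?T ^^ ?k) Y = Y" if Y: "Y \<in> flags P" "\<not> odd_flag Y" for Y
    using odd_flag_cases[OF Y(1)] Y(2) equivariant base by metis
  have inverse: "(?T' ^^ m) ((?T ^^ m) Y) = Y" if "Y \<in> flags P" for m Y
  proof (induction m)
    case (Suc m)
    have "?T' (?T Z) = Z" if "Z \<in> flags P" for Z
      using that flag_adj_adj flag_adj_in i i' by simp
    from this[OF T_in[OF that, of m]] Suc.IH show ?case
      by (simp only: funpow_Suc_right[of m ?T'] funpow.simps(2)[of m ?T] comp_apply)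
  qed simp
  have conj: "(?T' ^^ m) (flag_adj P i Y) = flag_adj P i ((?T ^^ m) Y)" if "Y \<in> flags P" for m Y
  proof (induction m)
    case (Suc m)
    have "?T' (flag_adj P i Z) = flag_adj P i (?T Z)" if "Z \<in> flags P" for Z
      using that flag_adj_adj flag_adj_in i i' by simp
    from this[OF T_in[OF that, of m]] Suc.IH show ?case
      by (simp only: funpow.simps(2) comp_apply)
  qed simp
  show ?thesis
  proof (cases "odd_flag X")
    case False
    then show ?thesis using even[OF X] inverse[OF X, of ?k] by simp
  next
    case True
    let ?Y = "flag_adj P i X"
    have Y: "?Y \<in> flags P" "\<not> odd_flag ?Y" "flag_adj P i ?Y = X"
      using flag_adj_in[OF X i'] odd_flag_adj[OF X i'] True flag_adj_adj[OF X i'] by auto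
    show ?thesis using conj[OF Y(1), of ?k] even[OF Y(1,2)] Y(3) by simp
  qed
qed

end

section \<open>Chiral and directly regular polytopes are rotary\<close>

lemma flag_orbit_self: "X \<subseteq> faces P \<Longrightarrow> X \<in> flag_orbit P X"
  unfolding flag_orbit_def using monoid.one_closed[OF group.is_monoid[OF group_aut_group[of P]]] aut_one_image[of X P]
  by (metis imageI)

lemma (in abstract_polytope) flag_orbit_aut_image:
  assumes f: "f \<in> carrier (aut_group P)" and X: "X \<subseteq> faces P"
  shows "flag_orbit P (f ` X) = flag_orbit P X"
proof -
  interpret Aut: group "aut_group P" by (rule group_aut_group)
  have fX: "f ` X \<subseteq> faces P" using autD(3)[OF f] X by blast
  have sub: "flag_orbit P (h ` Y) \<subseteq> flag_orbit P Y" if "h \<in> carrier (aut_group P)" "Y \<subseteq> faces P" for h Y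
  proof
    fix Z assume "Z \<in> flag_orbit P (h ` Y)"
    then obtain g where g: "g \<in> carrier (aut_group P)" "Z = g ` h ` Y" unfolding flag_orbit_def by blast
    then have "Z = (h \<otimes>\<^bsub>aut_group P\<^esub> g) ` Y" using aut_mult_image[OF that(2)] by blast
    moreover have "h \<otimes>\<^bsub>aut_group P\<^esub> g \<in> carrier (aut_group P)" using that(1) g(1) by simp
    ultimately show "Z \<in> flag_orbit P Y" unfolding flag_orbit_def by blast
  qed
  have "flag_orbit P ((inv\<^bsub>aut_group P\<^esub> f) ` f ` X) \<subseteq> flag_orbit P (f ` X)"
    by (rule sub[OF _ fX]) (use f in simp)
  then show ?thesis using sub[OF f X] aut_inv_image(1)[OF f X] by simp
qed

text \<open>Flag-transitivity leaves one orbit where chirality demands two. This settles the case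
  distinction in \<open>rot_gen\<close>, which asks for regularity.\<close>

lemma regular_not_chiral:
  assumes "regular n P"
  shows "\<not> chiral n P"
proof
  assume ch: "chiral n P"
  have "flag_orbit P X = flags P" if X: "X \<in> flags P" for X
  proof -
    interpret abstract_polytope n P using ch unfolding chiral_def by unfold_locales blast
    show ?thesis
    proof
      show "flag_orbit P X \<subseteq> flags P" unfolding flag_orbit_def using aut_flag[OF _ X] by blast
      show "flags P \<subseteq> flag_orbit P X"
      proof
        fix Y assume "Y \<in> flags P"
        then obtain f where "f \<in> carrier (aut_group P)" "f ` X = Y"
          using assms X unfolding regular_def by blast
        then show "Y \<in> flag_orbit P X" unfolding flag_orbit_def by blast
      qed
    qed
  qed
  then have "flag_orbit P ` flags P \<subseteq> {flags P}" by blast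
  then have "card (flag_orbit P ` flags P) \<le> card {flags P}" by (intro card_mono) auto
  then show False using ch unfolding chiral_def by simp
qed

context abstract_polytope
begin

lemma rank_zero_flags:
  assumes "n = 0" "X \<in> flags P" "Y \<in> flags P"
  shows "X = Y"
  using connected[OF assms(2,3)] assms(1) by (simp add: joined_empty)

text \<open>In rank 0 there is one flag and a trivial automorphism group, so neither two flag orbits
  nor index 2 can occur.\<close>

lemma rotary_rank_pos:
  assumes "\<Phi> \<in> flags P" "chiral n P \<or> directly_regular n P \<Phi>"
  shows "0 < n"
proof (rule ccontr)
  interpret Aut: group "aut_group P" by (rule group_aut_group)
  assume "\<not> 0 < n"
  then have n: "n = 0" by simp
  have flags: "flags P = {\<Phi>}" using rank_zero_flags[OF n assms(1)] assms(1) by blast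
  have one: "f = \<one>\<^bsub>aut_group P\<^esub>" if "f \<in> carrier (aut_group P)" for f
    by (rule aut_eqI[OF that _ assms(1)])
      (use rank_zero_flags[OF n] aut_flag[OF that assms(1)] aut_flag[OF Aut.one_closed assms(1)] in auto)
  then have "carrier (aut_group P) = {\<one>\<^bsub>aut_group P\<^esub>}" by auto
  then have "rcosets\<^bsub>aut_group P\<^esub> H = {H #>\<^bsub>aut_group P\<^esub> \<one>\<^bsub>aut_group P\<^esub>}" for H
    unfolding RCOSETS_def by simp
  then show False using assms(2) flags unfolding chiral_def directly_regular_def by simp
qed

lemma rotary_generators_in:
  assumes \<Phi>: "\<Phi> \<in> flags P" and rotary: "chiral n P \<or> directly_regular n P \<Phi>"
    and i: "i \<in> {1..n - 1}"
  shows "rot_gen n P \<Phi> i \<in> carrier (aut_group P) \<and>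
    rot_gen n P \<Phi> i ` \<Phi> = flag_adj P (i - 1) (flag_adj P i \<Phi>)"
proof -
  interpret Aut: group "aut_group P" by (rule group_aut_group)
  have i': "i < n" "i - 1 < n" using i by auto
  have flags: "flag_adj P i \<Phi> \<in> flags P" "flag_adj P (i - 1) \<Phi> \<in> flags P"
    "flag_adj P (i - 1) (flag_adj P i \<Phi>) \<in> flags P"
    using flag_adj_in \<Phi> i' by simp_all
  show ?thesis
  proof (cases "chiral n P")
    case True
    define orb where "orb = flag_orbit P"
    have card: "card (orb ` flags P) = 2"
      and adj: "\<And>X Y. X \<in> flags P \<Longrightarrow> Y \<in> flags P \<Longrightarrow> adjacent X Y \<Longrightarrow> orb X \<noteq> orb Y"
      using True unfolding chiral_def orb_def by blast+
    have "orb \<Phi> \<noteq> orb (flag_adj P i \<Phi>)"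
      "orb (flag_adj P i \<Phi>) \<noteq> orb (flag_adj P (i - 1) (flag_adj P i \<Phi>))"
      using adj \<Phi> flags adjacent_flag_adj i' by simp_all
    moreover obtain a b where "orb ` flags P = {a, b}"
      using card unfolding card_2_iff by blast
    then have "orb X = a \<or> orb X = b" if "X \<in> flags P" for X using that by blast
    \<comment> \<open>There are two orbits and each adjacency step changes the orbit, so two steps
      lead back to the first.\<close>
    from this[OF \<Phi>] this[OF flags(1)] this[OF flags(3)]
    have "orb (flag_adj P (i - 1) (flag_adj P i \<Phi>)) = orb \<Phi>"
      using calculation by metis
    then have "flag_adj P (i - 1) (flag_adj P i \<Phi>) \<in> flag_orbit P \<Phi>"
      using flag_orbit_self[OF flag_faces[OF flags(3)]] unfolding orb_def by simp
    then obtain f where f: "f \<in> carrier (aut_group P)" "f ` \<Phi> = flag_adj P (i - 1) (flag_adj P i \<Phi>)"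
      unfolding flag_orbit_def by auto
    have "rot_gen n P \<Phi> i = f"
      unfolding rot_gen_def using regular_not_chiral True aut_to_eqI[OF f(1) \<Phi> f(2)] by auto
    then show ?thesis using f by simp
  next
    case False
    then have reg: "regular n P" using rotary unfolding directly_regular_def by blast
    have refl: "refl_gen P \<Phi> k \<in> carrier (aut_group P) \<and> refl_gen P \<Phi> k ` \<Phi> = flag_adj P k \<Phi>"
      if k: "k < n" for k
    proof -
      obtain f where f: "f \<in> carrier (aut_group P)" "f ` \<Phi> = flag_adj P k \<Phi>"
        using reg \<Phi> flag_adj_in[OF \<Phi> k] unfolding regular_def by blast
      then show ?thesis unfolding refl_gen_def using aut_to_eqI[OF f(1) \<Phi> f(2)] by simp
    qed
    let ?a = "refl_gen P \<Phi> (i - 1)" and ?b = "refl_gen P \<Phi> i"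
    have eq: "rot_gen n P \<Phi> i = ?a \<otimes>\<^bsub>aut_group P\<^esub> ?b"
      unfolding rot_gen_def using reg by simp
    \<comment> \<open>Since \<open>?a\<close> acts first, \<open>?b\<close> is applied to the
      \<open>(i - 1)\<close>-adjacent flag; the change at \<open>i - 1\<close> passes through
      \<open>?b\<close> and ends up after the change at \<open>i\<close>.\<close>
    have "?b ` flag_adj P (i - 1) \<Phi> = flag_adj P (i - 1) (?b ` \<Phi>)"
      by (rule aut_flag_adj[OF _ \<Phi> i'(2)]) (use refl i' in blast)
    then have "(?a \<otimes>\<^bsub>aut_group P\<^esub> ?b) ` \<Phi> = flag_adj P (i - 1) (flag_adj P i \<Phi>)"
      using aut_mult_image[OF flag_faces[OF \<Phi>]] refl i' by simp
    then show ?thesis unfolding eq using refl i' by simp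
  qed
qed

text \<open>In a chiral polytope \<open>\<Phi>\<close> and \<open>\<Phi>\<^sup>0\<close> lie in
  different orbits, so no automorphism joins them. In a directly regular one, a rotation joining
  them would turn every automorphism into a rotation, against index 2.\<close>

lemma rotary_polytopeI:
  assumes \<Phi>: "\<Phi> \<in> flags P" and rotary: "chiral n P \<or> directly_regular n P \<Phi>"
  shows "rotary_polytope n P \<Phi> (rot_gen n P \<Phi>)"
    and "carrier (rot_group n P \<Phi>) = rotary_generators.rotations n P (rot_gen n P \<Phi>)"
proof -
  interpret G: rotary_generators n P \<Phi> "rot_gen n P \<Phi>"
    by unfold_locales
      (use \<Phi> rotary_rank_pos[OF \<Phi> rotary] rotary_generators_in[OF \<Phi> rotary] in auto)
  have no_refl: "f ` \<Phi> \<noteq> flag_adj P 0 \<Phi>"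
    if f: "f \<in> (if chiral n P then carrier (aut_group P) else G.rotations)" for f
  proof
    assume refl: "f ` \<Phi> = flag_adj P 0 \<Phi>"
    show False
    proof (cases "chiral n P")
      case True
      then have "flag_orbit P \<Phi> \<noteq> flag_orbit P (flag_adj P 0 \<Phi>)"
        using \<Phi> G.adj_base[OF G.rank_pos] adjacent_flag_adj[OF \<Phi> G.rank_pos]
        unfolding chiral_def by blast
      then show False
        using flag_orbit_aut_image[OF _ flag_faces[OF \<Phi>], of f] f True refl by simp
    next
      case False
      then have fH: "f \<in> G.rotations" using f by simp
      have "carrier (aut_group P) \<subseteq> G.rotations"
      proof
        fix a assume a: "a \<in> carrier (aut_group P)"
        obtain g b where g: "g \<in> G.rotations" "a ` \<Phi> = G.orbit_flag (g, b)"
          by (rule G.orbit_flag_surj[OF aut_flag[OF a \<Phi>]])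
        define h where "h = (if b then f \<otimes>\<^bsub>aut_group P\<^esub> g else g)"
        have h: "h \<in> G.rotations"
          unfolding h_def using g(1) fH subgroup.m_closed[OF G.rotations_subgroup] by simp
        have "a ` \<Phi> = h ` \<Phi>"
          using g(2) refl aut_mult_image[OF flag_faces[OF \<Phi>]] unfolding h_def G.orbit_flag_def by simp
        then have "a = h" by (rule aut_eqI[OF a G.rotations_aut[OF h] \<Phi>])
        then show "a \<in> G.rotations" using h by simp
      qed
      then have "rcosets\<^bsub>aut_group P\<^esub> G.rotations \<subseteq> {G.rotations}"
        unfolding RCOSETS_def
        using G.Aut.coset_join2[OF _ G.rotations_subgroup] by blast
      then have "card (rcosets\<^bsub>aut_group P\<^esub> G.rotations) \<le> card {G.rotations}"
        by (intro card_mono) auto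
      then show False
        using rotary False unfolding directly_regular_def G.rotations_def by simp
    qed
  qed
  show "rotary_polytope n P \<Phi> (rot_gen n P \<Phi>)"
    by unfold_locales (use no_refl G.rotations_aut in \<open>auto split: if_splits\<close>)
  show "carrier (rot_group n P \<Phi>) = G.rotations"
  proof (cases "chiral n P")
    case True
    have "carrier (aut_group P) \<subseteq> G.rotations"
    proof
      fix a assume a: "a \<in> carrier (aut_group P)"
      obtain g b where g: "g \<in> G.rotations" "a ` \<Phi> = G.orbit_flag (g, b)"
        by (rule G.orbit_flag_surj[OF aut_flag[OF a \<Phi>]])
      note gA = G.rotations_aut[OF g(1)]
      show "a \<in> G.rotations"
      proof (cases b)
        case False
        then have "a ` \<Phi> = g ` \<Phi>" using g(2) unfolding G.orbit_flag_def by simp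
        then show ?thesis using aut_eqI[OF a gA \<Phi>] g(1) by simp
      next
        case b: True
        then have "(a \<otimes>\<^bsub>aut_group P\<^esub> inv\<^bsub>aut_group P\<^esub> g) ` \<Phi> = flag_adj P 0 \<Phi>"
          using g(2) aut_mult_image[OF flag_faces[OF \<Phi>]]
            aut_inv_image(1)[OF gA flag_faces[OF G.adj_base[OF G.rank_pos]]]
          unfolding G.orbit_flag_def by simp
        moreover have "a \<otimes>\<^bsub>aut_group P\<^esub> inv\<^bsub>aut_group P\<^esub> g \<in> carrier (aut_group P)"
          using a gA by simp
        ultimately show ?thesis using no_refl True by auto
      qed
    qed
    then show ?thesis
      unfolding rot_group_def using True G.rotations_aut by auto
  next
    case False
    then show ?thesis unfolding rot_group_def G.rotations_def by simp
  qed
qed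

end

section \<open>Rotary polytopes are chiral or directly regular\<close>

context rotary_polytope
begin

text \<open>Rotations reach the even flags from \<open>\<Phi>\<close>, and \<open>f\<close> followed
  by rotations reaches the odd ones.\<close>

lemma regular_if_reflection:
  assumes f: "f \<in> carrier (aut_group P)" "f ` \<Phi> = flag_adj P 0 \<Phi>"
  shows "regular n P"
  unfolding regular_def
proof (intro conjI ballI)
  have reach: "\<exists>a\<in>carrier (aut_group P). a ` \<Phi> = X" if X: "X \<in> flags P" for X
  proof -
    obtain g b where g: "g \<in> rotations" "X = orbit_flag (g, b)" by (rule orbit_flag_surj[OF X])
    show ?thesis
    proof (intro bexI)
      show "(if b then f \<otimes>\<^bsub>aut_group P\<^esub> g else g) ` \<Phi> = X"
        using g(2) f(2) aut_mult_image[OF flag_faces[OF base_flag]] unfolding orbit_flag_def by simp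
      show "(if b then f \<otimes>\<^bsub>aut_group P\<^esub> g else g) \<in> carrier (aut_group P)"
        using rotations_aut[OF g(1)] f(1) by simp
    qed
  qed
  fix X Y assume XY: "X \<in> flags P" "Y \<in> flags P"
  obtain a where a: "a \<in> carrier (aut_group P)" "a ` \<Phi> = X" using reach[OF XY(1)] by blast
  obtain b where b: "b \<in> carrier (aut_group P)" "b ` \<Phi> = Y" using reach[OF XY(2)] by blast
  have "(inv\<^bsub>aut_group P\<^esub> a \<otimes>\<^bsub>aut_group P\<^esub> b) ` X = Y"
    using aut_mult_image[OF flag_faces[OF XY(1)]] aut_inv_image(1)[OF a(1) flag_faces[OF base_flag]]
      a(2) b(2) by simp
  moreover have "inv\<^bsub>aut_group P\<^esub> a \<otimes>\<^bsub>aut_group P\<^esub> b \<in> carrier (aut_group P)" using a(1) b(1) by simp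
  ultimately show "\<exists>f\<in>carrier (aut_group P). f ` X = Y" by blast
qed (rule polytope)

lemma odd_adj_base: "i < n \<Longrightarrow> odd_flag (flag_adj P i \<Phi>)"
  using odd_flag_adj[OF base_flag] odd_base by simp

text \<open>The even automorphisms are the rotations and any two odd ones differ by a rotation, so a
  single odd automorphism yields exactly two cosets.\<close>

lemma card_rcosets_rotations:
  assumes f: "f \<in> carrier (aut_group P)" "odd_flag (f ` \<Phi>)"
  shows "card (rcosets\<^bsub>aut_group P\<^esub> rotations) = 2"
proof -
  have sub: "rotations \<subseteq> carrier (aut_group P)" using rotations_aut by blast
  have "rotations #>\<^bsub>aut_group P\<^esub> a \<in> {rotations, rotations #>\<^bsub>aut_group P\<^esub> f}"
    if a: "a \<in> carrier (aut_group P)" for a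
  proof (cases "odd_flag (a ` \<Phi>)")
    case False
    then have "a \<in> rotations" using rotation_iff_even[OF a] by simp
    then show ?thesis using Aut.coset_join2[OF a rotations_subgroup] by simp
  next
    case True
    let ?h = "a \<otimes>\<^bsub>aut_group P\<^esub> inv\<^bsub>aut_group P\<^esub> f"
    have h: "?h \<in> carrier (aut_group P)" using a f by simp
    have "f ` ?h ` \<Phi> = a ` \<Phi>"
      using aut_mult_image[OF flag_faces[OF base_flag]]
        aut_inv_image(2)[OF f(1) flag_faces[OF aut_flag[OF a base_flag]]] by simp
    then have "\<not> odd_flag (?h ` \<Phi>)"
      using odd_aut_image[OF f(1) aut_flag[OF h base_flag]] f(2) True by simp
    then have "?h \<in> rotations" using rotation_iff_even[OF h] by simp
    then have "rotations #>\<^bsub>aut_group P\<^esub> ?h = rotations"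
      using Aut.coset_join2[OF h rotations_subgroup] by simp
    moreover have "?h \<otimes>\<^bsub>aut_group P\<^esub> f = a" using a f(1) by (simp add: Aut.m_assoc)
    ultimately have "rotations #>\<^bsub>aut_group P\<^esub> a = rotations #>\<^bsub>aut_group P\<^esub> f"
      using Aut.coset_mult_assoc[OF sub h f(1)] by simp
    then show ?thesis by simp
  qed
  moreover have "rotations = rotations #>\<^bsub>aut_group P\<^esub> \<one>\<^bsub>aut_group P\<^esub>"
    using Aut.coset_mult_one[OF sub] by simp
  ultimately have "rcosets\<^bsub>aut_group P\<^esub> rotations = {rotations, rotations #>\<^bsub>aut_group P\<^esub> f}"
    unfolding RCOSETS_def using f(1) Aut.one_closed by blast
  moreover have "f \<in> rotations #>\<^bsub>aut_group P\<^esub> f"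
    by (rule Aut.rcos_self[OF f(1) rotations_subgroup])
  then have "rotations \<noteq> rotations #>\<^bsub>aut_group P\<^esub> f"
    using rotation_iff_even[OF f(1)] f(2) by blast
  ultimately show ?thesis by simp
qed

text \<open>The case distinction is whether some automorphism takes \<open>\<Phi>\<close> to
  \<open>\<Phi>\<^sup>0\<close>. If so, the polytope is directly regular; if not, the two parities
  are the two flag orbits. By freeness \<open>rot_gen\<close> returns the given \<open>s i\<close>
  in both cases, although its definition treats them differently.\<close>

theorem rotary:
  shows chiral_or_directly_regular: "chiral n P \<or> directly_regular n P \<Phi>"
    and rot_gen_eq: "i \<in> {1..n - 1} \<Longrightarrow> rot_gen n P \<Phi> i = s i"
    and carrier_rot_group: "carrier (rot_group n P \<Phi>) = rotations"
proof -
  have s_unique: "f = s i"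
    if "i \<in> {1..n - 1}" "f \<in> carrier (aut_group P)" "f ` \<Phi> = flag_adj P (i - 1) (flag_adj P i \<Phi>)" for f i
    by (rule aut_eqI[OF that(2) s_aut[OF that(1)] base_flag]) (use that s_base in simp)
  have rotary: "chiral n P \<or> directly_regular n P \<Phi>"
  proof (cases "\<exists>f\<in>carrier (aut_group P). f ` \<Phi> = flag_adj P 0 \<Phi>")
    case True
    then obtain f where f: "f \<in> carrier (aut_group P)" "f ` \<Phi> = flag_adj P 0 \<Phi>" by blast
    note reg = regular_if_reflection[OF f]
    have refl: "refl_gen P \<Phi> k \<in> carrier (aut_group P) \<and> refl_gen P \<Phi> k ` \<Phi> = flag_adj P k \<Phi>"
      if k: "k < n" for k
    proof -
      obtain g where g: "g \<in> carrier (aut_group P)" "g ` \<Phi> = flag_adj P k \<Phi>"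
        using reg base_flag adj_base[OF k] unfolding regular_def by blast
      then show ?thesis unfolding refl_gen_def using aut_to_eqI[OF g(1) base_flag g(2)] by simp
    qed
    have "rot_gen n P \<Phi> i = s i" if i: "i \<in> {1..n - 1}" for i
    proof -
      let ?a = "refl_gen P \<Phi> (i - 1)" and ?b = "refl_gen P \<Phi> i"
      have i': "i < n" "i - 1 < n" using i by auto
      have "?b ` flag_adj P (i - 1) \<Phi> = flag_adj P (i - 1) (?b ` \<Phi>)"
        by (rule aut_flag_adj[OF _ base_flag i'(2)]) (use refl i' in blast)
      then have "(?a \<otimes>\<^bsub>aut_group P\<^esub> ?b) ` \<Phi> = flag_adj P (i - 1) (flag_adj P i \<Phi>)"
        using aut_mult_image[OF flag_faces[OF base_flag]] refl i' by simp
      then have "?a \<otimes>\<^bsub>aut_group P\<^esub> ?b = s i" using s_unique[OF i] refl i' by simp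
      then show ?thesis unfolding rot_gen_def using reg by simp
    qed
    then have "rot_gen n P \<Phi> ` {1..n - 1} = s ` {1..n - 1}" by (rule image_cong[OF HOL.refl])
    then have "card (rcosets\<^bsub>aut_group P\<^esub> (generate (aut_group P) (rot_gen n P \<Phi> ` {1..n - 1}))) = 2"
      using card_rcosets_rotations[OF f(1)] f(2) odd_adj_base[OF rank_pos] unfolding rotations_def by simp
    then show ?thesis using reg unfolding directly_regular_def by blast
  next
    case False
    have base_orbits: "flag_orbit P X = (if odd_flag X then flag_orbit P (flag_adj P 0 \<Phi>) else flag_orbit P \<Phi>)"
      if "X \<in> flags P" for X
    proof -
      have orb: "flag_orbit P (g ` Z) = flag_orbit P Z" if "g \<in> rotations" "Z \<in> flags P" for g Z
        by (rule flag_orbit_aut_image[OF rotations_aut[OF that(1)] flag_faces[OF that(2)]])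
      from \<open>X \<in> flags P\<close> show ?thesis
      proof (cases rule: odd_flag_cases)
        case (1 g)
        have "flag_orbit P X = flag_orbit P \<Phi>" unfolding 1(3) by (rule orb[OF 1(1) base_flag])
        then show ?thesis using 1(2) by simp
      next
        case (2 g)
        have "flag_orbit P X = flag_orbit P (flag_adj P 0 \<Phi>)"
          unfolding 2(3) by (rule orb[OF 2(1) adj_base[OF rank_pos]])
        then show ?thesis using 2(2) by simp
      qed
    qed
    have "flag_adj P 0 \<Phi> \<notin> flag_orbit P \<Phi>"
      using False unfolding flag_orbit_def by auto
    then have neq: "flag_orbit P \<Phi> \<noteq> flag_orbit P (flag_adj P 0 \<Phi>)"
      using flag_orbit_self[OF flag_faces[OF adj_base[OF rank_pos]]] by metis
    have "flag_orbit P ` flags P = {flag_orbit P \<Phi>, flag_orbit P (flag_adj P 0 \<Phi>)}"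
    proof
      show "flag_orbit P ` flags P \<subseteq> {flag_orbit P \<Phi>, flag_orbit P (flag_adj P 0 \<Phi>)}"
        using base_orbits by (intro image_subsetI) simp
      show "{flag_orbit P \<Phi>, flag_orbit P (flag_adj P 0 \<Phi>)} \<subseteq> flag_orbit P ` flags P"
        using base_flag adj_base[OF rank_pos] by blast
    qed
    then have "card (flag_orbit P ` flags P) = 2" using neq by simp
    moreover have "flag_orbit P X \<noteq> flag_orbit P Y"
      if XY: "X \<in> flags P" "Y \<in> flags P" "adjacent X Y" for X Y
    proof -
      obtain j where "j < n" "Y = flag_adj P j X" by (rule adjacent_flags[OF XY])
      then show ?thesis
        using odd_flag_adj[OF XY(1)] base_orbits[OF XY(1)] base_orbits[OF XY(2)] neq by auto
    qed
    ultimately show ?thesis using polytope unfolding chiral_def by blast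
  qed
  then show "chiral n P \<or> directly_regular n P \<Phi>" .
  have gen: "rot_gen n P \<Phi> i = s i" if "i \<in> {1..n - 1}" for i
    using s_unique[OF that] rotary_generators_in[OF base_flag rotary that] by blast
  then show "i \<in> {1..n - 1} \<Longrightarrow> rot_gen n P \<Phi> i = s i" .
  interpret R: rotary_polytope n P \<Phi> "rot_gen n P \<Phi>" by (rule rotary_polytopeI[OF base_flag rotary])
  have "R.rotations = rotations"
    unfolding rotations_def R.rotations_def using gen by (metis image_cong)
  then show "carrier (rot_group n P \<Phi>) = rotations"
    using rotary_polytopeI(2)[OF base_flag rotary] by simp
qed

lemma rot_group_eq: "rot_group n P \<Phi> = rotation_group"
proof -
  have "rot_group n P \<Phi> = (aut_group P)\<lparr>carrier := carrier (rot_group n P \<Phi>)\<rparr>"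
    unfolding rot_group_def by simp
  then show ?thesis using carrier_rot_group by simp
qed

end

section \<open>The poset of a group\<close>

text \<open>A map that intertwines two systems up to a renaming of letters transports words letter
  by letter, hence also the sets of reachable elements.\<close>

lemma joined_image:
  assumes "\<And>i u. i \<in> K \<Longrightarrow> u \<in> V \<Longrightarrow> r i u \<in> V"
    and "\<And>i u. i \<in> K \<Longrightarrow> u \<in> V \<Longrightarrow> f (r i u) = r' (\<pi> i) (f u)"
    and u: "u \<in> V"
  shows "f ` {v. joined r K u v} = {v. joined r' (\<pi> ` K) (f u) v}"
proof -
  have fold: "f (fold r w u) = fold r' (map \<pi> w) (f u)" if "w \<in> lists K" for w
    unfolding fold_map
    by (rule fold_equivariant[OF _ _ that u]) (simp_all add: assms(1,2))
  have "{v. joined r K u v} = (\<lambda>w. fold r w u) ` lists K"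
    unfolding joined_def by auto
  moreover have "{v. joined r' (\<pi> ` K) (f u) v} = (\<lambda>w. fold r' w (f u)) ` map \<pi> ` lists K"
    unfolding joined_def lists_image[symmetric] by auto
  ultimately show ?thesis using fold by (auto simp: image_image intro!: image_cong)
qed

text \<open>Both automorphisms and dualities arise in this way, with \<open>\<pi>\<close> the identity and the reversal of
  the ranks, respectively.\<close>

definition lift_face :: "(int \<Rightarrow> int) \<Rightarrow> ('v \<Rightarrow> 'v) \<Rightarrow> int \<times> 'v set \<Rightarrow> int \<times> 'v set" where
  "lift_face \<pi> f F = (\<pi> (fst F), f ` snd F)"

text \<open>Ranks are integers and letters are natural numbers, so \<open>\<pi>\<close> acts on
  letters through \<open>int\<close> and \<open>nat\<close>. The conditions make it permute the
  proper ranks among themselves, and therefore also the ranks -1 and \<open>n\<close>.\<close>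

locale flag_system_map = polytopal_flag_system n V r
  for n and V :: "'v set" and r +
  fixes f :: "'v \<Rightarrow> 'v" and \<pi> :: "int \<Rightarrow> int"
  assumes f_bij: "bij_betw f V V"
    and \<pi>_bij: "bij_betw \<pi> {- 1..int n} {- 1..int n}"
    and \<pi>_proper: "bij_betw (\<lambda>i. nat (\<pi> (int i))) {..<n} {..<n}"
    and f_adj: "i < n \<Longrightarrow> u \<in> V \<Longrightarrow> f (r i u) = r (nat (\<pi> (int i))) (f u)"
    and \<pi>_nonneg: "i < n \<Longrightarrow> 0 \<le> \<pi> (int i)"
begin

lemma f_in: "u \<in> V \<Longrightarrow> f u \<in> V"
  using f_bij unfolding bij_betw_def by blast

lemma lift_flag_face:
  assumes u: "u \<in> V" and j: "j \<in> {- 1..int n}"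
  shows "lift_face \<pi> f (face j u) = face (\<pi> j) (f u)"
proof -
  let ?p = "\<lambda>i. nat (\<pi> (int i))"
  have proper: "int (?p i) \<noteq> \<pi> j \<longleftrightarrow> int i \<noteq> j" if "i < n" for i
    using \<pi>_nonneg[OF that] bij_betw_imp_inj_on[OF \<pi>_bij] j that
    by (auto dest!: inj_onD)
  have p: "?p ` {..<n} = {..<n}" using \<pi>_proper unfolding bij_betw_def by blast
  have "?p ` {i. i < n \<and> int i \<noteq> j} = {i. i < n \<and> int i \<noteq> \<pi> j}"
  proof
    show "?p ` {i. i < n \<and> int i \<noteq> j} \<subseteq> {i. i < n \<and> int i \<noteq> \<pi> j}"
      using p proper by (intro image_subsetI) blast
    show "{i. i < n \<and> int i \<noteq> \<pi> j} \<subseteq> ?p ` {i. i < n \<and> int i \<noteq> j}"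
    proof
      fix k assume k: "k \<in> {i. i < n \<and> int i \<noteq> \<pi> j}"
      then obtain i where "i < n" "k = ?p i" using p by blast
      then show "k \<in> ?p ` {i. i < n \<and> int i \<noteq> j}" using proper k by blast
    qed
  qed
  then have "f ` {v. joined r {i. i < n \<and> int i \<noteq> j} u v} = {v. joined r {i. i < n \<and> int i \<noteq> \<pi> j} (f u) v}"
    using joined_image[of "{i. i < n \<and> int i \<noteq> j}" V r f r ?p u] adj_in f_adj u by simp
  then show ?thesis unfolding lift_face_def flag_face_def by simp
qed

lemma lift_flag_of: "u \<in> V \<Longrightarrow> lift_face \<pi> f ` flag_of n r u = flag_of n r (f u)"
proof -
  assume u: "u \<in> V"
  have "lift_face \<pi> f ` flag_of n r u = (\<lambda>j. face (\<pi> j) (f u)) ` {- 1..int n}"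
    unfolding flag_of_def image_image using lift_flag_face[OF u] by (intro image_cong) auto
  also have "\<dots> = (\<lambda>j. face j (f u)) ` \<pi> ` {- 1..int n}" by (simp only: image_image)
  also have "\<pi> ` {- 1..int n} = {- 1..int n}" using \<pi>_bij unfolding bij_betw_def by blast
  finally show ?thesis unfolding flag_of_def .
qed

lemma face_subset: "F \<in> faces poset \<Longrightarrow> snd F \<subseteq> V"
proof -
  assume "F \<in> faces poset"
  then obtain j u where F: "F = face j u" "u \<in> V" unfolding faces_flag_poset by blast
  have "{i. i < n \<and> int i \<noteq> j} \<subseteq> {..<n}" by auto
  then show ?thesis using joined_in[OF _ _ F(2)] unfolding F(1) flag_face_def by auto
qed

lemma lift_bij: "bij_betw (lift_face \<pi> f) (faces poset) (faces poset)"
proof (rule bij_betw_imageI)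
  show "inj_on (lift_face \<pi> f) (faces poset)"
  proof (rule inj_onI)
    fix F G assume F: "F \<in> faces poset" and G: "G \<in> faces poset"
      and eq: "lift_face \<pi> f F = lift_face \<pi> f G"
    have "fst F = fst G"
      using eq inj_onD[OF bij_betw_imp_inj_on[OF \<pi>_bij] _ flag_poset_rank[OF F] flag_poset_rank[OF G]]
      unfolding lift_face_def by simp
    moreover have "snd F = snd G"
      using eq inj_on_image_eq_iff[OF bij_betw_imp_inj_on[OF f_bij] face_subset[OF F] face_subset[OF G]]
      unfolding lift_face_def by simp
    ultimately show "F = G" by (rule prod_eqI)
  qed
  show "lift_face \<pi> f ` faces poset = faces poset"
  proof
    show "lift_face \<pi> f ` faces poset \<subseteq> faces poset"
    proof (rule image_subsetI)
      fix F assume "F \<in> faces poset"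
      then obtain j u where F: "F = face j u" "j \<in> {- 1..int n}" "u \<in> V"
        unfolding faces_flag_poset by blast
      have "\<pi> j \<in> {- 1..int n}" using \<pi>_bij F(2) unfolding bij_betw_def by blast
      then show "lift_face \<pi> f F \<in> faces poset"
        unfolding F(1) lift_flag_face[OF F(3,2)] using flag_face_in_poset[OF f_in[OF F(3)]] by simp
    qed
    show "faces poset \<subseteq> lift_face \<pi> f ` faces poset"
    proof
      fix F assume "F \<in> faces poset"
      then obtain j u where F: "F = face j u" "j \<in> {- 1..int n}" "u \<in> V"
        unfolding faces_flag_poset by blast
      obtain k where k: "k \<in> {- 1..int n}" "j = \<pi> k"
        using \<pi>_bij F(2) unfolding bij_betw_def by blast
      obtain v where v: "v \<in> V" "u = f v"
        using f_bij F(3) unfolding bij_betw_def by blast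
      have "F = lift_face \<pi> f (face k v)"
        unfolding F(1) lift_flag_face[OF v(1) k(1)] k(2) v(2) ..
      moreover have "face k v \<in> faces poset" using flag_face_in_poset[OF v(1)] k(1) by simp
      ultimately show "F \<in> lift_face \<pi> f ` faces poset" by blast
    qed
  qed
qed

lemma lift_incident:
  assumes "F \<in> faces poset" "G \<in> faces poset"
  shows "snd (lift_face \<pi> f F) \<inter> snd (lift_face \<pi> f G) \<noteq> {} \<longleftrightarrow> snd F \<inter> snd G \<noteq> {}"
  using inj_on_image_Int[OF bij_betw_imp_inj_on[OF f_bij] face_subset[OF assms(1)] face_subset[OF assms(2)]]
  unfolding lift_face_def by auto

lemma lift_in: "F \<in> faces poset \<Longrightarrow> lift_face \<pi> f F \<in> faces poset"
  using lift_bij unfolding bij_betw_def by blast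

lemma face_le_iff: "(F, G) \<in> face_le poset \<longleftrightarrow>
    F \<in> faces poset \<and> G \<in> faces poset \<and> fst F \<le> fst G \<and> snd F \<inter> snd G \<noteq> {}"
  by (simp add: flag_poset_def Let_def)

lemma lift_automorphism:
  assumes "\<And>i j. i \<in> {- 1..int n} \<Longrightarrow> j \<in> {- 1..int n} \<Longrightarrow> \<pi> i \<le> \<pi> j \<longleftrightarrow> i \<le> j"
  shows "restrict (lift_face \<pi> f) (faces poset) \<in> carrier (aut_group poset)"
proof (rule autI)
  show "bij_betw (restrict (lift_face \<pi> f) (faces poset)) (faces poset) (faces poset)"
    using lift_bij by (simp add: bij_betw_restrict_eq)
  fix F G assume FG: "F \<in> faces poset" "G \<in> faces poset"
  have "fst (lift_face \<pi> f F) \<le> fst (lift_face \<pi> f G) \<longleftrightarrow> fst F \<le> fst G"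
    unfolding lift_face_def using assms[OF flag_poset_rank[OF FG(1)] flag_poset_rank[OF FG(2)]] by simp
  then show "(restrict (lift_face \<pi> f) (faces poset) F, restrict (lift_face \<pi> f) (faces poset) G) \<in> face_le poset
      \<longleftrightarrow> (F, G) \<in> face_le poset"
    using FG lift_in lift_incident[OF FG] by (simp add: face_le_iff)
qed simp

lemma lift_duality:
  assumes "\<And>i j. i \<in> {- 1..int n} \<Longrightarrow> j \<in> {- 1..int n} \<Longrightarrow> \<pi> i \<le> \<pi> j \<longleftrightarrow> j \<le> i"
    and FG: "F \<in> faces poset" "G \<in> faces poset"
  shows "(lift_face \<pi> f F, lift_face \<pi> f G) \<in> face_le poset \<longleftrightarrow> (G, F) \<in> face_le poset"
proof -
  have "fst (lift_face \<pi> f F) \<le> fst (lift_face \<pi> f G) \<longleftrightarrow> fst G \<le> fst F"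
    unfolding lift_face_def using assms(1)[OF flag_poset_rank[OF FG(1)] flag_poset_rank[OF FG(2)]] by simp
  then show ?thesis
    using FG lift_in lift_incident[OF FG] by (auto simp: face_le_iff)
qed

end

text \<open>The intersection property of \<open>G\<close> appears in the form of polytopality of the
  pairs \<open>(g, b)\<close>.\<close>

locale group_flag_system = group G for G :: "('g, 'c) monoid_scheme" (structure) +
  fixes n :: nat and s :: "nat \<Rightarrow> 'g"
  assumes gen_in: "i \<in> {1..n - 1} \<Longrightarrow> s i \<in> carrier G"
    and pos: "0 < n"
    and polytopal: "polytopal_flag_system n (carrier G \<times> UNIV) (gp_adj G s)"
begin

sublocale polytopal_flag_system n "carrier G \<times> UNIV" "gp_adj G s" by (rule polytopal)

lemma rot_prod_in: "i < n \<Longrightarrow> rot_prod G s i \<in> carrier G"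
  by (induction i) (auto intro!: m_closed gen_in)

lemma gp_face_eq:
  assumes "x \<in> carrier G \<times> UNIV"
  shows "gp_face n G s j x = face j x"
proof -
  have "{(u, gp_adj G s i u) | u i. u \<in> carrier G \<times> UNIV \<and> i < n \<and> int i \<noteq> j} =
      {(u, gp_adj G s i u) | u i. u \<in> carrier G \<times> UNIV \<and> i \<in> {i. i < n \<and> int i \<noteq> j}}"
    by simp
  moreover have "joined (gp_adj G s) {i. i < n \<and> int i \<noteq> j} x y \<longleftrightarrow>
      (x, y) \<in> {(u, gp_adj G s i u) | u i. u \<in> carrier G \<times> UNIV \<and> i \<in> {i. i < n \<and> int i \<noteq> j}}\<^sup>*" for y
    by (rule joined_iff_rtrancl[OF _ assms]) (use adj_in in simp)
  ultimately show ?thesis unfolding gp_face_def flag_face_def by auto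
qed

lemma group_poset_eq: "group_poset n G s = poset"
proof -
  have "{gp_face n G s j x | j x. j \<in> {- 1..int n} \<and> x \<in> carrier G \<times> UNIV} =
      {face j x | j x. j \<in> {- 1..int n} \<and> x \<in> carrier G \<times> UNIV}"
    using gp_face_eq by metis
  then show ?thesis unfolding group_poset_def flag_poset_def by simp
qed

lemma group_poset_flag_eq: "group_poset_flag n G s = flag_of n (gp_adj G s) (\<one>, False)"
  unfolding group_poset_flag_def flag_of_def using gp_face_eq by (intro image_cong refl) simp

end

lemma rotary_generatorsI:
  assumes "polytope n P" "\<Phi> \<in> flags P" "0 < n"
    and "\<And>i. i \<in> {1..n - 1} \<Longrightarrow> s i \<in> carrier (aut_group P)"
    and "\<And>i. i \<in> {1..n - 1} \<Longrightarrow> s i ` \<Phi> = flag_adj P (i - 1) (flag_adj P i \<Phi>)"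
  shows "rotary_generators n P \<Phi> s"
  using assms by unfold_locales

context group_flag_system
begin

abbreviation "base \<equiv> (\<one>, False)"
abbreviation "base_flag \<equiv> flag_of n (gp_adj G s) base"

lemma base_in: "base \<in> carrier G \<times> UNIV"
  by simp

lemma polytope_group: "polytope n poset"
  by (rule polytope_poset) (use base_in in blast)

lemma flags_group: "flags poset = flag_of n (gp_adj G s) ` (carrier G \<times> UNIV)"
  by (rule flags_poset) (use base_in in blast)

text \<open>Connectedness of the pairs turns into generation: each adjacency step multiplies the
  group component by a product of generators or its inverse, and every element is reached from the
  identity.\<close>

lemma carrier_generated: "generate G (s ` {1..n - 1}) = carrier G"
proof
  have sub: "s ` {1..n - 1} \<subseteq> carrier G" using gen_in by blast
  let ?H = "generate G (s ` {1..n - 1})"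
  note H = generate_is_subgroup[OF sub]
  show "?H \<subseteq> carrier G" using subgroup.subset[OF H] .
  have t: "rot_prod G s i \<in> ?H" if "i < n" for i
    using that
  proof (induction i)
    case 0
    then show ?case using subgroup.one_closed[OF H] by simp
  next
    case (Suc i)
    have "s (Suc i) \<in> ?H" by (rule generate.incl) (use Suc.prems in force)
    then show ?case using Suc subgroup.m_closed[OF H] by simp
  qed
  show "carrier G \<subseteq> ?H"
  proof
    fix g assume "g \<in> carrier G"
    then have "joined (gp_adj G s) {..<n} base (g, False)" by (intro connected) auto
    then have "fst (g, False) \<in> ?H"
    proof (induction rule: joined_induct)
      case refl
      then show ?case using subgroup.one_closed[OF H] by simp
    next
      case (step x i)
      have "rot_prod G s i \<in> ?H" using t step.hyps by simp
      then show ?case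
        using step.IH subgroup.m_closed[OF H] subgroup.m_inv_closed[OF H]
        unfolding gp_adj_def by (auto split: prod.split)
    qed
    then show "g \<in> ?H" by simp
  qed
qed

section \<open>The action of the group on its poset\<close>

definition translate :: "'g \<Rightarrow> 'g \<times> bool \<Rightarrow> 'g \<times> bool" where
  "translate g u = (fst u \<otimes> g, snd u)"

text \<open>The adjacency maps multiply on the left, so right multiplication commutes with
  them.\<close>

lemma translate_map:
  assumes g: "g \<in> carrier G"
  shows "flag_system_map n (carrier G \<times> UNIV) (gp_adj G s) (translate g) (\<lambda>j. j)"
proof unfold_locales
  show "bij_betw (translate g) (carrier G \<times> UNIV) (carrier G \<times> UNIV)"
  proof (rule bij_betw_byWitness[where f' = "translate (inv g)"])
    show "\<forall>u\<in>carrier G \<times> UNIV. translate (inv g) (translate g u) = u"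
      "\<forall>u\<in>carrier G \<times> UNIV. translate g (translate (inv g) u) = u"
      using g unfolding translate_def by (auto simp: m_assoc)
    show "translate g ` (carrier G \<times> UNIV) \<subseteq> carrier G \<times> UNIV"
      "translate (inv g) ` (carrier G \<times> UNIV) \<subseteq> carrier G \<times> UNIV"
      using g unfolding translate_def by auto
  qed
  show "bij_betw (\<lambda>j. j) {- 1..int n} {- 1..int n}" unfolding bij_betw_def by (simp add: inj_on_def)
  show "bij_betw (\<lambda>i. nat (int i)) {..<n} {..<n}" unfolding bij_betw_def by (simp add: inj_on_def)
  fix i u assume i: "i < n" and u: "u \<in> carrier G \<times> (UNIV :: bool set)"
  show "translate g (gp_adj G s i u) = gp_adj G s (nat (int i)) (translate g u)"
    using rot_prod_in[OF i] g u unfolding translate_def gp_adj_def by (auto simp: m_assoc)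
qed simp

definition act :: "'g \<Rightarrow> int \<times> ('g \<times> bool) set \<Rightarrow> int \<times> ('g \<times> bool) set" where
  "act g = restrict (lift_face (\<lambda>j. j) (translate g)) (faces poset)"

lemma act_aut: "g \<in> carrier G \<Longrightarrow> act g \<in> carrier (aut_group poset)"
  unfolding act_def by (rule flag_system_map.lift_automorphism[OF translate_map]) auto

lemma flag_of_faces: "u \<in> carrier G \<times> UNIV \<Longrightarrow> flag_of n (gp_adj G s) u \<subseteq> faces poset"
  unfolding flag_of_def by (rule image_subsetI, rule flag_face_in_poset) auto

lemma act_flag_of:
  assumes g: "g \<in> carrier G" and u: "u \<in> carrier G \<times> UNIV"
  shows "act g ` flag_of n (gp_adj G s) u = flag_of n (gp_adj G s) (translate g u)"
proof -
  have "act g ` flag_of n (gp_adj G s) u = lift_face (\<lambda>j. j) (translate g) ` flag_of n (gp_adj G s) u"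
    unfolding act_def using flag_of_faces[OF u] by (intro image_cong refl) auto
  then show ?thesis using flag_system_map.lift_flag_of[OF translate_map[OF g] u] by simp
qed

lemma act_base: "g \<in> carrier G \<Longrightarrow> act g ` base_flag = flag_of n (gp_adj G s) (g, False)"
  using act_flag_of[OF _ base_in] unfolding translate_def by simp

lemma flag_of_eqD: "flag_of n (gp_adj G s) u = flag_of n (gp_adj G s) v \<Longrightarrow>
    u \<in> carrier G \<times> UNIV \<Longrightarrow> v \<in> carrier G \<times> UNIV \<Longrightarrow> u = v"
  by (rule inj_onD[OF flag_of_inj])

lemma base_flag_in: "base_flag \<in> flags poset"
  unfolding flags_group using base_in by blast

lemma act_mult:
  assumes "g \<in> carrier G" "h \<in> carrier G"
  shows "act (g \<otimes> h) = act g \<otimes>\<^bsub>aut_group poset\<^esub> act h"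
proof -
  interpret Q: abstract_polytope n poset by unfold_locales (rule polytope_group)
  interpret Aut: group "aut_group poset" by (rule group_aut_group)
  show ?thesis
  proof (rule Q.aut_eqI[OF _ _ base_flag_in])
    show "act (g \<otimes> h) \<in> carrier (aut_group poset)" using act_aut assms by simp
    show "act g \<otimes>\<^bsub>aut_group poset\<^esub> act h \<in> carrier (aut_group poset)" using act_aut assms by simp
    have "(act g \<otimes>\<^bsub>aut_group poset\<^esub> act h) ` base_flag = act h ` flag_of n (gp_adj G s) (g, False)"
      using aut_mult_image[OF flag_of_faces[OF base_in]] act_base[OF assms(1)] by simp
    also have "\<dots> = flag_of n (gp_adj G s) (g \<otimes> h, False)"
      using act_flag_of[OF assms(2), of "(g, False)"] assms unfolding translate_def by simp
    finally show "act (g \<otimes> h) ` base_flag = (act g \<otimes>\<^bsub>aut_group poset\<^esub> act h) ` base_flag"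
      using act_base assms by simp
  qed
qed

lemma act_inj: "inj_on act (carrier G)"
proof (rule inj_onI)
  fix g h assume gh: "g \<in> carrier G" "h \<in> carrier G" "act g = act h"
  have "(g, False) = (h, False)"
    by (rule flag_of_eqD) (use act_base[OF gh(1)] act_base[OF gh(2)] gh in simp_all)
  then show "g = h" by simp
qed

sublocale act: group_hom G "aut_group poset" act
  by (intro group_hom.intro group_hom_axioms.intro group_axioms group_aut_group homI act_aut act_mult)

lemma flag_adj_group:
  "u \<in> carrier G \<times> UNIV \<Longrightarrow> i < n \<Longrightarrow>
    flag_adj poset i (flag_of n (gp_adj G s) u) = flag_of n (gp_adj G s) (gp_adj G s i u)"
  by (rule flag_adj_flag_of)

text \<open>The rotations are the translations. They preserve the Boolean of a pair, so none of them
  takes the base flag to its 0-adjacent flag, whose Boolean is \<open>True\<close>.\<close>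

theorem rotary_group_poset: "rotary_polytope n poset base_flag (\<lambda>i. act (s i))"
  and rotations_group_poset: "rotary_generators.rotations n poset (\<lambda>i. act (s i)) = act ` carrier G"
proof -
  interpret R: rotary_generators n poset base_flag "\<lambda>i. act (s i)"
  proof (rule rotary_generatorsI[OF polytope_group base_flag_in pos])
    fix i assume i: "i \<in> {1..n - 1}"
    show "act (s i) \<in> carrier (aut_group poset)" by (rule act_aut[OF gen_in[OF i]])
    have i': "i < n" "i - 1 < n" "Suc (i - 1) = i" using i by auto
    note t = rot_prod_in[OF i'(1)] rot_prod_in[OF i'(2)]
    have "rot_prod G s i = rot_prod G s (i - 1) \<otimes> s i"
      using rot_prod.simps(2)[of G s "i - 1"] i'(3) by simp
    \<comment> \<open>Two adjacency steps strip the product up to \<open>i\<close> of the product up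
      to \<open>i - 1\<close> and leave the generator itself.\<close>
    then have "inv (rot_prod G s (i - 1)) \<otimes> rot_prod G s i = s i"
      using t gen_in[OF i] by (simp add: m_assoc[symmetric])
    then have "gp_adj G s (i - 1) (gp_adj G s i base) = (s i, False)"
      unfolding gp_adj_def using t by simp
    then show "act (s i) ` base_flag = flag_adj poset (i - 1) (flag_adj poset i base_flag)"
      using flag_adj_group[OF base_in i'(1)] flag_adj_group[OF adj_in[OF i'(1) base_in] i'(2)]
        act_base[OF gen_in[OF i]] by simp
  qed
  have rotations: "R.rotations = act ` carrier G"
    using act.generate_img[of "s ` {1..n - 1}"] gen_in carrier_generated
    unfolding R.rotations_def by (simp add: image_image image_subset_iff)
  then show "R.rotations = act ` carrier G" .
  show "rotary_polytope n poset base_flag (\<lambda>i. act (s i))"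
  proof unfold_locales
    fix f assume "f \<in> R.rotations"
    then obtain g where g: "g \<in> carrier G" "f = act g" unfolding rotations by blast
    have "flag_adj poset 0 base_flag = flag_of n (gp_adj G s) (\<one>, True)"
      using flag_adj_group[OF base_in pos] unfolding gp_adj_def by simp
    then show "f ` base_flag \<noteq> flag_adj poset 0 base_flag"
      using act_base[OF g(1)] flag_of_eqD[of "(g, False)" "(\<one>, True)"] g by auto
  qed
qed

lemma
  shows group_poset_rotary: "chiral n poset \<or> directly_regular n poset base_flag"
    and rot_gen_group_poset: "i \<in> {1..n - 1} \<Longrightarrow> rot_gen n poset base_flag i = act (s i)"
    and rot_group_group_poset: "rot_group n poset base_flag = (aut_group poset)\<lparr>carrier := act ` carrier G\<rparr>"
proof -
  interpret R: rotary_polytope n poset base_flag "\<lambda>i. act (s i)" by (rule rotary_group_poset)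
  show "chiral n poset \<or> directly_regular n poset base_flag" by (rule R.chiral_or_directly_regular)
  show "i \<in> {1..n - 1} \<Longrightarrow> rot_gen n poset base_flag i = act (s i)" by (rule R.rot_gen_eq)
  show "rot_group n poset base_flag = (aut_group poset)\<lparr>carrier := act ` carrier G\<rparr>"
    using R.rot_group_eq rotations_group_poset by simp
qed

lemma act_iso: "act \<in> iso G (rot_group n poset base_flag)"
  unfolding rot_group_group_poset iso_def hom_def bij_betw_def
  using act_inj act_mult by auto

lemma inv_act_iso: "inv_into (carrier G) act \<in> iso (rot_group n poset base_flag) G"
  by (rule iso_set_sym[OF act_iso])

lemma group_rot_group: "group (rot_group n poset base_flag)"
  unfolding rot_group_group_poset
  by (rule group.subgroup_imp_group[OF group_aut_group act.img_is_subgroup])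

text \<open>Orders are compared through divisibility of exponents, which also covers infinite order,
  coded by 0.\<close>

lemma ord_act:
  assumes g: "g \<in> carrier G"
  shows "group.ord (rot_group n poset base_flag) (act g) = ord g"
proof -
  interpret R: group "rot_group n poset base_flag" by (rule group_rot_group)
  interpret h: group_hom G "rot_group n poset base_flag" act
    by (intro group_hom.intro group_hom_axioms.intro group_axioms R.group_axioms)
      (use act_iso in \<open>simp add: iso_def\<close>)
  have "act g [^]\<^bsub>rot_group n poset base_flag\<^esub> k = \<one>\<^bsub>rot_group n poset base_flag\<^esub> \<longleftrightarrow> ord g dvd k"
    for k :: nat
  proof -
    have "act g [^]\<^bsub>rot_group n poset base_flag\<^esub> k = \<one>\<^bsub>rot_group n poset base_flag\<^esub> \<longleftrightarrow>
        act (g [^] k) = act \<one>"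
      using h.hom_nat_pow[OF g, of k] h.hom_one by simp
    also have "\<dots> \<longleftrightarrow> g [^] k = \<one>"
      using inj_on_eq_iff[OF act_inj, of "g [^] k" \<one>] g by simp
    finally show ?thesis using pow_eq_id[OF g] by simp
  qed
  then show ?thesis using R.ord_unique[of "act g" "ord g"] h.hom_closed[OF g] by simp
qed

end

section \<open>Mixes of polytopes of coprime type\<close>

lemma rot_prod_DirProd:
  "rot_prod (G \<times>\<times> H) (\<lambda>i. (s i, t i)) k = (rot_prod G s k, rot_prod H t k)"
  by (induction k) simp_all

lemma nat_pow_DirProd: "(x, y) [^]\<^bsub>G \<times>\<times> H\<^esub> (k :: nat) = (x [^]\<^bsub>G\<^esub> k, y [^]\<^bsub>H\<^esub> k)"
  by (induction k) (simp_all add: nat_pow_def)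

lemma ord_DirProd:
  assumes G: "group G" and H: "group H" and x: "x \<in> carrier G" and y: "y \<in> carrier H"
    and coprime: "coprime (group.ord G x) (group.ord H y)"
  shows "group.ord (G \<times>\<times> H) (x, y) = group.ord G x * group.ord H y"
proof -
  interpret GH: group "G \<times>\<times> H" by (rule DirProd_group[OF G H])
  have "group.ord G x dvd k \<and> group.ord H y dvd k \<longleftrightarrow> group.ord G x * group.ord H y dvd k" for k
    using coprime by (auto intro: divides_mult dest: dvd_mult_left dvd_mult_right)
  then show ?thesis
    using group.pow_eq_id[OF G x] group.pow_eq_id[OF H y] x y
    by (subst GH.ord_unique) (auto simp: nat_pow_DirProd)
qed

text \<open>Covers any two rotary polytopes with coprime orders; duality enters later. The flag set
  is formed from the full direct product from the start, and the identification with the subgroup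
  generated by \<open>gens\<close> is deduced from connectedness.\<close>

locale mix_polytopes =
  P: rotary_polytope n P \<Phi> s + Q: rotary_polytope n Q \<Psi> t
  for n and P :: "'a ranked_poset" and \<Phi> s and Q :: "'b ranked_poset" and \<Psi> t +
  assumes coprime_ord: "i \<in> {1..n - 1} \<Longrightarrow>
      coprime (group.ord P.rotation_group (s i)) (group.ord Q.rotation_group (t i))"
begin

abbreviation "product \<equiv> P.rotation_group \<times>\<times> Q.rotation_group"
abbreviation "gens i \<equiv> (s i, t i)"
abbreviation "mix_flags \<equiv> (P.rotations \<times> Q.rotations) \<times> (UNIV :: bool set)"

lemma group_product: "group product"
  by (rule DirProd_group[OF P.Rot.is_group Q.Rot.is_group])

text \<open>Both projections read the same Boolean, which is why the two flags of a pair have equal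
  parity.\<close>

definition fst_flag :: "(('a \<Rightarrow> 'a) \<times> ('b \<Rightarrow> 'b)) \<times> bool \<Rightarrow> 'a set" where
  "fst_flag u = P.orbit_flag (fst (fst u), snd u)"

definition snd_flag :: "(('a \<Rightarrow> 'a) \<times> ('b \<Rightarrow> 'b)) \<times> bool \<Rightarrow> 'b set" where
  "snd_flag u = Q.orbit_flag (snd (fst u), snd u)"

lemma gp_adj_product:
  assumes "a \<in> P.rotations" "b \<in> Q.rotations" "i < n"
  shows "gp_adj product gens i ((a, b), c) =
    ((fst (gp_adj P.rotation_group s i (a, c)), fst (gp_adj Q.rotation_group t i (b, c))), \<not> c)"
  unfolding gp_adj_def rot_prod_DirProd
  using inv_DirProd[OF P.Rot.is_group Q.Rot.is_group, of "rot_prod P.rotation_group s i" "rot_prod Q.rotation_group t i"]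
    P.rot_prod_rotation[OF assms(3)] Q.rot_prod_rotation[OF assms(3)]
  by (cases c) simp_all

lemma snd_gp_adj: "snd (gp_adj G x i (g, c)) = (\<not> c)"
  unfolding gp_adj_def by simp

lemma gp_adj_product_in:
  assumes "u \<in> mix_flags" "i < n"
  shows "gp_adj product gens i u \<in> mix_flags"
proof -
  obtain a b c where abc: "u = ((a, b), c)" "a \<in> P.rotations" "b \<in> Q.rotations"
    using assms(1) by blast
  then show ?thesis
    using P.gp_adj_in[OF _ assms(2), of "(a, c)"] Q.gp_adj_in[OF _ assms(2), of "(b, c)"]
    unfolding abc(1) gp_adj_product[OF abc(2,3) assms(2)] by (simp add: mem_Times_iff)
qed

lemma flag_in:
  assumes "u \<in> mix_flags"
  shows "fst_flag u \<in> flags P" and "snd_flag u \<in> flags Q"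
  unfolding fst_flag_def snd_flag_def using assms P.orbit_flag_in Q.orbit_flag_in by auto

lemma flag_gp_adj:
  assumes u: "u \<in> mix_flags" and i: "i < n"
  shows fst_flag_gp_adj: "fst_flag (gp_adj product gens i u) = flag_adj P i (fst_flag u)"
    and snd_flag_gp_adj: "snd_flag (gp_adj product gens i u) = flag_adj Q i (snd_flag u)"
proof -
  obtain a b c where abc: "u = ((a, b), c)" "a \<in> P.rotations" "b \<in> Q.rotations" using u by blast
  have "(fst (gp_adj P.rotation_group s i (a, c)), \<not> c) = gp_adj P.rotation_group s i (a, c)"
    "(fst (gp_adj Q.rotation_group t i (b, c)), \<not> c) = gp_adj Q.rotation_group t i (b, c)"
    by (simp_all add: prod_eq_iff snd_gp_adj)
  then show "fst_flag (gp_adj product gens i u) = flag_adj P i (fst_flag u)"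
    "snd_flag (gp_adj product gens i u) = flag_adj Q i (snd_flag u)"
    using P.orbit_flag_gp_adj[OF _ i, of "(a, c)"] Q.orbit_flag_gp_adj[OF _ i, of "(b, c)"] abc
    unfolding fst_flag_def snd_flag_def abc(1) gp_adj_product[OF abc(2,3) i] by simp_all
qed

lemma flags_determine:
  assumes "u \<in> mix_flags" "v \<in> mix_flags" "fst_flag u = fst_flag v" "snd_flag u = snd_flag v"
  shows "u = v"
proof -
  have "(fst (fst u), snd u) = (fst (fst v), snd v)"
    using inj_onD[OF P.orbit_flag_inj assms(3)[unfolded fst_flag_def]] assms(1,2) by auto
  moreover have "(snd (fst u), snd u) = (snd (fst v), snd v)"
    using inj_onD[OF Q.orbit_flag_inj assms(4)[unfolded snd_flag_def]] assms(1,2) by auto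
  ultimately show ?thesis by (simp add: prod_eq_iff)
qed

lemma odd_flags:
  assumes "u \<in> mix_flags"
  shows "P.odd_flag (fst_flag u) = snd u" and "Q.odd_flag (snd_flag u) = snd u"
  unfolding fst_flag_def snd_flag_def using assms P.odd_orbit_flag Q.odd_orbit_flag by auto

text \<open>Each relation holds on both projections, and these determine the pair.\<close>

lemma flag_system_mix: "flag_system n mix_flags (gp_adj product gens)"
proof
  fix i u assume i: "i < n" and u: "u \<in> mix_flags"
  note iu = gp_adj_product_in[OF u i]
  show "gp_adj product gens i u \<in> mix_flags" by (rule iu)
  show "gp_adj product gens i (gp_adj product gens i u) = u"
    by (rule flags_determine[OF gp_adj_product_in[OF iu i] u])
      (simp_all add: flag_gp_adj[OF iu i] flag_gp_adj[OF u i] P.flag_adj_adj Q.flag_adj_adj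
        flag_in[OF u] i)
next
  fix i j u assume ij: "Suc i < j" "j < n" and u: "u \<in> mix_flags"
  have i: "i < n" using ij by simp
  note iu = gp_adj_product_in[OF u i] and ju = gp_adj_product_in[OF u ij(2)]
  show "gp_adj product gens i (gp_adj product gens j u) = gp_adj product gens j (gp_adj product gens i u)"
    by (rule flags_determine[OF gp_adj_product_in[OF ju i] gp_adj_product_in[OF iu ij(2)]])
      (simp_all add: flag_gp_adj[OF iu ij(2)] flag_gp_adj[OF ju i] flag_gp_adj[OF u i]
        flag_gp_adj[OF u ij(2)] P.flag_adj_commute[OF flag_in(1)[OF u] ij]
        Q.flag_adj_commute[OF flag_in(2)[OF u] ij])
qed

lemma polytopal_mix: "polytopal_flag_system n mix_flags (gp_adj product gens)"
proof -
  interpret V: flag_system n mix_flags "gp_adj product gens" by (rule flag_system_mix)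
  \<comment> \<open>Parity serves as colour and the orders serve as periods; \<open>Suc\<close>
    passes from the letters \<open>i\<close>, \<open>i + 1\<close> to the generator with index
    \<open>i + 1\<close>.\<close>
  interpret flag_system_product n mix_flags "gp_adj product gens" "flags P" "flag_adj P" "flags Q" "flag_adj Q"
    snd P.odd_flag Q.odd_flag fst_flag snd_flag
    "\<lambda>i. group.ord P.rotation_group (s (Suc i))" "\<lambda>i. group.ord Q.rotation_group (t (Suc i))"
    by unfold_locales
      (simp_all add: flag_in flag_gp_adj flags_determine odd_flags P.odd_flag_adj Q.odd_flag_adj
        P.rotation_period Q.rotation_period coprime_ord del: fold.simps)
  show ?thesis by (rule polytopal)
qed

sublocale mix: group_flag_system product n gens
proof (intro group_flag_system.intro group_flag_system_axioms.intro group_product)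
  show "gens i \<in> carrier product" if "i \<in> {1..n - 1}" for i
    using P.s_rotation[OF that] Q.s_rotation[OF that] by simp
  show "0 < n" by (rule P.rank_pos)
  show "polytopal_flag_system n (carrier product \<times> UNIV) (gp_adj product gens)"
    using polytopal_mix by simp
qed

end

section \<open>Duality\<close>

lemma dual_simps [simp]:
  "faces (dual n P) = faces P" "face_le (dual n P) = (face_le P)\<inverse>" "rk (dual n P) F = int n - 1 - rk P F"
  by (simp_all add: dual_def)

lemma flags_dual [simp]: "flags (dual n P) = flags P"
proof -
  have "Chains ((face_le P)\<inverse>) = Chains (face_le P)" unfolding Chains_def by auto
  then show ?thesis unfolding flags_def by simp
qed

lemma aut_group_dual [simp]: "aut_group (dual n P) = aut_group P"
proof -
  have "(\<forall>F\<in>faces P. \<forall>G\<in>faces P. ((f F, f G) \<in> (face_le P)\<inverse>) = ((F, G) \<in> (face_le P)\<inverse>)) \<longleftrightarrow>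
      (\<forall>F\<in>faces P. \<forall>G\<in>faces P. ((f F, f G) \<in> face_le P) = ((F, G) \<in> face_le P))" for f
    by auto
  then show ?thesis unfolding aut_group_def dual_simps by presburger
qed

lemma flag_adj_dual:
  assumes "j < n"
  shows "flag_adj (dual n P) j X = flag_adj P (n - 1 - j) X"
proof -
  have "rk (dual n P) F \<noteq> int j \<longleftrightarrow> rk P F \<noteq> int (n - 1 - j)" for F
    using assms by auto
  then show ?thesis unfolding flag_adj_def flags_dual by presburger
qed

lemma polytope_dual:
  fixes P :: "'a ranked_poset"
  assumes "polytope n P"
  shows "polytope n (dual n P)"
proof -
  interpret P: abstract_polytope n P by unfold_locales (rule assms)
  show ?thesis
    unfolding polytope_def
  proof (intro conjI)
    show "partial_order_on (faces (dual n P)) (face_le (dual n P))"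
      using P.partial_order by simp
    show "\<forall>F\<in>faces (dual n P). - 1 \<le> rk (dual n P) F \<and> rk (dual n P) F \<le> int n"
      using P.rk_bounds by auto
    show "\<forall>F G. (F, G) \<in> face_le (dual n P) \<and> F \<noteq> G \<longrightarrow> rk (dual n P) F < rk (dual n P) G"
      using P.rk_less by auto
    have "\<exists>F\<in>faces P. rk P F = int n \<and> (\<forall>G\<in>faces P. (G, F) \<in> face_le P)"
      using assms unfolding polytope_def by (elim conjE) assumption
    then obtain F where "F \<in> faces P" "rk P F = int n" "\<forall>G\<in>faces P. (G, F) \<in> face_le P" by blast
    then show "\<exists>F\<in>faces (dual n P). rk (dual n P) F = - 1 \<and> (\<forall>G\<in>faces (dual n P). (F, G) \<in> face_le (dual n P))"
      by (intro bexI[of _ F]) simp_all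
    have "\<exists>F\<in>faces P. rk P F = - 1 \<and> (\<forall>G\<in>faces P. (F, G) \<in> face_le P)"
      using assms unfolding polytope_def by (elim conjE) assumption
    then obtain F where "F \<in> faces P" "rk P F = - 1" "\<forall>G\<in>faces P. (F, G) \<in> face_le P" by blast
    then show "\<exists>F\<in>faces (dual n P). rk (dual n P) F = int n \<and> (\<forall>G\<in>faces (dual n P). (G, F) \<in> face_le (dual n P))"
      by (intro bexI[of _ F]) simp_all
    show "\<forall>\<Phi>\<in>flags (dual n P). card \<Phi> = n + 2" using P.card_flag by simp
    show "strongly_flag_connected (dual n P)"
      using P.strongly_connected unfolding strongly_flag_connected_def by simp
    show "\<forall>F G. (F, G) \<in> face_le (dual n P) \<and> rk (dual n P) G = rk (dual n P) F + 2 \<longrightarrow>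
        card {H \<in> faces (dual n P). rk (dual n P) H = rk (dual n P) F + 1 \<and>
          (F, H) \<in> face_le (dual n P) \<and> (H, G) \<in> face_le (dual n P)} = 2"
    proof (intro allI impI)
      fix F G assume FG: "(F, G) \<in> face_le (dual n P) \<and> rk (dual n P) G = rk (dual n P) F + 2"
      then have GF: "(G, F) \<in> face_le P" "rk P F = rk P G + 2" by simp_all
      have "{H \<in> faces (dual n P). rk (dual n P) H = rk (dual n P) F + 1 \<and>
          (F, H) \<in> face_le (dual n P) \<and> (H, G) \<in> face_le (dual n P)} =
        {H \<in> faces P. rk P H = rk P G + 1 \<and> (G, H) \<in> face_le P \<and> (H, F) \<in> face_le P}"
        using GF(2) by auto
      then show "card {H \<in> faces (dual n P). rk (dual n P) H = rk (dual n P) F + 1 \<and>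
          (F, H) \<in> face_le (dual n P) \<and> (H, G) \<in> face_le (dual n P)} = 2"
        using P.card_between[OF GF] by simp
    qed
  qed
qed

locale rotary_dual = rotary_polytope n P \<Phi> s
  for n and P :: "'a ranked_poset" and \<Phi> s
begin

abbreviation "dual_gens i \<equiv> inv\<^bsub>aut_group P\<^esub> s (n - i)"

text \<open>Reversing the indices and inverting are both undone by doing them again, so each family
  lies in the group generated by the other.\<close>

lemma rotations_dual: "generate (aut_group P) (dual_gens ` {1..n - 1}) = rotations"
proof
  have dual_gens: "dual_gens i \<in> rotations" if "i \<in> {1..n - 1}" for i
    by (rule subgroup.m_inv_closed[OF rotations_subgroup s_rotation]) (use that in auto)
  then have sub: "dual_gens ` {1..n - 1} \<subseteq> carrier (aut_group P)"
    using rotations_aut by blast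
  show "generate (aut_group P) (dual_gens ` {1..n - 1}) \<subseteq> rotations"
  proof (rule Aut.generate_subgroup_incl[OF _ rotations_subgroup])
    show "dual_gens ` {1..n - 1} \<subseteq> rotations" using dual_gens by blast
  qed
  show "rotations \<subseteq> generate (aut_group P) (dual_gens ` {1..n - 1})"
    unfolding rotations_def
  proof (rule Aut.generate_subgroup_incl[OF _ Aut.generate_is_subgroup[OF sub]], rule image_subsetI)
    fix i assume i: "i \<in> {1..n - 1}"
    then have ni: "n - i \<in> {1..n - 1}" "n - (n - i) = i" by auto
    have "inv\<^bsub>aut_group P\<^esub> dual_gens (n - i) \<in> generate (aut_group P) (dual_gens ` {1..n - 1})"
      by (rule generate.inv) (rule imageI[OF ni(1)])
    then show "s i \<in> generate (aut_group P) (dual_gens ` {1..n - 1})"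
      using Aut.inv_inv[OF s_aut[OF i]] ni(2) by simp
  qed
qed

text \<open>For \<open>k = n - i\<close> the letters \<open>k\<close> and \<open>k - 1\<close> of
  \<open>P\<close> are the dual letters \<open>i - 1\<close> and \<open>i\<close>. Inverting
  \<open>s k\<close> exchanges the order of its two steps, which is the order required of a dual
  generator.\<close>

lemma rotary_dual: "rotary_polytope n (dual n P) \<Phi> dual_gens"
proof -
  interpret D: rotary_generators n "dual n P" \<Phi> dual_gens
  proof (rule rotary_generatorsI[OF polytope_dual[OF polytope]])
    show "\<Phi> \<in> flags (dual n P)" using base_flag by simp
    show "0 < n" by (rule rank_pos)
    fix i assume i: "i \<in> {1..n - 1}"
    define k where "k = n - i"
    have k: "k \<in> {1..n - 1}" "k < n" "k - 1 < n" "n - 1 - i = k - 1" "n - 1 - (i - 1) = k"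
      and i': "i < n" "i - 1 < n"
      using i unfolding k_def by auto
    have sk: "s k \<in> carrier (aut_group P)" by (rule s_aut[OF k(1)])
    show "dual_gens i \<in> carrier (aut_group (dual n P))" using sk unfolding k_def by simp
    have X: "flag_adj P k (flag_adj P (k - 1) \<Phi>) \<in> flags P"
      using flag_adj_in base_flag k by simp
    have "s k ` flag_adj P k (flag_adj P (k - 1) \<Phi>) =
        flag_adj P k (flag_adj P (k - 1) (flag_adj P (k - 1) (flag_adj P k \<Phi>)))"
      using aut_flag_adj[OF sk] flag_adj_in base_flag k s_base[OF k(1)] by simp
    also have "\<dots> = \<Phi>" using flag_adj_adj flag_adj_in base_flag k by simp
    finally have "(inv\<^bsub>aut_group P\<^esub> s k) ` \<Phi> = flag_adj P k (flag_adj P (k - 1) \<Phi>)"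
      using aut_inv_image(1)[OF sk flag_faces[OF X]] by simp
    moreover have "flag_adj (dual n P) (i - 1) (flag_adj (dual n P) i \<Phi>) =
        flag_adj P k (flag_adj P (k - 1) \<Phi>)"
      unfolding flag_adj_dual[OF i'(1)] flag_adj_dual[OF i'(2)] k(4,5) ..
    ultimately show "dual_gens i ` \<Phi> = flag_adj (dual n P) (i - 1) (flag_adj (dual n P) i \<Phi>)"
      unfolding k_def by simp
  qed
  show ?thesis
  proof unfold_locales
    fix f assume "f \<in> D.rotations"
    then have "f \<in> rotations" unfolding D.rotations_def using rotations_dual by simp
    then have "\<not> odd_flag (f ` \<Phi>)" using rotation_iff_even[OF rotations_aut] by blast
    \<comment> \<open>The 0-adjacent flag in the dual is the \<open>(n - 1)\<close>-adjacent flag of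
      \<open>P\<close>, which is odd as well.\<close>
    moreover have "odd_flag (flag_adj P (n - 1) \<Phi>)" using odd_adj_base rank_pos by simp
    ultimately show "f ` \<Phi> \<noteq> flag_adj (dual n P) 0 \<Phi>"
      using flag_adj_dual[OF rank_pos, of P \<Phi>] by auto
  qed
qed

lemma
  shows dual_rotary: "chiral n (dual n P) \<or> directly_regular n (dual n P) \<Phi>"
    and rot_gen_dual: "i \<in> {1..n - 1} \<Longrightarrow> rot_gen n (dual n P) \<Phi> i = dual_gens i"
    and rot_group_dual: "rot_group n (dual n P) \<Phi> = rotation_group"
proof -
  interpret D: rotary_polytope n "dual n P" \<Phi> dual_gens by (rule rotary_dual)
  show "chiral n (dual n P) \<or> directly_regular n (dual n P) \<Phi>" by (rule D.chiral_or_directly_regular)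
  show "i \<in> {1..n - 1} \<Longrightarrow> rot_gen n (dual n P) \<Phi> i = dual_gens i" by (rule D.rot_gen_eq)
  show "rot_group n (dual n P) \<Phi> = rotation_group"
    unfolding D.rot_group_eq D.rotations_def using rotations_dual by simp
qed

lemma ord_dual_gens:
  assumes "i \<in> {1..n - 1}"
  shows "group.ord rotation_group (dual_gens i) = group.ord rotation_group (s (n - i))"
proof -
  have "s (n - i) \<in> rotations" by (rule s_rotation) (use assms in auto)
  then show ?thesis
    using Rot.ord_inv[of "s (n - i)"] Aut.m_inv_consistent[OF rotations_subgroup] by simp
qed

end

section \<open>Self-duality of the mix\<close>

locale mix_dual = mix_polytopes n P \<Phi> s "dual n P" \<Phi> t
  for n and P :: "'a ranked_poset" and \<Phi> s t
begin

text \<open>Both parities alternate along the same edges, whose letters are merely renamed, and both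
  make the common base flag even.\<close>

lemma odd_flag_dual:
  assumes "X \<in> flags P"
  shows "Q.odd_flag X = P.odd_flag X"
  using P.connected[OF P.base_flag assms]
proof (induction rule: joined_induct)
  case refl
  then show ?case using P.odd_base Q.odd_base by simp
next
  case (step Y i)
  have i: "i < n" "n - 1 - i < n" "n - 1 - (n - 1 - i) = i" using step.hyps by auto
  have Y: "Y \<in> flags P" by (rule P.joined_in[OF step.hyps(1) _ P.base_flag]) simp
  have "flag_adj (dual n P) (n - 1 - i) Y = flag_adj P i Y"
    using flag_adj_dual[OF i(2), of P Y] i(3) by simp
  then show ?case
    using Q.odd_flag_adj[of Y, OF _ i(2)] P.odd_flag_adj[OF Y i(1)] Y step.IH by simp
qed

text \<open>Exchanging the two flags of a pair could fail only if they required different Booleans;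
  equality of the two notions of parity excludes this.\<close>

lemma swapped_flag_exists:
  assumes u: "u \<in> mix_flags"
  obtains v where "v \<in> mix_flags" "fst_flag v = snd_flag u" "snd_flag v = fst_flag u"
proof -
  have X: "snd_flag u \<in> flags P" and Y: "fst_flag u \<in> flags (dual n P)"
    using flag_in[OF u] by simp_all
  obtain a c where a: "a \<in> P.rotations" "snd_flag u = P.orbit_flag (a, c)"
    by (rule P.orbit_flag_surj[OF X])
  obtain b d where b: "b \<in> Q.rotations" "fst_flag u = Q.orbit_flag (b, d)"
    by (rule Q.orbit_flag_surj[OF Y])
  have "c = snd u"
    using P.odd_orbit_flag[OF a(1), of c] odd_flags(2)[OF u] odd_flag_dual[OF X] a(2) by simp
  moreover have "d = snd u"
    using Q.odd_orbit_flag[OF b(1), of d] odd_flags(1)[OF u] odd_flag_dual[of "fst_flag u"] Y b(2) by simp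
  ultimately have "fst_flag ((a, b), c) = snd_flag u" "snd_flag ((a, b), c) = fst_flag u"
    unfolding fst_flag_def[of "((a, b), c)"] snd_flag_def[of "((a, b), c)"] using a(2) b(2) by simp_all
  moreover have "((a, b), c) \<in> mix_flags" using a b by simp
  ultimately show ?thesis using that by blast
qed

text \<open>Specified by its effect on flags, since for odd flags the group elements themselves may
  change: one encoding starts from the 0-adjacent flag and the other from the
  \<open>(n - 1)\<close>-adjacent flag of \<open>P\<close>.\<close>

definition swap_flag where
  "swap_flag u = (SOME v. v \<in> mix_flags \<and> fst_flag v = snd_flag u \<and> snd_flag v = fst_flag u)"

lemma swap_flag:
  assumes "u \<in> mix_flags"
  shows "swap_flag u \<in> mix_flags" "fst_flag (swap_flag u) = snd_flag u" "snd_flag (swap_flag u) = fst_flag u"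
proof -
  have "\<exists>v. v \<in> mix_flags \<and> fst_flag v = snd_flag u \<and> snd_flag v = fst_flag u"
    by (rule swapped_flag_exists[OF assms]) blast
  then have "swap_flag u \<in> mix_flags \<and> fst_flag (swap_flag u) = snd_flag u \<and> snd_flag (swap_flag u) = fst_flag u"
    unfolding swap_flag_def by (rule someI_ex)
  then show "swap_flag u \<in> mix_flags" "fst_flag (swap_flag u) = snd_flag u" "snd_flag (swap_flag u) = fst_flag u"
    by simp_all
qed

lemma swap_flag_swap_flag: "u \<in> mix_flags \<Longrightarrow> swap_flag (swap_flag u) = u"
  by (rule flags_determine) (simp_all only: swap_flag)

text \<open>The letter \<open>i\<close> of the dual is the letter \<open>n - 1 - i\<close> of
  \<open>P\<close>, so exchanging the coordinates reverses the letters.\<close>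

lemma swap_flag_gp_adj:
  assumes u: "u \<in> mix_flags" and i: "i < n"
  shows "swap_flag (gp_adj product gens i u) = gp_adj product gens (n - 1 - i) (swap_flag u)"
proof (rule flags_determine)
  have j: "n - 1 - i < n" using i by simp
  note iu = gp_adj_product_in[OF u i] and su = swap_flag(1)[OF u]
  show "swap_flag (gp_adj product gens i u) \<in> mix_flags" by (rule swap_flag(1)[OF iu])
  show "gp_adj product gens (n - 1 - i) (swap_flag u) \<in> mix_flags" by (rule gp_adj_product_in[OF su j])
  show "fst_flag (swap_flag (gp_adj product gens i u)) = fst_flag (gp_adj product gens (n - 1 - i) (swap_flag u))"
    unfolding swap_flag(2)[OF iu] snd_flag_gp_adj[OF u i] fst_flag_gp_adj[OF su j] swap_flag(2)[OF u]
    by (rule flag_adj_dual[OF i])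
  have "n - 1 - (n - 1 - i) = i" using i by simp
  then show "snd_flag (swap_flag (gp_adj product gens i u)) = snd_flag (gp_adj product gens (n - 1 - i) (swap_flag u))"
    unfolding swap_flag(3)[OF iu] fst_flag_gp_adj[OF u i] snd_flag_gp_adj[OF su j] swap_flag(3)[OF u]
    using flag_adj_dual[OF j, of P "fst_flag u"] by simp
qed

lemma swap_flag_base: "swap_flag mix.base = mix.base"
proof (rule flags_determine)
  have base: "mix.base \<in> mix_flags" using mix.base_in by simp
  show "swap_flag mix.base \<in> mix_flags" "mix.base \<in> mix_flags" using swap_flag(1)[OF base] base by auto
  have "fst_flag mix.base = \<Phi>"
    unfolding fst_flag_def P.orbit_flag_def using aut_one_image[OF P.flag_faces[OF P.base_flag]] by simp
  moreover have "snd_flag mix.base = \<Phi>"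
    unfolding snd_flag_def Q.orbit_flag_def using aut_one_image[OF Q.flag_faces[OF Q.base_flag]] by simp
  ultimately show "fst_flag (swap_flag mix.base) = fst_flag mix.base"
    "snd_flag (swap_flag mix.base) = snd_flag mix.base"
    using swap_flag(2,3)[OF base] by simp_all
qed

lemma swap_map: "flag_system_map n (carrier product \<times> UNIV) (gp_adj product gens) swap_flag (\<lambda>j. int n - 1 - j)"
proof unfold_locales
  have "bij_betw swap_flag mix_flags mix_flags"
    by (rule bij_betw_byWitness[where f' = swap_flag])
      (intro ballI image_subsetI swap_flag_swap_flag swap_flag(1); assumption)+
  then show "bij_betw swap_flag (carrier product \<times> UNIV) (carrier product \<times> UNIV)"
    by simp
  show "bij_betw (\<lambda>j. int n - 1 - j) {- 1..int n} {- 1..int n}"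
    by (rule bij_betw_byWitness[where f' = "\<lambda>j. int n - 1 - j"]) auto
  show "bij_betw (\<lambda>i. nat (int n - 1 - int i)) {..<n} {..<n}"
    by (rule bij_betw_byWitness[where f' = "\<lambda>i. nat (int n - 1 - int i)"]) auto
  fix i u assume i: "i < n"
  then show "0 \<le> int n - 1 - int i" by simp
  assume "u \<in> carrier product \<times> (UNIV :: bool set)"
  moreover have "nat (int n - 1 - int i) = n - 1 - i" using i by simp
  ultimately show "swap_flag (gp_adj product gens i u) = gp_adj product gens (nat (int n - 1 - int i)) (swap_flag u)"
    using swap_flag_gp_adj[of u i] i by simp
qed

theorem properly_self_dual_mix: "properly_self_dual n mix.poset mix.base_flag"
proof -
  let ?d = "lift_face (\<lambda>j. int n - 1 - j) swap_flag"
  have "bij_betw ?d (faces mix.poset) (faces mix.poset)"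
    by (rule flag_system_map.lift_bij[OF swap_map])
  moreover have "(?d F, ?d G) \<in> face_le mix.poset \<longleftrightarrow> (G, F) \<in> face_le mix.poset"
    if "F \<in> faces mix.poset" "G \<in> faces mix.poset" for F G
    by (rule flag_system_map.lift_duality[OF swap_map _ that]) auto
  moreover have "?d ` mix.base_flag = mix.base_flag"
    using flag_system_map.lift_flag_of[OF swap_map mix.base_in] swap_flag_base by simp
  ultimately show ?thesis
    unfolding properly_self_dual_def using mix.group_poset_rotary by blast
qed

end

theorem proposition4p1:
  fixes P :: "'a ranked_poset" and \<Phi> :: "'a set" and n :: nat and p :: "nat \<Rightarrow> nat"
  assumes "\<Phi> \<in> flags P"
    and "chiral n P \<or> directly_regular n P \<Phi>"
    and "has_type n P \<Phi> p"
    and "\<And>i. i \<in> {1..n - 1} \<Longrightarrow> gcd (p i) (p (n - i)) = 1"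
  defines "M \<equiv> mix n P \<Phi> (dual n P) \<Phi>"
    and "\<Phi>M \<equiv> mix_flag n P \<Phi> (dual n P) \<Phi>"
  shows "(chiral n M \<or> directly_regular n M \<Phi>M)
    \<and> \<Phi>M \<in> flags M
    \<and> properly_self_dual n M \<Phi>M
    \<and> has_type n M \<Phi>M (\<lambda>i. p i * p (n - i))
    \<and> mix_group n P \<Phi> (dual n P) \<Phi> = rot_group n P \<Phi> \<times>\<times> rot_group n (dual n P) \<Phi>
    \<and> (\<exists>h \<in> iso (rot_group n M \<Phi>M) (rot_group n P \<Phi> \<times>\<times> rot_group n (dual n P) \<Phi>).
          \<forall>i \<in> {1..n - 1}. h (rot_gen n M \<Phi>M i) = mix_gen n P \<Phi> (dual n P) \<Phi> i)"
proof -
  let ?s = "rot_gen n P \<Phi>" and ?t = "rot_gen n (dual n P) \<Phi>"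
  have polytope: "polytope n P"
    using assms(2) unfolding chiral_def directly_regular_def regular_def by blast
  then interpret abs: abstract_polytope n P by unfold_locales
  interpret R: rotary_dual n P \<Phi> ?s
    by (rule rotary_dual.intro[OF abs.rotary_polytopeI(1)[OF assms(1,2)]])
  interpret dual: abstract_polytope n "dual n P"
    by unfold_locales (rule polytope_dual[OF polytope])
  interpret D: rotary_polytope n "dual n P" \<Phi> ?t
    by (rule dual.rotary_polytopeI(1)) (use assms(1) R.dual_rotary in simp_all)
  have A: "rot_group n P \<Phi> = R.rotation_group" by (rule R.rot_group_eq)
  have B: "rot_group n (dual n P) \<Phi> = D.rotation_group" by (rule D.rot_group_eq)
  \<comment> \<open>The dual has the same automorphisms and the same rotations, so orders may be
    computed in either group.\<close>
  have AB: "D.rotation_group = R.rotation_group" using R.rot_group_dual B by simp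
  have ord_s: "group.ord R.rotation_group (?s i) = p i" if "i \<in> {1..n - 1}" for i
    using assms(3) that unfolding has_type_def A by blast
  have ord_t: "group.ord D.rotation_group (?t i) = p (n - i)" if "i \<in> {1..n - 1}" for i
  proof -
    have "n - i \<in> {1..n - 1}" using that by auto
    then show ?thesis
      unfolding AB R.rot_gen_dual[OF that] R.ord_dual_gens[OF that] by (rule ord_s)
  qed
  interpret mix_dual n P \<Phi> ?s ?t
  proof unfold_locales
    fix i assume i: "i \<in> {1..n - 1}"
    show "coprime (group.ord R.rotation_group (?s i)) (group.ord D.rotation_group (?t i))"
      unfolding ord_s[OF i] ord_t[OF i] using assms(4)[OF i] by (simp add: coprime_iff_gcd_eq_1)
  qed
  have gens: "mix_gen n P \<Phi> (dual n P) \<Phi> = gens"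
    unfolding mix_gen_def by (rule ext) simp
  have group: "mix_group n P \<Phi> (dual n P) \<Phi> = product"
    unfolding mix_group_def gens A B mix.carrier_generated by simp
  have M: "M = mix.poset"
    unfolding M_def mix_def group gens by (rule mix.group_poset_eq)
  have \<Phi>M: "\<Phi>M = mix.base_flag"
    unfolding \<Phi>M_def mix_flag_def group gens by (rule mix.group_poset_flag_eq)
  have "group.ord (rot_group n M \<Phi>M) (rot_gen n M \<Phi>M i) = p i * p (n - i)" if i: "i \<in> {1..n - 1}" for i
  proof -
    have "group.ord product (gens i) = p i * p (n - i)"
      using ord_DirProd[OF R.Rot.is_group D.Rot.is_group, of "?s i" "?t i"] coprime_ord[OF i]
        R.s_rotation[OF i] D.s_rotation[OF i] ord_s[OF i] ord_t[OF i] by simp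
    then show ?thesis
      unfolding M \<Phi>M mix.rot_gen_group_poset[OF i] using mix.ord_act[OF mix.gen_in[OF i]] by simp
  qed
  then have type: "has_type n M \<Phi>M (\<lambda>i. p i * p (n - i))"
    unfolding has_type_def by blast
  \<comment> \<open>Undoing the translation action identifies the rotation group of the mix with the
    direct product and returns each generator to its pair.\<close>
  let ?h = "inv_into (carrier product) mix.act"
  have iso: "?h \<in> iso (rot_group n M \<Phi>M) (rot_group n P \<Phi> \<times>\<times> rot_group n (dual n P) \<Phi>)"
    unfolding M \<Phi>M A B by (rule mix.inv_act_iso)
  have "?h (rot_gen n M \<Phi>M i) = mix_gen n P \<Phi> (dual n P) \<Phi> i" if i: "i \<in> {1..n - 1}" for i
    unfolding M \<Phi>M gens mix.rot_gen_group_poset[OF i] by (rule inv_into_f_f[OF mix.act_inj mix.gen_in[OF i]])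
  then have "\<exists>h \<in> iso (rot_group n M \<Phi>M) (rot_group n P \<Phi> \<times>\<times> rot_group n (dual n P) \<Phi>).
      \<forall>i \<in> {1..n - 1}. h (rot_gen n M \<Phi>M i) = mix_gen n P \<Phi> (dual n P) \<Phi> i"
    using iso by blast
  moreover have "mix_group n P \<Phi> (dual n P) \<Phi> = rot_group n P \<Phi> \<times>\<times> rot_group n (dual n P) \<Phi>"
    unfolding group A B ..
  moreover have "(chiral n M \<or> directly_regular n M \<Phi>M) \<and> \<Phi>M \<in> flags M \<and> properly_self_dual n M \<Phi>M"
    unfolding M \<Phi>M using mix.group_poset_rotary mix.base_flag_in properly_self_dual_mix by blast
  ultimately show ?thesis using type by blast
qed

end
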